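(* Let $r>0$, $s>1$, $t>0$. Let $\mathcal{G}$ be a map from a subset of $\mathcal{X}$ containing $\tilde C_r^s(\mathcal{X})$ into $\mathcal{Y}$, and assume that there exist $M<\infty$ and an open set $O_{\mathbb{C}}\subseteq\mathcal{X}_{\mathbb{C}}$ containing $\tilde C_r^{s}(\mathcal{X})$ such that $\mathcal{G}$ extends to a holomorphic map $\mathcal{G}:O_{\mathbb{C}}\to\mathcal{Y}_{\mathbb{C}}$ with $\sup_{a\in O_{\mathbb{C}}}\|\mathcal{G}(a)\|_{\mathcal{Y}^t_{\mathbb{C}}}\le M$. Fix $\delta>0$ (arbitrarily small). Then there exists a constant $C>0$ such that for every $N\in\mathbb{N}$ there exists a ReLU neural network $\tilde{\boldsymbol G}_N$ of size $O(N)$ (implied constant independent of $N$) such that $$\sup_{a\in C_r^s(\mathcal{X})}\big\|\mathcal{G}(a)-\mathcal{D}(\tilde{\boldsymbol G}_N(\mathcal{E}(a)))\big\|_{\mathcal{Y}}\le C N^{-\min\{s-1,t\}+\delta}.$$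
   Context: $\mathbb{N}=\{1,2,\dots\}$. $\mathcal{X},\mathcal{Y}$ are separable real Hilbert spaces; the subscript $\mathbb{C}$ denotes complexification. $(\psi_j)_{j\in\mathbb{N}}$ is a frame of $\mathcal{X}$ with canonical dual frame $(\tilde\psi_j)_{j\in\mathbb{N}}$, and $(\eta_j)_{j\in\mathbb{N}}$ is a frame of $\mathcal{Y}$ with canonical dual frame $(\tilde\eta_j)_{j\in\mathbb{N}}$. (A sequence $(\psi_j)$ is a frame of $\mathcal{X}$ if the analysis operator $F:\mathcal{X}\to\ell^2(\mathbb{N})$, $v\mapsto(\langle v,\psi_j\rangle)_j$, is bounded and boundedly invertible onto its range; the canonical dual frame is $\tilde\psi_j=(F'F)^{-1}\psi_j$ with $F'$ the adjoint of $F$.) Encoder and decoder: $\mathcal{E}:\mathcal{X}\to\ell^2(\mathbb{N})$, $\mathcal{E}(x)=(\langle x,\tilde\psi_j\rangle)_{j\in\mathbb{N}}$; $\mathcal{D}:\ell^2(\mathbb{N})\to\mathcal{Y}$, $\mathcal{D}((y_j)_j)=\sum_{j\in\mathbb{N}}y_j\eta_j$. $(w_j)_{j\in\mathbb{N}}$ is a fixed strictly positive, monotonically decreasing sequence with $(w_j^{1+\epsilon})_j\in\ell^1(\mathbb{N})$ for all $\epsilon>0$. For $t\ge0$, $\|y\|_{\mathcal{Y}^t}^2=\sum_j|\langle y,\tilde\eta_j\rangle|^2w_j^{-2t}$, $\mathcal{Y}^t=\{y\in\mathcal{Y}:\|y\|_{\mathcal{Y}^t}<\infty\}$, and $\mathcal{Y}^t_{\mathbb{C}}$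 is its complexification (same norm formula). With $U=[-1,1]^{\mathbb{N}}$ and $\sigma_r^s:U\to\mathcal{X}$, $\sigma_r^s(\boldsymbol y)=r\sum_{j\in\mathbb{N}}w_j^sy_j\psi_j$, set $\tilde C_r^s(\mathcal{X})=\{\sigma_r^s(\boldsymbol y):\boldsymbol y\in U\}$ and $C_r^s(\mathcal{X})=\{a\in\mathcal{X}:\sup_{j}|\langle a,\tilde\psi_j\rangle|w_j^{-s}\le r\}$ (so $C_r^s(\mathcal{X})\subseteq\tilde C_r^s(\mathcal{X})$). A ReLU neural network is a map $A_L\circ\mathrm{ReLU}\circ A_{L-1}\circ\cdots\circ\mathrm{ReLU}\circ A_0:\mathbb{R}^{n_0}\to\mathbb{R}^{n_{L+1}}$, where $\mathrm{ReLU}(x)=\max\{0,x\}$ acts componentwise and $A_j(x)=W_jx+b_j$ with $W_j\in\mathbb{R}^{n_{j+1}\times n_j}$, $b_j\in\mathbb{R}^{n_{j+1}}$. Its size is the number of nonzero entries of all $W_j$ and $b_j$, $0\le j\le L$. It is viewed as a map $\ell^2(\mathbb{N})\to\ell^2(\mathbb{N})$ by applying it to the first $n_0$ components of the input and padding the output with zeros. *)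

theory Defs
  imports "HOL-Analysis.Analysis" "Jordan_Normal_Form.Matrix"
begin

section \<open>The sequence space of square-summable real sequences\<close>

text \<open>Sequences and frames indexed by the positive integers are indexed here by
  the type nat, with index 0 in the role of index 1.\<close>

typedef ell2 = "{c :: nat \<Rightarrow> real. summable (\<lambda>j. (c j)\<^sup>2)}"
  morphisms coord to_ell2
  by (rule exI [of _ "\<lambda>_. 0"]) simp

lemma summable_coord_square: "summable (\<lambda>j. (coord x j)\<^sup>2)"
  using coord by auto

lemma coord_to_ell2: "summable (\<lambda>j. (c j)\<^sup>2) \<Longrightarrow> coord (to_ell2 c) = c"
  by (simp add: to_ell2_inverse)

lemma ell2_eq_iff: "x = y \<longleftrightarrow> (\<forall>j. coord x j = coord y j)"
  by (metis coord_inject ext)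

lemma summable_mult_square:
  fixes c d :: "nat \<Rightarrow> real"
  assumes "summable (\<lambda>j. (c j)\<^sup>2)" "summable (\<lambda>j. (d j)\<^sup>2)"
  shows "summable (\<lambda>j. c j * d j)"
proof (rule summable_comparison_test')
  show "summable (\<lambda>j. (c j)\<^sup>2 + (d j)\<^sup>2)"
    using assms by (rule summable_add)
  show "norm (c j * d j) \<le> (c j)\<^sup>2 + (d j)\<^sup>2" for j
  proof -
    have "2 * \<bar>c j\<bar> * \<bar>d j\<bar> \<le> \<bar>c j\<bar>\<^sup>2 + \<bar>d j\<bar>\<^sup>2"
      by (rule sum_squares_bound)
    moreover have "0 \<le> \<bar>c j\<bar> * \<bar>d j\<bar>"
      by simp
    ultimately have "\<bar>c j\<bar> * \<bar>d j\<bar> \<le> (c j)\<^sup>2 + (d j)\<^sup>2"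
      unfolding power2_abs mult.assoc by linarith
    then show ?thesis
      by (simp add: abs_mult)
  qed
qed

lemma summable_coord_mult: "summable (\<lambda>j. coord x j * coord y j)"
  by (intro summable_mult_square summable_coord_square)

lemma summable_add_square:
  fixes c d :: "nat \<Rightarrow> real"
  assumes "summable (\<lambda>j. (c j)\<^sup>2)" "summable (\<lambda>j. (d j)\<^sup>2)"
  shows "summable (\<lambda>j. (c j + d j)\<^sup>2)"
proof -
  have "summable (\<lambda>j. (c j)\<^sup>2 + (d j)\<^sup>2 + 2 * (c j * d j))"
    using assms by (intro summable_add summable_mult summable_mult_square)
  then show ?thesis
    by (simp add: power2_sum mult.assoc)
qed

instantiation ell2 :: real_vector
begin

definition "0 = to_ell2 (\<lambda>_. 0)"
definition "x + y = to_ell2 (\<lambda>j. coord x j + coord y j)"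
definition "- x = to_ell2 (\<lambda>j. - coord x j)"
definition "x - y = to_ell2 (\<lambda>j. coord x j - coord y j)"
definition "r *\<^sub>R x = to_ell2 (\<lambda>j. r * coord x j)"

lemma coord_zero [simp]: "coord 0 j = 0"
  by (simp add: zero_ell2_def coord_to_ell2)

lemma coord_add [simp]: "coord (x + y) j = coord x j + coord y j"
  by (simp add: plus_ell2_def coord_to_ell2 summable_add_square summable_coord_square)

lemma coord_uminus [simp]: "coord (- x) j = - coord x j"
  by (simp add: uminus_ell2_def coord_to_ell2 summable_coord_square)

lemma coord_diff [simp]: "coord (x - y) j = coord x j - coord y j"
  using summable_add_square [OF summable_coord_square [of x], of "\<lambda>j. - coord y j"]
  by (simp add: minus_ell2_def coord_to_ell2 summable_coord_square)

lemma coord_scaleR [simp]: "coord (r *\<^sub>R x) j = r * coord x j"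
  by (simp add: scaleR_ell2_def coord_to_ell2 power_mult_distrib summable_mult
      summable_coord_square)

instance
  by standard (simp_all add: ell2_eq_iff algebra_simps)

end

instantiation ell2 :: real_inner
begin

definition "inner x y = (\<Sum>j. coord x j * coord y j)"
definition "norm (x :: ell2) = sqrt (inner x x)"
definition "sgn (x :: ell2) = x /\<^sub>R norm x"
definition "dist (x :: ell2) y = norm (x - y)"
definition "uniformity = (INF e\<in>{0<..}. principal {(x :: ell2, y). dist x y < e})"
definition "open (U :: ell2 set) \<longleftrightarrow>
  (\<forall>x\<in>U. eventually (\<lambda>(x', y). x' = x \<longrightarrow> y \<in> U) uniformity)"

instance
proof
  fix x y z :: ell2 and r :: real
  show "inner x y = inner y x"
    by (simp add: inner_ell2_def mult.commute)
  show "inner (x + y) z = inner x z + inner y z"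
    by (simp add: inner_ell2_def distrib_right suminf_add summable_coord_mult)
  show "inner (r *\<^sub>R x) y = r * inner x y"
    by (simp add: inner_ell2_def mult.assoc suminf_mult summable_coord_mult)
  show "0 \<le> inner x x"
    by (simp add: inner_ell2_def suminf_nonneg summable_coord_mult)
  show "inner x x = 0 \<longleftrightarrow> x = 0"
    by (simp add: inner_ell2_def suminf_eq_zero_iff summable_coord_mult ell2_eq_iff)
qed (simp_all add: norm_ell2_def sgn_ell2_def dist_ell2_def uniformity_ell2_def
      open_ell2_def)

end

section \<open>Frames, encoder and decoder\<close>

definition analysis_op :: "(nat \<Rightarrow> 'a::real_inner) \<Rightarrow> 'a \<Rightarrow> ell2" where
  "analysis_op \<psi> v = to_ell2 (\<lambda>j. inner v (\<psi> j))"

text \<open>The summability clause says that the analysis operator really takes values in the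
  sequence space; outside of it, the embedding of sequences is unspecified.\<close>

definition is_frame :: "(nat \<Rightarrow> 'a::real_inner) \<Rightarrow> bool" where
  "is_frame \<psi> \<longleftrightarrow>
     (\<forall>v. summable (\<lambda>j. (inner v (\<psi> j))\<^sup>2)) \<and>
     bounded_linear (analysis_op \<psi>) \<and>
     inj (analysis_op \<psi>) \<and>
     (\<exists>K. \<forall>c \<in> range (analysis_op \<psi>). norm (inv_into UNIV (analysis_op \<psi>) c) \<le> K * norm c)"

definition dual_frame :: "(nat \<Rightarrow> 'a::real_inner) \<Rightarrow> nat \<Rightarrow> 'a" where
  "dual_frame \<psi> j = inv_into UNIV (adjoint (analysis_op \<psi>) \<circ> analysis_op \<psi>) (\<psi> j)"

definition encoder :: "(nat \<Rightarrow> 'a::real_inner) \<Rightarrow> 'a \<Rightarrow> ell2" where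
  "encoder \<psi> x = to_ell2 (\<lambda>j. inner x (dual_frame \<psi> j))"

definition decoder :: "(nat \<Rightarrow> 'b::real_inner) \<Rightarrow> ell2 \<Rightarrow> 'b" where
  "decoder \<eta> y = (\<Sum>j. coord y j *\<^sub>R \<eta> j)"

section \<open>Complexification\<close>

text \<open>The pair (x, y) stands for x + i y. The norm of the product type is the norm of
  the complexified Hilbert space.\<close>

type_synonym 'a complexified = "'a \<times> 'a"

definition of_real_part :: "'a::real_vector \<Rightarrow> 'a complexified" where
  "of_real_part x = (x, 0)"

definition cscale :: "complex \<Rightarrow> 'a::real_vector complexified \<Rightarrow> 'a complexified" where
  "cscale c z = (Re c *\<^sub>R fst z - Im c *\<^sub>R snd z, Re c *\<^sub>R snd z + Im c *\<^sub>R fst z)"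

text \<open>The complexified inner product of z with a real vector e.\<close>

definition cinner_real :: "'a::real_inner complexified \<Rightarrow> 'a \<Rightarrow> complex" where
  "cinner_real z e = Complex (inner (fst z) e) (inner (snd z) e)"

text \<open>Holomorphy in the sense of complex Frechet differentiability: the real Frechet
  derivative (bounded and real-linear by definition) is complex-linear. Intended for open S.\<close>

definition holomorphic_map_on ::
  "('a::real_normed_vector complexified \<Rightarrow> 'b::real_normed_vector complexified) \<Rightarrow>
    'a complexified set \<Rightarrow> bool" where
  "holomorphic_map_on f S \<longleftrightarrow>
     (\<forall>z\<in>S. \<exists>f'. (f has_derivative f') (at z) \<and>
        (\<forall>c v. f' (cscale c v) = cscale c (f' v)))"

section \<open>Smoothness spaces and input sets\<close>

definition admissible_weights :: "(nat \<Rightarrow> real) \<Rightarrow> bool" where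
  "admissible_weights w \<longleftrightarrow>
     (\<forall>j. 0 < w j) \<and> decseq w \<and> (\<forall>\<epsilon>>0. summable (\<lambda>j. w j powr (1 + \<epsilon>)))"

text \<open>The complexified smoothness space and its norm. The norm is meaningful only on the
  space, as suminf is unspecified for divergent series.\<close>

definition smooth_space ::
  "(nat \<Rightarrow> real) \<Rightarrow> (nat \<Rightarrow> 'b::real_inner) \<Rightarrow> real \<Rightarrow> 'b complexified set" where
  "smooth_space w \<eta> t =
     {y. summable (\<lambda>j. (cmod (cinner_real y (dual_frame \<eta> j)))\<^sup>2 * w j powr (- 2 * t))}"

definition smooth_norm ::
  "(nat \<Rightarrow> real) \<Rightarrow> (nat \<Rightarrow> 'b::real_inner) \<Rightarrow> real \<Rightarrow> 'b complexified \<Rightarrow> real" where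
  "smooth_norm w \<eta> t y =
     sqrt (\<Sum>j. (cmod (cinner_real y (dual_frame \<eta> j)))\<^sup>2 * w j powr (- 2 * t))"

definition unit_cube :: "(nat \<Rightarrow> real) set" where
  "unit_cube = {y. \<forall>j. y j \<in> {-1..1}}"

definition sigma_map ::
  "(nat \<Rightarrow> real) \<Rightarrow> (nat \<Rightarrow> 'a::real_inner) \<Rightarrow> real \<Rightarrow> real \<Rightarrow> (nat \<Rightarrow> real) \<Rightarrow> 'a" where
  "sigma_map w \<psi> r s y = r *\<^sub>R (\<Sum>j. (w j powr s * y j) *\<^sub>R \<psi> j)"

definition cube_image ::
  "(nat \<Rightarrow> real) \<Rightarrow> (nat \<Rightarrow> 'a::real_inner) \<Rightarrow> real \<Rightarrow> real \<Rightarrow> 'a set" where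
  "cube_image w \<psi> r s = sigma_map w \<psi> r s ` unit_cube"

definition coeff_cube ::
  "(nat \<Rightarrow> real) \<Rightarrow> (nat \<Rightarrow> 'a::real_inner) \<Rightarrow> real \<Rightarrow> real \<Rightarrow> 'a set" where
  "coeff_cube w \<psi> r s = {a. \<forall>j. \<bar>inner a (dual_frame \<psi> j)\<bar> * w j powr (- s) \<le> r}"

section \<open>ReLU neural networks\<close>

text \<open>A network is the nonempty list of its affine layers, input layer first. All widths
  are positive.\<close>

type_synonym relu_net = "(real Matrix.mat \<times> real Matrix.vec) list"

fun relu_net_dims :: "nat \<Rightarrow> nat \<Rightarrow> relu_net \<Rightarrow> bool" where
  "relu_net_dims n m [] \<longleftrightarrow> False"
| "relu_net_dims n m [(W, b)] \<longleftrightarrow>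
     0 < n \<and> 0 < m \<and> W \<in> carrier_mat m n \<and> b \<in> carrier_vec m"
| "relu_net_dims n m ((W, b) # l # ls) \<longleftrightarrow>
     0 < n \<and> (\<exists>k. W \<in> carrier_mat k n \<and> b \<in> carrier_vec k \<and> relu_net_dims k m (l # ls))"

fun relu_net_eval :: "relu_net \<Rightarrow> real Matrix.vec \<Rightarrow> real Matrix.vec" where
  "relu_net_eval [] x = x"
| "relu_net_eval [(W, b)] x = W *\<^sub>v x + b"
| "relu_net_eval ((W, b) # l # ls) x =
     relu_net_eval (l # ls) (map_vec (max 0) (W *\<^sub>v x + b))"

definition layer_size :: "real Matrix.mat \<times> real Matrix.vec \<Rightarrow> nat" where
  "layer_size = (\<lambda>(W, b).
     card {(i, j). i < dim_row W \<and> j < dim_col W \<and> W $$ (i, j) \<noteq> 0} +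
     card {i. i < dim_vec b \<and> vec_index b i \<noteq> 0})"

definition relu_net_size :: "relu_net \<Rightarrow> nat" where
  "relu_net_size \<Phi> = sum_list (map layer_size \<Phi>)"

text \<open>A network with input dimension n and output dimension m as a self-map of the
  sequence space.\<close>

definition relu_net_ell2 :: "nat \<Rightarrow> nat \<Rightarrow> relu_net \<Rightarrow> ell2 \<Rightarrow> ell2" where
  "relu_net_ell2 n m \<Phi> x =
     to_ell2 (\<lambda>i. if i < m then vec_index (relu_net_eval \<Phi> (Matrix.vec n (coord x))) i else 0)"

end

(*
The cube image is compact, so the extension is bounded on balls of a fixed radius around its points.
Partition the range of the finitely many coordinates that are not small by hat functions, and use
the Taylor expansion of the map at each grid point. The expansion is indexed by words of coordinate
directions instead of multi-indices: Cauchy's estimate, iterated with shrinking balls, bounds the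
coefficient of a word by a product of weights theta over its letters, in the norm of the smoothness
space. On a fine grid the p-th powers of the weights sum to at most 1/4, with 1/p slightly below s,
so the p-th powers of the products are summable over all words.

Let beta be the product for a word. Keeping the first floor(N beta^p) output coefficients of each
word costs O(N) coefficients, and the decay of the weights w bounds the discarded part of a word by
a multiple of N^(1 - 1/p) beta^p. Only words of length O(log N) are kept. Each kept feature, a
product of O(log N) numbers in [0, 1], is computed to accuracy N^(-q) by a network of
polylogarithmic size based on Yarotsky's approximation of the square, and the polylogarithmic
factor is absorbed in delta.
*)
theory Submission
  imports Defs "HOL-Complex_Analysis.Cauchy_Integral_Formula"
begin

text \<open>Holomorphy and the bound \<open>M\<close> hold only on balls of one radius around the
  cube image, so no single power series need converge on the whole cube. Refining the first
  \<open>J\<close> coordinates by a factor \<open>H\<close> makes all displacements from a grid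
  point small against that radius, the later directions being small by summability. \<open>J\<close>
  and \<open>H\<close> depend on the map and not on N, so the number of cells enters only the
  constants.

  A word is one ordering of a monomial, so the weights of all words of length i add up to the i-th
  power of the letter sum. Multinomial coefficients disappear, at the price that the letter sum must
  be below 1 and not just finite; this is the second task of the grid.

  Put tau = 1/p - 1. A word cut after about N beta^p coefficients leaves an error of order (N
  beta^p)^(-tau) beta = N^(-tau) beta^p, because 1 - p tau = p. Hence the same sum of beta^p
  controls size and error. Summability of w^(s p) requires tau < s - 1, and the decay of w^t
  requires tau < t. The construction is run with N^g, g < 1, in place of N; the spare factor N^(1-g)
  pays for the polylogarithm.\<close>

section \<open>Computing with ReLU layers\<close>

text \<open>A layer is represented by the finite set of functions that its neurons compute from the
  network input, so that parallel networks of equal depth are combined by a union of sets and the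
  sizes add up. Every hidden layer ends with the activation, hence all values passed on are
  nonnegative and can be carried through further layers unchanged.\<close>

type_synonym fn = "(nat \<Rightarrow> real) \<Rightarrow> real"

text \<open>The extra 1 charges the bias of a neuron whether or not it vanishes, so \<open>c\<close>
  bounds all nonzero parameters of one row.\<close>

definition sparse_affine :: "fn set \<Rightarrow> nat \<Rightarrow> fn \<Rightarrow> bool" where
  "sparse_affine P c g \<longleftrightarrow>
     (\<exists>a b. g = (\<lambda>x. (\<Sum>p\<in>P. a p * p x) + b) \<and> card {p \<in> P. a p \<noteq> 0} + 1 \<le> c)"

text \<open>Nonemptiness keeps all hidden widths positive, as \<open>relu_net_dims\<close>
  demands.\<close>

definition relu_layer :: "fn set \<Rightarrow> nat \<Rightarrow> fn set \<Rightarrow> bool" where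
  "relu_layer P S F \<longleftrightarrow> finite F \<and> F \<noteq> {} \<and>
     (\<exists>cost. (\<forall>f\<in>F. \<exists>g. sparse_affine P (cost f) g \<and> f = (\<lambda>x. max 0 (g x))) \<and> sum cost F \<le> S)"

text \<open>Depth 0 only selects functions that are already present and costs nothing; the output
  matrix is added later, in \<open>relu_layers_to_net\<close>.\<close>

primrec relu_layers :: "nat \<Rightarrow> fn set \<Rightarrow> nat \<Rightarrow> fn set \<Rightarrow> bool" where
  "relu_layers 0 P S F \<longleftrightarrow> F \<subseteq> P"
| "relu_layers (Suc k) P S F \<longleftrightarrow>
     (\<exists>Q T U. relu_layer P T Q \<and> relu_layers k Q U F \<and> T + U \<le> S)"

declare relu_layers.simps(2) [simp del]

lemma relu_layers_SucE:
  assumes "relu_layers (Suc k) P S F"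
  obtains Q T U where "relu_layer P T Q" "relu_layers k Q U F" "T + U \<le> S"
  using assms unfolding relu_layers.simps(2) by blast

lemma relu_layers_SucI:
  "relu_layer P T Q \<Longrightarrow> relu_layers k Q U F \<Longrightarrow> T + U \<le> S \<Longrightarrow> relu_layers (Suc k) P S F"
  unfolding relu_layers.simps(2) by blast

lemma sparse_affine_const: "sparse_affine P 1 (\<lambda>_. b)"
  unfolding sparse_affine_def by (rule exI[of _ "\<lambda>_. 0"], rule exI[of _ b]) auto

text \<open>Neurons are assembled one summand at a time, and each summand costs one weight. This is
  why later terms keep the shape \<open>0 + 1 * f x + (-1) * g x\<close>: the introduction rules
  match it syntactically.\<close>

lemma sparse_affine_add:
  assumes "sparse_affine P c g" "finite P" "p \<in> P"
  shows "sparse_affine P (Suc c) (\<lambda>x. g x + \<alpha> * p x)"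
proof -
  obtain a b where g: "g = (\<lambda>x. (\<Sum>p\<in>P. a p * p x) + b)" and c: "card {p \<in> P. a p \<noteq> 0} + 1 \<le> c"
    using assms(1) unfolding sparse_affine_def by blast
  let ?a = "a(p := a p + \<alpha>)"
  have "(\<Sum>q\<in>P. ?a q * q x) = (\<Sum>q\<in>P. a q * q x) + \<alpha> * p x" for x
  proof -
    have "(\<Sum>q\<in>P. ?a q * q x) = (\<Sum>q\<in>P. a q * q x + (if q = p then \<alpha> * p x else 0))"
      by (rule sum.cong) (auto simp: algebra_simps)
    also have "\<dots> = (\<Sum>q\<in>P. a q * q x) + \<alpha> * p x"
      using assms by (simp add: sum.distrib)
    finally show ?thesis .
  qed
  then have "(\<lambda>x. g x + \<alpha> * p x) = (\<lambda>x. (\<Sum>q\<in>P. ?a q * q x) + b)"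
    by (auto simp: g)
  moreover have "card {q \<in> P. ?a q \<noteq> 0} \<le> card (insert p {q \<in> P. a q \<noteq> 0})"
    using assms by (intro card_mono) auto
  moreover have "\<dots> \<le> Suc (card {q \<in> P. a q \<noteq> 0})"
    by (rule card_insert_le_m1) auto
  ultimately show ?thesis
    using c unfolding sparse_affine_def by (intro exI[of _ ?a] exI[of _ b]) auto
qed

lemma sparse_affine_mono:
  assumes "sparse_affine P c g" "P \<subseteq> Q" "finite Q" "c \<le> d"
  shows "sparse_affine Q d g"
proof -
  obtain a b where g: "g = (\<lambda>x. (\<Sum>p\<in>P. a p * p x) + b)" and c: "card {p \<in> P. a p \<noteq> 0} + 1 \<le> c"
    using assms(1) unfolding sparse_affine_def by blast
  let ?a = "\<lambda>p. if p \<in> P then a p else 0"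
  have "(\<Sum>q\<in>Q. ?a q * q x) = (\<Sum>q\<in>P. a q * q x)" for x
    using assms by (intro sum.mono_neutral_cong_right) auto
  moreover have "{q \<in> Q. ?a q \<noteq> 0} = {p \<in> P. a p \<noteq> 0}"
    using assms by auto
  ultimately show ?thesis
    using c assms unfolding sparse_affine_def g by (intro exI[of _ ?a] exI[of _ b]) auto
qed

lemma relu_layer_single:
  assumes "sparse_affine P c g"
  shows "relu_layer P c {\<lambda>x. max 0 (g x)}"
  unfolding relu_layer_def using assms by (auto intro!: exI[of _ "\<lambda>_. c"])

lemma relu_layer_union:
  assumes "relu_layer P S F" "relu_layer Q T G" "finite P" "finite Q"
  shows "relu_layer (P \<union> Q) (S + T) (F \<union> G)"
proof -
  obtain u where u: "\<forall>f\<in>F. \<exists>g. sparse_affine P (u f) g \<and> f = (\<lambda>x. max 0 (g x))" "sum u F \<le> S"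
    and F: "finite F" "F \<noteq> {}"
    using assms unfolding relu_layer_def by blast
  obtain v where v: "\<forall>f\<in>G. \<exists>g. sparse_affine Q (v f) g \<and> f = (\<lambda>x. max 0 (g x))" "sum v G \<le> T"
    and G: "finite G" "G \<noteq> {}"
    using assms unfolding relu_layer_def by blast
  \<comment> \<open>A function computed by both layers is charged only once, at its price in the
    first one.\<close>
  let ?w = "\<lambda>f. if f \<in> F then u f else v f"
  have "sum ?w (F \<union> G) = sum ?w F + sum ?w (G - F)"
    using F G sum.union_disjoint[of F "G - F" ?w] by (auto simp: Un_Diff_cancel)
  also have "sum ?w F = sum u F" by simp
  also have "sum ?w (G - F) = sum v (G - F)" by simp
  also have "\<dots> \<le> sum v G"
    using G by (intro sum_mono2) auto
  finally have "sum ?w (F \<union> G) \<le> S + T"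
    using u v by simp
  moreover have "\<exists>g. sparse_affine (P \<union> Q) (?w f) g \<and> f = (\<lambda>x. max 0 (g x))" if f: "f \<in> F \<union> G" for f
  proof (cases "f \<in> F")
    case True
    then obtain g where "sparse_affine P (u f) g" "f = (\<lambda>x. max 0 (g x))"
      using bspec[OF u(1), of f] by auto
    then show ?thesis
      using True assms(3,4) sparse_affine_mono[of P "u f" g "P \<union> Q" "u f"] by auto
  next
    case False
    then obtain g where "sparse_affine Q (v f) g" "f = (\<lambda>x. max 0 (g x))"
      using bspec[OF v(1), of f] f by auto
    then show ?thesis
      using False assms(3,4) sparse_affine_mono[of Q "v f" g "P \<union> Q" "v f"] by auto
  qed
  ultimately show ?thesis
    using F G unfolding relu_layer_def by (intro conjI exI[of _ ?w]) auto
qed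

lemma relu_layer_insert:
  assumes "relu_layer P S F" "sparse_affine P c g" "finite P"
  shows "relu_layer P (c + S) (insert (\<lambda>x. max 0 (g x)) F)"
  using relu_layer_union[OF relu_layer_single[OF assms(2)] assms(1)] assms(3) by simp

lemma relu_layer_finite: "relu_layer P S F \<Longrightarrow> finite F \<and> F \<noteq> {}"
  by (simp add: relu_layer_def)

lemma relu_layers_mono:
  assumes "relu_layers k P S F" "S \<le> T"
  shows "relu_layers k P T F"
proof (cases k)
  case (Suc l)
  obtain Q U V where "relu_layer P U Q" "relu_layers l Q V F" "U + V \<le> S"
    using assms(1) unfolding Suc by (rule relu_layers_SucE)
  then show ?thesis
    using assms(2) unfolding Suc by (intro relu_layers_SucI) auto
qed (use assms in auto)

lemma relu_layers_subset:
  assumes "relu_layers k P S F" "G \<subseteq> F"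
  shows "relu_layers k P S G"
  using assms
proof (induction k arbitrary: P S)
  case (Suc k)
  obtain Q T U where Q: "relu_layer P T Q" "relu_layers k Q U F" "T + U \<le> S"
    using Suc.prems(1) by (rule relu_layers_SucE)
  then show ?case
    using Suc.IH[OF Q(2) Suc.prems(2)] by (intro relu_layers_SucI) auto
qed auto

lemma relu_layers_one: "relu_layer P S F \<Longrightarrow> S \<le> T \<Longrightarrow> relu_layers 1 P T F"
  unfolding One_nat_def by (rule relu_layers_SucI[where U = 0]) auto

lemma relu_layers_union:
  assumes "relu_layers k P S F" "relu_layers k Q T G" "finite P" "finite Q"
  shows "relu_layers k (P \<union> Q) (S + T) (F \<union> G)"
  using assms
proof (induction k arbitrary: P Q S T)
  case (Suc k)
  obtain P' S1 S2 where P': "relu_layer P S1 P'" "relu_layers k P' S2 F" "S1 + S2 \<le> S"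
    using Suc.prems(1) by (rule relu_layers_SucE)
  obtain Q' T1 T2 where Q': "relu_layer Q T1 Q'" "relu_layers k Q' T2 G" "T1 + T2 \<le> T"
    using Suc.prems(2) by (rule relu_layers_SucE)
  have "relu_layers k (P' \<union> Q') (S2 + T2) (F \<union> G)"
    using Suc.IH P' Q' by (simp add: relu_layer_finite)
  moreover have "relu_layer (P \<union> Q) (S1 + T1) (P' \<union> Q')"
    using P' Q' Suc.prems by (intro relu_layer_union) auto
  ultimately show ?case
    using P' Q' by (intro relu_layers_SucI) auto
qed auto

lemma relu_layers_Un:
  assumes "relu_layers k P S F" "relu_layers k P T G" "finite P"
  shows "relu_layers k P (S + T) (F \<union> G)"
  using relu_layers_union[OF assms assms(3)] by simp

lemma relu_layers_UNION:
  assumes "finite I" "\<And>i. i \<in> I \<Longrightarrow> relu_layers k P S {f i}" "finite P" "I \<noteq> {}"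
  shows "relu_layers k P (card I * S) (f ` I)"
  using assms(1,4,2)
proof (induction I rule: finite_ne_induct)
  case (insert i I)
  have "relu_layers k P (S + card I * S) ({f i} \<union> f ` I)"
    using insert assms by (intro relu_layers_Un) auto
  then show ?case
    using insert by simp
qed auto

lemma relu_layers_trans:
  assumes "relu_layers k P S F" "relu_layers l F T G" "finite P"
  shows "relu_layers (k + l) P (S + T) G"
  using assms
proof (induction k arbitrary: P S)
  case 0
  then have "F \<subseteq> P" by simp
  then have "relu_layers l P T G"
  proof (cases l)
    case (Suc l')
    obtain Q T1 T2 where Q: "relu_layer F T1 Q" "relu_layers l' Q T2 G" "T1 + T2 \<le> T"
      using 0(2) unfolding Suc by (rule relu_layers_SucE)
    \<comment> \<open>Enlarging the set of inputs adds only zero weights.\<close>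
    have "relu_layer P T1 Q"
      using Q(1) \<open>F \<subseteq> P\<close> 0 unfolding relu_layer_def by (meson sparse_affine_mono order_refl)
    then show ?thesis using Q unfolding Suc by (intro relu_layers_SucI)
  qed (use 0 in auto)
  then show ?case by (auto intro: relu_layers_mono)
next
  case (Suc k)
  then obtain Q S1 S2 where Q: "relu_layer P S1 Q" "relu_layers k Q S2 F" "S1 + S2 \<le> S"
    using Suc.prems(1) by (elim relu_layers_SucE)
  then have "relu_layers (k + l) Q (S2 + T) G"
    using Suc by (simp add: relu_layer_finite)
  then show ?case
    using Q unfolding add_Suc by (intro relu_layers_SucI) auto
qed

text \<open>Parallel branches need equal depth; a finished value waits at the price of one weight
  and one bias slot per layer.\<close>

lemma relu_layers_carry:
  assumes "h \<in> P" "\<And>x. 0 \<le> h x" "finite P"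
  shows "relu_layers k P (2 * k) {h}"
  using assms
proof (induction k arbitrary: P)
  case (Suc k)
  have "sparse_affine P (Suc 1) (\<lambda>x. 0 + 1 * h x)"
    using Suc.prems by (intro sparse_affine_add sparse_affine_const) auto
  from relu_layer_single[OF this] have "relu_layer P 2 {h}"
    using Suc.prems by (simp add: max_absorb2 numeral_2_eq_2)
  moreover have "relu_layers k {h} (2 * k) {h}"
    using Suc by auto
  ultimately show ?case
    by (rule relu_layers_SucI) simp
qed auto

section \<open>Approximate multiplication\<close>

text \<open>The identity v (1 - v) = T(v)/4 + T(v) (1 - T(v))/4 for the tent map T turns the parabola
  into a geometrically convergent sum over iterates of T.\<close>

definition tent :: "real \<Rightarrow> real" where
  "tent v = 1 - \<bar>2 * v - 1\<bar>"

primrec tent_sum :: "nat \<Rightarrow> real \<Rightarrow> real" where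
  "tent_sum 0 v = 0"
| "tent_sum (Suc m) v = tent_sum m v + (tent ^^ Suc m) v / 4 ^ Suc m"

lemma tent_range: "v \<in> {0..1} \<Longrightarrow> tent v \<in> {0..1}"
  by (auto simp: tent_def abs_if)

lemma tent_iter_range: "v \<in> {0..1} \<Longrightarrow> (tent ^^ m) v \<in> {0..1}"
proof (induction m)
  case (Suc m)
  then show ?case using tent_range[of "(tent ^^ m) v"] by simp
qed auto

lemma tent_identity: "v - v\<^sup>2 = tent v / 4 + (tent v - (tent v)\<^sup>2) / 4"
proof -
  have sq: "(2 * v - 1)\<^sup>2 = 4 * v\<^sup>2 - 4 * v + 1"
    by (simp add: power2_eq_square algebra_simps)
  have "(tent v)\<^sup>2 = 1 - 2 * \<bar>2 * v - 1\<bar> + (2 * v - 1)\<^sup>2"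
    unfolding tent_def by (simp add: power2_diff[of 1])
  then show ?thesis
    unfolding tent_def sq by (simp add: add_divide_distrib diff_divide_distrib)
qed

lemma tent_sum_remainder:
  "v - v\<^sup>2 = tent_sum m v + ((tent ^^ m) v - ((tent ^^ m) v)\<^sup>2) / 4 ^ m"
proof (induction m)
  case (Suc m)
  let ?t = "(tent ^^ m) v"
  have "(?t - ?t\<^sup>2) / 4 ^ m = (tent ?t / 4 + (tent ?t - (tent ?t)\<^sup>2) / 4) / 4 ^ m"
    by (subst tent_identity[of ?t]) simp
  then show ?case
    using Suc by (simp add: add_divide_distrib)
qed auto

text \<open>The remainder is t - t^2 at an iterate t of \<open>tent\<close>, which lies in [0, 1/4]
  on the unit interval; hence the extra factor 4 in the denominator.\<close>

lemma tent_sum_error: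
  assumes "v \<in> {0..1}"
  shows "\<bar>v - v\<^sup>2 - tent_sum m v\<bar> \<le> 1 / (4 * 4 ^ m)"
proof -
  let ?t = "(tent ^^ m) v"
  have t: "0 \<le> ?t" "?t \<le> 1" using tent_iter_range[OF assms, of m] by auto
  have "0 \<le> ?t * (1 - ?t)" using t by simp
  then have "0 \<le> ?t - ?t\<^sup>2" by (simp add: power2_eq_square algebra_simps)
  moreover have "0 \<le> (?t - 1/2)\<^sup>2" by simp
  then have "?t - ?t\<^sup>2 \<le> 1/4" by (simp add: power2_eq_square algebra_simps)
  ultimately have "\<bar>?t - ?t\<^sup>2\<bar> / 4 ^ m \<le> (1/4) / 4 ^ m"
    by (intro divide_right_mono) auto
  then show ?thesis
    using tent_sum_remainder[of v m] by (simp add: abs_divide)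
qed

lemma tent_sum_nonneg: "v \<in> {0..1} \<Longrightarrow> 0 \<le> tent_sum m v"
proof (induction m)
  case (Suc m)
  then show ?case using tent_iter_range[of v "Suc m"] by simp
qed auto

text \<open>With q(v) = v - v^2, d = |x - y|/2 and z = (x + y)/2, the product xy = z^2 - d^2 equals
  min x y + q(d) - q(z). The two outer maxima clip the result to [0, 1].\<close>

definition approx_mult :: "nat \<Rightarrow> real \<Rightarrow> real \<Rightarrow> real" where
  "approx_mult m x y = max 0 (1 - max 0 (1 - (min x y
     + tent_sum m (\<bar>x - y\<bar> / 2) - tent_sum m ((x + y) / 2))))"

lemma approx_mult_range: "approx_mult m x y \<in> {0..1}"
  by (auto simp: approx_mult_def)

text \<open>The two parabola errors add up to half of the bound, and clipping to [0, 1] cannot move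
  the value away from a product that lies there.\<close>

lemma approx_mult_error:
  assumes "x \<in> {0..1}" "y \<in> {0..1}"
  shows "\<bar>approx_mult m x y - x * y\<bar> \<le> 1 / 4 ^ m"
proof -
  let ?z = "(x + y) / 2" and ?d = "\<bar>x - y\<bar> / 2"
  let ?v = "min x y + tent_sum m ?d - tent_sum m ?z"
  have "\<bar>?z - ?z\<^sup>2 - tent_sum m ?z\<bar> \<le> 1 / (4 * 4 ^ m)"
    using assms by (intro tent_sum_error) auto
  moreover have "\<bar>?d - ?d\<^sup>2 - tent_sum m ?d\<bar> \<le> 1 / (4 * 4 ^ m)"
    using assms by (intro tent_sum_error) auto
  moreover have "x * y = min x y + (?d - ?d\<^sup>2) - (?z - ?z\<^sup>2)"
    by (auto simp: min_def abs_if power2_eq_square field_simps)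
  ultimately have "\<bar>?v - x * y\<bar> \<le> 1 / (4 * 4 ^ m) + 1 / (4 * 4 ^ m)"
    by linarith
  also have "\<dots> \<le> 1 / 4 ^ m" by (simp add: field_simps)
  finally have "\<bar>?v - x * y\<bar> \<le> 1 / 4 ^ m" .
  moreover have "0 \<le> x * y" "x * y \<le> 1"
    using assms by (auto simp: mult_le_one)
  ultimately show ?thesis
    unfolding approx_mult_def by linarith
qed

text \<open>The separate clause for one entry makes k factors cost k - 1 multiplications. Nesting to
  one side is affordable because depth enters the size only through carried values.\<close>

fun approx_prod :: "nat \<Rightarrow> real list \<Rightarrow> real" where
  "approx_prod m [] = 1"
| "approx_prod m [x] = x"
| "approx_prod m (x # y # zs) = approx_mult m x (approx_prod m (y # zs))"

lemma approx_prod_range: "set xs \<subseteq> {0..1} \<Longrightarrow> approx_prod m xs \<in> {0..1}"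
  by (cases "(m, xs)" rule: approx_prod.cases) (use approx_mult_range in auto)

lemma prod_list_range:
  fixes xs :: "real list"
  shows "set xs \<subseteq> {0..1} \<Longrightarrow> prod_list xs \<in> {0..1}"
  by (induction xs) (auto simp: mult_le_one)

text \<open>All factors lie in [0, 1], so an error made inside is not amplified by the later
  multiplications and the errors merely add.\<close>

lemma approx_prod_error:
  "set xs \<subseteq> {0..1} \<Longrightarrow> \<bar>approx_prod m xs - prod_list xs\<bar> \<le> real (length xs) / 4 ^ m"
proof (induction m xs rule: approx_prod.induct)
  case (3 m x y zs)
  let ?p = "approx_prod m (y # zs)" and ?q = "prod_list (y # zs)"
  have "\<bar>approx_mult m x ?p - x * ?p\<bar> \<le> 1 / 4 ^ m"
    using 3 approx_prod_range[of "y # zs" m] by (intro approx_mult_error) auto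
  moreover have "\<bar>x * ?p - x * ?q\<bar> \<le> real (length (y # zs)) / 4 ^ m"
  proof -
    have "\<bar>x * ?p - x * ?q\<bar> = x * \<bar>?p - ?q\<bar>"
      using 3 by (simp add: right_diff_distrib[symmetric] abs_mult)
    also have "\<dots> \<le> 1 * \<bar>?p - ?q\<bar>"
      using 3 by (intro mult_right_mono) auto
    finally show ?thesis using 3 by simp
  qed
  ultimately show ?case
    by (simp add: add_divide_distrib)
qed auto

text \<open>One step of the recursion behind \<open>tent_sum\<close>: the partial sum
  \<open>A\<close> travels along as an accumulator, so earlier iterates need not be kept. Here |2 v
  - 1| is the sum of the two ramps.\<close>

lemma relu_layers_tent:
  assumes "v \<in> P" "A \<in> P" "finite P" "\<And>x. v x \<in> {0..1}" "\<And>x. 0 \<le> A x" "0 \<le> c"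
  shows "relu_layers 2 P 15 {\<lambda>x. tent (v x), \<lambda>x. A x + c * tent (v x)}"
proof -
  let ?p = "\<lambda>x. max 0 (-1 + 2 * v x)" and ?n = "\<lambda>x. max 0 (1 + (-2) * v x)"
  let ?A = "\<lambda>x. max 0 (0 + 1 * A x)"
  let ?Q = "{?p, ?n, ?A}"
  have 1: "relu_layer P (Suc 1 + (Suc 1 + Suc 1)) ?Q"
    using assms by (intro relu_layer_insert relu_layer_single sparse_affine_add sparse_affine_const)
  have "relu_layer ?Q (Suc (Suc 1) + Suc (Suc (Suc 1)))
     {\<lambda>x. max 0 (1 + (-1) * ?p x + (-1) * ?n x), \<lambda>x. max 0 (c + 1 * ?A x + (-c) * ?p x + (-c) * ?n x)}"
    by (intro relu_layer_insert relu_layer_single sparse_affine_add sparse_affine_const) auto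
  moreover have t: "tent (v x) = 1 + (-1) * ?p x + (-1) * ?n x" for x
    by (auto simp: tent_def)
  have "max 0 (1 + (-1) * ?p x + (-1) * ?n x) = tent (v x)" for x
    using tent_range[OF assms(4), of x] by (simp only: t[symmetric]) (simp add: max_def)
  moreover have "max 0 (c + 1 * ?A x + (-c) * ?p x + (-c) * ?n x) = A x + c * tent (v x)" for x
  proof -
    have "c + 1 * ?A x + (-c) * ?p x + (-c) * ?n x = A x + c * tent (v x)"
      unfolding t using assms(5)[of x] by (simp add: algebra_simps)
    moreover have "0 \<le> A x + c * tent (v x)"
      using tent_range[OF assms(4), of x] assms by simp
    ultimately show ?thesis by simp
  qed
  ultimately have 2: "relu_layer ?Q 7 {\<lambda>x. tent (v x), \<lambda>x. A x + c * tent (v x)}"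
    by (simp add: eval_nat_numeral)
  have "relu_layers (1 + 1) P (6 + 7) {\<lambda>x. tent (v x), \<lambda>x. A x + c * tent (v x)}"
    by (rule relu_layers_trans[OF relu_layers_one[OF 1] relu_layers_one[OF 2]]) (use assms in auto)
  then have "relu_layers 2 P (6 + 7) {\<lambda>x. tent (v x), \<lambda>x. A x + c * tent (v x)}"
    by (simp only: one_add_one)
  then show ?thesis
    by (rule relu_layers_mono) simp
qed

lemma relu_layers_tent_sum:
  assumes "v \<in> P" "A \<in> P" "finite P" "\<And>x. v x \<in> {0..1}" "\<And>x. 0 \<le> A x"
  shows "relu_layers (2 * m) P (15 * m) {\<lambda>x. (tent ^^ m) (v x), \<lambda>x. A x + tent_sum m (v x)}"
proof (induction m)
  case (Suc m)
  let ?Q = "{\<lambda>x. (tent ^^ m) (v x), \<lambda>x. A x + tent_sum m (v x)}"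
  have "relu_layers 2 ?Q 15 {\<lambda>x. tent ((tent ^^ m) (v x)),
      \<lambda>x. (A x + tent_sum m (v x)) + (1 / 4 ^ Suc m) * tent ((tent ^^ m) (v x))}"
    using tent_iter_range[OF assms(4)] tent_sum_nonneg[OF assms(4)] assms(5)
    by (intro relu_layers_tent) auto
  from relu_layers_trans[OF Suc this] show ?case
    using assms by (simp add: algebra_simps)
qed (use assms in auto)

lemma relu_layers_approx_mult:
  assumes "f \<in> P" "g \<in> P" "finite P" "\<And>x. f x \<in> {0..1}" "\<And>x. g x \<in> {0..1}"
  shows "relu_layers (2 * m + 4) P (34 * m + 30) {\<lambda>x. approx_mult m (f x) (g x)}"
proof -
  let ?z = "\<lambda>x. (f x + g x) / 2" and ?d = "\<lambda>x. \<bar>f x - g x\<bar> / 2"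
    and ?mn = "\<lambda>x. min (f x) (g x)"
  let ?z' = "\<lambda>x. max 0 (0 + (1/2) * f x + (1/2) * g x)"
    and ?d1 = "\<lambda>x. max 0 (0 + 1 * f x + (-1) * g x)"
    and ?d2 = "\<lambda>x. max 0 (0 + (-1) * f x + 1 * g x)"
  \<comment> \<open>Since min = z - d, the minimum is available after two layers; it starts the
    accumulator of the sum at \<open>?d\<close>, and the constant 0 that of the sum at
    \<open>?z\<close>.\<close>
  let ?Q1 = "{?z', ?d1, ?d2}" and ?Q2 = "{?z, ?d, ?mn, \<lambda>x. 0}"
  have "relu_layer P (Suc (Suc 1) + (Suc (Suc 1) + Suc (Suc 1))) ?Q1"
    using assms by (intro relu_layer_insert relu_layer_single sparse_affine_add sparse_affine_const)
  then have L1: "relu_layers 1 P 9 ?Q1" by (rule relu_layers_one) simp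
  have "relu_layer ?Q1 (Suc 1 + (Suc (Suc 1) + (Suc (Suc (Suc 1)) + 1)))
     {\<lambda>x. max 0 (0 + 1 * ?z' x), \<lambda>x. max 0 (0 + (1/2) * ?d1 x + (1/2) * ?d2 x),
      \<lambda>x. max 0 (0 + 1 * ?z' x + (-1/2) * ?d1 x + (-1/2) * ?d2 x), \<lambda>x. max 0 0}"
    by (intro relu_layer_insert relu_layer_single sparse_affine_add sparse_affine_const) auto
  moreover have e1: "(\<lambda>x. max 0 (0 + 1 * ?z' x)) = ?z"
  proof
    show "max 0 (0 + 1 * ?z' x) = ?z x" for x
      using assms(4,5)[of x] by auto
  qed
  moreover have e2: "(\<lambda>x. max 0 (0 + (1/2) * ?d1 x + (1/2) * ?d2 x)) = ?d"
    by (auto simp: max_def)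
  moreover have e3: "(\<lambda>x. max 0 (0 + 1 * ?z' x + (-1/2) * ?d1 x + (-1/2) * ?d2 x)) = ?mn"
  proof
    show "max 0 (0 + 1 * ?z' x + (-1/2) * ?d1 x + (-1/2) * ?d2 x) = ?mn x" for x
      using assms(4,5)[of x] by (auto simp: max_def min_def field_simps)
  qed
  ultimately have "relu_layer ?Q1 (Suc 1 + (Suc (Suc 1) + (Suc (Suc (Suc 1)) + 1))) ?Q2"
    by (simp only: max.idem)
  then have L2: "relu_layers 1 ?Q1 10 ?Q2" by (rule relu_layers_one) simp
  let ?qd = "\<lambda>x. ?mn x + tent_sum m (?d x)" and ?qz = "\<lambda>x. 0 + tent_sum m (?z x)"
  have r: "?z x \<in> {0..1}" "?d x \<in> {0..1}" "0 \<le> ?mn x" for x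
    using assms(4,5)[of x] by auto
  have "relu_layers (2 * m) ?Q2 (15 * m) {\<lambda>x. (tent ^^ m) (?d x), ?qd}"
    using r by (intro relu_layers_tent_sum) auto
  then have "relu_layers (2 * m) ?Q2 (15 * m) {?qd}"
    by (rule relu_layers_subset) auto
  moreover have "relu_layers (2 * m) ?Q2 (15 * m) {\<lambda>x. (tent ^^ m) (?z x), ?qz}"
    using r by (intro relu_layers_tent_sum) auto
  then have "relu_layers (2 * m) ?Q2 (15 * m) {?qz}"
    by (rule relu_layers_subset) auto
  ultimately have L3: "relu_layers (2 * m) ?Q2 (15 * m + 15 * m) ({?qd} \<union> {?qz})"
    by (rule relu_layers_Un) auto
  let ?u = "\<lambda>x. max 0 (1 + (-1) * ?qd x + 1 * ?qz x)"
  let ?w = "\<lambda>x. max 0 (1 + (-1) * ?u x)"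
  have "relu_layer ({?qd} \<union> {?qz}) (Suc (Suc 1)) {?u}"
    by (intro relu_layer_single sparse_affine_add sparse_affine_const) auto
  then have L4: "relu_layers 1 ({?qd} \<union> {?qz}) 3 {?u}" by (rule relu_layers_one) simp
  have "relu_layer {?u} (Suc 1) {?w}"
    by (intro relu_layer_single sparse_affine_add sparse_affine_const) auto
  then have L5: "relu_layers 1 {?u} 2 {?w}" by (rule relu_layers_one) simp
  have "relu_layers (1 + (1 + (2 * m + (1 + 1)))) P (9 + (10 + ((15 * m + 15 * m) + (3 + 2)))) {?w}"
    by (rule relu_layers_trans[OF L1 relu_layers_trans[OF L2 relu_layers_trans[OF L3 relu_layers_trans[OF L4 L5]]]])
      (use assms in auto)
  moreover have "1 + (1 + (2 * m + (1 + 1))) = 2 * m + 4"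
      "9 + (10 + ((15 * m + 15 * m) + (3 + 2))) = 30 * m + 24"
    by simp_all
  ultimately have "relu_layers (2 * m + 4) P (30 * m + 24) {?w}"
    by (simp only:)
  moreover have "?w = (\<lambda>x. approx_mult m (f x) (g x))"
    unfolding approx_mult_def by (simp add: algebra_simps)
  ultimately show ?thesis
    by (auto intro: relu_layers_mono)
qed

text \<open>The square comes from carrying: each factor waits until the product of the factors to
  its right is complete.\<close>

lemma relu_layers_approx_prod:
  assumes "finite P" "\<And>f x. f \<in> P \<Longrightarrow> f x \<in> {0..1}" "set fs \<subseteq> P" "fs \<noteq> []"
  shows "relu_layers ((length fs - 1) * (2 * m + 4)) P (length fs ^ 2 * (38 * m + 38))
    {\<lambda>x. approx_prod m (map (\<lambda>f. f x) fs)}"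
  using assms(3,4)
proof (induction fs)
  case (Cons f fs)
  show ?case
  proof (cases fs)
    case (Cons g gs)
    let ?k = "(length fs - 1) * (2 * m + 4)"
    let ?p = "\<lambda>x. approx_prod m (map (\<lambda>f. f x) fs)"
    have "relu_layers ?k P (length fs ^ 2 * (38 * m + 38)) {?p}"
      using Cons.IH Cons.prems Cons by auto
    moreover have "relu_layers ?k P (2 * ?k) {f}"
      using assms Cons.prems by (intro relu_layers_carry) auto
    ultimately have 1: "relu_layers ?k P (length fs ^ 2 * (38 * m + 38) + 2 * ?k) ({?p} \<union> {f})"
      using assms by (intro relu_layers_Un) auto
    have "set (map (\<lambda>f. f x) fs) \<subseteq> {0..1}" for x
      using assms Cons.prems by auto
    then have 2: "relu_layers (2 * m + 4) ({?p} \<union> {f}) (34 * m + 30) {\<lambda>x. approx_mult m (f x) (?p x)}"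
      using assms Cons.prems by (intro relu_layers_approx_mult approx_prod_range) auto
    have "relu_layers (?k + (2 * m + 4)) P (length fs ^ 2 * (38 * m + 38) + 2 * ?k + (34 * m + 30))
        {\<lambda>x. approx_mult m (f x) (?p x)}"
      using relu_layers_trans[OF 1 2] assms by simp
    moreover have "?k + (2 * m + 4) = (length (f # fs) - 1) * (2 * m + 4)"
      using Cons by simp
    ultimately have 3: "relu_layers ((length (f # fs) - 1) * (2 * m + 4)) P
        (length fs ^ 2 * (38 * m + 38) + 2 * ?k + (34 * m + 30)) {\<lambda>x. approx_mult m (f x) (?p x)}"
      by (simp only:)
    have 4: "length fs ^ 2 * (38 * m + 38) + 2 * ?k + (34 * m + 30)
        \<le> length (f # fs) ^ 2 * (38 * m + 38)"
      using Cons by (simp add: power2_eq_square algebra_simps)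
    show ?thesis
      using relu_layers_mono[OF 3 4] Cons by simp
  qed (use Cons in auto)
qed auto


section \<open>From layers of functions to matrices\<close>

text \<open>Enumerating each function set by a distinct list turns a layer into a matrix. The list
  \<open>ps\<close> varies in the induction since the first layer is peeled off, and the
  coefficients \<open>A\<close> become a last affine layer with zero bias.\<close>

lemma relu_layers_to_net:
  fixes A :: "nat \<Rightarrow> fn \<Rightarrow> real"
  assumes "relu_layers k (set ps) S F" "distinct ps" "ps \<noteq> []" "0 < m"
  shows "\<exists>\<Phi>. relu_net_dims (length ps) m \<Phi> \<and>
    relu_net_size \<Phi> \<le> S + card {(j, f). j < m \<and> f \<in> F \<and> A j f \<noteq> 0} \<and>
    (\<forall>x. relu_net_eval \<Phi> (Matrix.vec (length ps) (\<lambda>i. (ps ! i) x)) =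
      Matrix.vec m (\<lambda>j. \<Sum>f\<in>F. A j f * f x))"
  using assms
proof (induction k arbitrary: ps S)
  case 0
  let ?n = "length ps"
  have F: "F \<subseteq> set ps" "finite F" using 0 by (auto intro: finite_subset)
  define W where "W = Matrix.mat m ?n (\<lambda>(j, i). if ps ! i \<in> F then A j (ps ! i) else 0)"
  have W: "W \<in> carrier_mat m ?n" by (simp add: W_def)
  have "card {(j, i). j < m \<and> i < ?n \<and> W $$ (j, i) \<noteq> 0} \<le> card {(j, f). j < m \<and> f \<in> F \<and> A j f \<noteq> 0}"
  proof (rule card_inj_on_le)
    show "inj_on (\<lambda>(j, i). (j, ps ! i)) {(j, i). j < m \<and> i < ?n \<and> W $$ (j, i) \<noteq> 0}"
      using 0 by (auto simp: inj_on_def nth_eq_iff_index_eq)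
    show "(\<lambda>(j, i). (j, ps ! i)) ` {(j, i). j < m \<and> i < ?n \<and> W $$ (j, i) \<noteq> 0}
        \<subseteq> {(j, f). j < m \<and> f \<in> F \<and> A j f \<noteq> 0}"
      by (auto simp: W_def split: if_splits)
    show "finite {(j, f). j < m \<and> f \<in> F \<and> A j f \<noteq> 0}"
      by (rule finite_subset[of _ "{..<m} \<times> F"]) (use F in auto)
  qed
  moreover have "relu_net_eval [(W, 0\<^sub>v m)] (Matrix.vec ?n (\<lambda>i. (ps ! i) x)) =
      Matrix.vec m (\<lambda>j. \<Sum>f\<in>F. A j f * f x)" for x
  proof (rule eq_vecI)
    fix j assume "j < dim_vec (Matrix.vec m (\<lambda>j. \<Sum>f\<in>F. A j f * f x))"
    then have j: "j < m" by simp
    have "vec_index (relu_net_eval [(W, 0\<^sub>v m)] (Matrix.vec ?n (\<lambda>i. (ps ! i) x))) j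
        = (\<Sum>i<?n. (if ps ! i \<in> F then A j (ps ! i) else 0) * (ps ! i) x)"
      using j by (simp add: W_def scalar_prod_def atLeast0LessThan)
    also have "\<dots> = (\<Sum>f\<in>set ps. (if f \<in> F then A j f else 0) * f x)"
      using 0 by (intro sum.reindex_bij_betw bij_betw_nth) auto
    also have "\<dots> = (\<Sum>f\<in>F. A j f * f x)"
      using F by (intro sum.mono_neutral_cong_right) auto
    finally show "vec_index (relu_net_eval [(W, 0\<^sub>v m)] (Matrix.vec ?n (\<lambda>i. (ps ! i) x))) j =
        vec_index (Matrix.vec m (\<lambda>j. \<Sum>f\<in>F. A j f * f x)) j"
      using j by simp
  qed (use W in auto)
  moreover have "{i. i < m \<and> vec_index (0\<^sub>v m :: real Matrix.vec) i \<noteq> 0} = {}"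
    by auto
  then have "relu_net_size [(W, 0\<^sub>v m)] = card {(j, i). j < m \<and> i < ?n \<and> W $$ (j, i) \<noteq> 0}"
    using W by (simp add: relu_net_size_def layer_size_def)
  moreover have "relu_net_dims ?n m [(W, 0\<^sub>v m)]"
    using 0 W by simp
  ultimately show ?case
    by (intro exI[of _ "[(W, 0\<^sub>v m)]"] conjI allI) linarith+
next
  case (Suc k)
  let ?n = "length ps"
  obtain Q T U where Q: "relu_layer (set ps) T Q" "relu_layers k Q U F" "T + U \<le> S"
    using Suc.prems(1) by (rule relu_layers_SucE)
  obtain cost where cost: "\<forall>f\<in>Q. \<exists>g. sparse_affine (set ps) (cost f) g \<and> f = (\<lambda>x. max 0 (g x))"
    "sum cost Q \<le> T" and Qf: "finite Q" "Q \<noteq> {}"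
    using Q(1) unfolding relu_layer_def by blast
  \<comment> \<open>Weights and bias are coded as one pair so that a single choice suffices.\<close>
  have "\<forall>f\<in>Q. \<exists>h. f = (\<lambda>x. max 0 ((\<Sum>p\<in>set ps. fst h p * p x) + snd h)) \<and>
      card {p \<in> set ps. fst h p \<noteq> 0} + 1 \<le> cost f"
  proof
    fix f assume f: "f \<in> Q"
    obtain g where g: "sparse_affine (set ps) (cost f) g" "f = (\<lambda>x. max 0 (g x))"
      using bspec[OF cost(1) f] by (elim exE conjE)
    obtain a b where "g = (\<lambda>x. (\<Sum>p\<in>set ps. a p * p x) + b)"
        "card {p \<in> set ps. a p \<noteq> 0} + 1 \<le> cost f"
      using g(1) unfolding sparse_affine_def by (elim exE conjE)
    with g(2) show "\<exists>h. f = (\<lambda>x. max 0 ((\<Sum>p\<in>set ps. fst h p * p x) + snd h)) \<and>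
        card {p \<in> set ps. fst h p \<noteq> 0} + 1 \<le> cost f"
      by (intro exI[of _ "(a, b)"]) simp
  qed
  from bchoice[OF this] obtain h where h: "\<forall>f\<in>Q. f = (\<lambda>x. max 0 ((\<Sum>p\<in>set ps. fst (h f) p * p x) + snd (h f))) \<and>
      card {p \<in> set ps. fst (h f) p \<noteq> 0} + 1 \<le> cost f" by (elim exE)
  define a where "a f = fst (h f)" for f
  define b where "b f = snd (h f)" for f
  have ab: "f = (\<lambda>x. max 0 ((\<Sum>p\<in>set ps. a f p * p x) + b f))"
    "card {p \<in> set ps. a f p \<noteq> 0} + 1 \<le> cost f" if "f \<in> Q" for f
    using conjunct1[OF bspec[OF h that]] conjunct2[OF bspec[OF h that]]
    unfolding a_def b_def by - assumption+
  obtain qs where qs: "set qs = Q" "distinct qs"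
    using finite_distinct_list[OF Qf(1)] by auto
  let ?l = "length qs"
  have "qs \<noteq> []" using qs Qf by auto
  then obtain \<Phi> where \<Phi>: "relu_net_dims ?l m \<Phi>"
    "relu_net_size \<Phi> \<le> U + card {(j, f). j < m \<and> f \<in> F \<and> A j f \<noteq> 0}"
    "\<And>x. relu_net_eval \<Phi> (Matrix.vec ?l (\<lambda>i. (qs ! i) x)) = Matrix.vec m (\<lambda>j. \<Sum>f\<in>F. A j f * f x)"
    using Suc.IH[of qs U] Q qs Suc.prems by auto
  define W where "W = Matrix.mat ?l ?n (\<lambda>(i, j). a (qs ! i) (ps ! j))"
  define c where "c = Matrix.vec ?l (\<lambda>i. b (qs ! i))"
  have W: "W \<in> carrier_mat ?l ?n" "c \<in> carrier_vec ?l" by (simp_all add: W_def c_def)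
  have "layer_size (W, c) \<le> T"
  proof -
    have row: "card {j. j < ?n \<and> a f (ps ! j) \<noteq> 0} + 1 \<le> cost f" if "f \<in> Q" for f
    proof -
      have "card {j. j < ?n \<and> a f (ps ! j) \<noteq> 0} \<le> card {p \<in> set ps. a f p \<noteq> 0}"
        by (rule card_inj_on_le[where f = "\<lambda>j. ps ! j"])
          (use Suc.prems in \<open>auto simp: inj_on_def nth_eq_iff_index_eq\<close>)
      then show ?thesis using ab(2)[OF that] by simp
    qed
    have "{(i, j). i < dim_row W \<and> j < dim_col W \<and> W $$ (i, j) \<noteq> 0} =
        (SIGMA i:{..<?l}. {j. j < ?n \<and> a (qs ! i) (ps ! j) \<noteq> 0})"
      by (auto simp: W_def)
    then have "card {(i, j). i < dim_row W \<and> j < dim_col W \<and> W $$ (i, j) \<noteq> 0} =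
        (\<Sum>i<?l. card {j. j < ?n \<and> a (qs ! i) (ps ! j) \<noteq> 0})"
      by (simp only:) (subst card_SigmaI, auto)
    moreover have "card {i. i < dim_vec c \<and> vec_index c i \<noteq> 0} \<le> card {..<?l}"
      by (intro card_mono) (auto simp: c_def)
    ultimately have "layer_size (W, c) \<le> (\<Sum>i<?l. card {j. j < ?n \<and> a (qs ! i) (ps ! j) \<noteq> 0} + 1)"
      unfolding layer_size_def sum.distrib by simp
    also have "\<dots> \<le> (\<Sum>i<?l. cost (qs ! i))"
      by (intro sum_mono row) (use qs in auto)
    also have "\<dots> = sum cost Q"
      unfolding qs(1)[symmetric] by (intro sum.reindex_bij_betw bij_betw_nth) (use qs in auto)
    finally show ?thesis using cost by simp
  qed
  then have "relu_net_size ((W, c) # \<Phi>) \<le> S + card {(j, f). j < m \<and> f \<in> F \<and> A j f \<noteq> 0}"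
    using \<Phi>(2) Q(3) by (simp add: relu_net_size_def)
  moreover have "relu_net_dims ?n m ((W, c) # \<Phi>)"
    using \<Phi>(1) W Suc.prems by (cases \<Phi>) auto
  moreover have "relu_net_eval ((W, c) # \<Phi>) (Matrix.vec ?n (\<lambda>i. (ps ! i) x)) =
      Matrix.vec m (\<lambda>j. \<Sum>f\<in>F. A j f * f x)" for x
  proof -
    have "map_vec (max 0) (W *\<^sub>v Matrix.vec ?n (\<lambda>i. (ps ! i) x) + c) = Matrix.vec ?l (\<lambda>i. (qs ! i) x)"
    proof (rule eq_vecI)
      fix i assume "i < dim_vec (Matrix.vec ?l (\<lambda>i. (qs ! i) x))"
      then have i: "i < ?l" by simp
      have "vec_index (W *\<^sub>v Matrix.vec ?n (\<lambda>i. (ps ! i) x) + c) i =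
          (\<Sum>j<?n. a (qs ! i) (ps ! j) * (ps ! j) x) + b (qs ! i)"
        using i by (simp add: W_def c_def scalar_prod_def atLeast0LessThan)
      also have "(\<Sum>j<?n. a (qs ! i) (ps ! j) * (ps ! j) x) = (\<Sum>p\<in>set ps. a (qs ! i) p * p x)"
        using Suc.prems by (intro sum.reindex_bij_betw bij_betw_nth) auto
      finally have "vec_index (map_vec (max 0) (W *\<^sub>v Matrix.vec ?n (\<lambda>i. (ps ! i) x) + c)) i =
          max 0 ((\<Sum>p\<in>set ps. a (qs ! i) p * p x) + b (qs ! i))"
        using i W by simp
      also have "\<dots> = (qs ! i) x"
        using fun_cong[OF ab(1)[of "qs ! i"], of x] i qs by auto
      finally show "vec_index (map_vec (max 0) (W *\<^sub>v Matrix.vec ?n (\<lambda>i. (ps ! i) x) + c)) i =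
          vec_index (Matrix.vec ?l (\<lambda>i. (qs ! i) x)) i"
        using i by simp
    qed (use W in auto)
    then show ?thesis
      using \<Phi>(1) \<Phi>(3)[of x] by (cases \<Phi>) auto
  qed
  ultimately show ?case by blast
qed

text \<open>Hat functions and affine functions clipped to [0, 1] both have this form.\<close>

type_synonym factor = "nat \<times> real \<times> real \<times> real \<times> real"

fun factor_eval :: "factor \<Rightarrow> fn" where
  "factor_eval (i, a, b, c, d) = (\<lambda>x. max 0 (1 - max 0 (a * x i + b) - max 0 (c * x i + d)))"

lemma factor_eval_range: "factor_eval u x \<in> {0..1}"
  by (cases u) auto

lemma relu_layers_factor:
  assumes "fst u < n"
  shows "relu_layers 2 ((\<lambda>i x. x i) ` {..<n}) 7 {factor_eval u}"
proof -
  obtain i a b c d where u: "u = (i, a, b, c, d)" by (cases u)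
  let ?P = "(\<lambda>i x. x i) ` {..<n} :: fn set"
  let ?f = "\<lambda>x :: nat \<Rightarrow> real. max 0 (b + a * x i)" and ?g = "\<lambda>x :: nat \<Rightarrow> real. max 0 (d + c * x i)"
  have "relu_layer ?P (Suc 1 + Suc 1) {?f, ?g}"
    using assms u by (intro relu_layer_insert relu_layer_single sparse_affine_add sparse_affine_const) auto
  then have 1: "relu_layers 1 ?P 4 {?f, ?g}"
    by (rule relu_layers_one) simp
  have "relu_layer {?f, ?g} (Suc (Suc 1)) {\<lambda>x. max 0 (1 + (-1) * ?f x + (-1) * ?g x)}"
    by (intro relu_layer_single sparse_affine_add sparse_affine_const) auto
  moreover have "(\<lambda>x. max 0 (1 + (-1) * ?f x + (-1) * ?g x)) = factor_eval u"
    by (auto simp: u algebra_simps)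
  ultimately have 2: "relu_layers 1 {?f, ?g} 3 {factor_eval u}"
    by (simp only:) (rule relu_layers_one, auto)
  have "relu_layers (1 + 1) ?P (4 + 3) {factor_eval u}"
    by (rule relu_layers_trans[OF 1 2]) simp
  then have "relu_layers 2 ?P (4 + 3) {factor_eval u}"
    by (simp only: one_add_one)
  then show ?thesis
    by (rule relu_layers_mono) simp
qed

text \<open>\<open>L\<close> is both the accuracy of the multiplications and, in all uses, the
  number of factors; this gives error L / 4^L at a size of order L^3.\<close>

definition approx_feature :: "nat \<Rightarrow> factor list \<Rightarrow> fn" where
  "approx_feature L us x = approx_prod L (map (\<lambda>u. factor_eval u x) us)"

text \<open>The depth depends on \<open>L\<close> alone because all lists have length
  \<open>L\<close>; this allows different features to run in parallel. Of the constant 90, the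
  factors use 7 and the product 76.\<close>

lemma relu_layers_approx_feature:
  assumes "\<And>u. u \<in> set us \<Longrightarrow> fst u < n" "length us = L" "0 < L"
  shows "relu_layers (2 + (L - 1) * (2 * L + 4)) ((\<lambda>i x. x i) ` {..<n}) (90 * L ^ 3)
    {approx_feature L us}"
proof -
  let ?P = "(\<lambda>i x. x i) ` {..<n} :: fn set"
  have ne: "us \<noteq> []" using assms by auto
  have 1: "relu_layers 2 ?P (card (set us) * 7) (factor_eval ` set us)"
    using ne by (intro relu_layers_UNION relu_layers_factor assms) auto
  have "relu_layers ((length (map factor_eval us) - 1) * (2 * L + 4)) (factor_eval ` set us)
      (length (map factor_eval us) ^ 2 * (38 * L + 38))
      {\<lambda>x. approx_prod L (map (\<lambda>f. f x) (map factor_eval us))}"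
    using ne factor_eval_range by (intro relu_layers_approx_prod) auto
  moreover have "(\<lambda>x. approx_prod L (map (\<lambda>f. f x) (map factor_eval us))) = approx_feature L us"
    by (simp add: approx_feature_def comp_def fun_eq_iff)
  ultimately have 2: "relu_layers ((L - 1) * (2 * L + 4)) (factor_eval ` set us)
      (L\<^sup>2 * (38 * L + 38)) {approx_feature L us}"
    using assms(2) by (simp only: length_map)
  have *: "relu_layers (2 + (L - 1) * (2 * L + 4)) ?P
      (card (set us) * 7 + L\<^sup>2 * (38 * L + 38)) {approx_feature L us}"
    by (rule relu_layers_trans[OF 1 2]) simp
  have "card (set us) \<le> L" using card_length[of us] assms by simp
  also have "L \<le> L ^ 3" using assms by (simp add: self_le_power)
  finally have "card (set us) * 7 \<le> 7 * L ^ 3" by simp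
  moreover have "L\<^sup>2 \<le> L ^ 3" using assms by (intro power_increasing) auto
  then have "L\<^sup>2 * (38 * L + 38) \<le> 76 * L ^ 3"
    by (simp add: algebra_simps power2_eq_square power3_eq_cube)
  ultimately show ?thesis
    using relu_layers_mono[OF *, of "90 * L ^ 3"] by simp
qed

lemma approx_feature_error:
  assumes "length us = L"
  shows "\<bar>approx_feature L us x - prod_list (map (\<lambda>u. factor_eval u x) us)\<bar> \<le> real L / 4 ^ L"
proof -
  have "set (map (\<lambda>u. factor_eval u x) us) \<subseteq> {0..1}"
    unfolding set_map image_subset_iff using factor_eval_range by blast
  from approx_prod_error[OF this, of L] show ?thesis
    unfolding approx_feature_def using assms by simp
qed

text \<open>Output j reads feature q only for j < \<open>d q\<close>, so the last layer has at most
  the sum of \<open>d\<close> nonzero entries, however large the output dimension \<open>m\<close>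
  is.\<close>

theorem feature_network:
  fixes B :: "'q \<Rightarrow> nat \<Rightarrow> real" and us :: "'q \<Rightarrow> factor list"
  assumes "finite Q" "Q \<noteq> {}" "0 < L" "0 < n" "0 < m"
    and "\<And>q. q \<in> Q \<Longrightarrow> length (us q) = L"
    and "\<And>q u. q \<in> Q \<Longrightarrow> u \<in> set (us q) \<Longrightarrow> fst u < n"
  shows "\<exists>\<Phi>. relu_net_dims n m \<Phi> \<and>
    relu_net_size \<Phi> \<le> card Q * (90 * L ^ 3) + (\<Sum>q\<in>Q. d q) \<and>
    (\<forall>x. relu_net_eval \<Phi> (Matrix.vec n x) =
      Matrix.vec m (\<lambda>j. \<Sum>q\<in>Q. if j < d q then B q j * approx_feature L (us q) x else 0))"
proof -
  define ps :: "fn list" where "ps = map (\<lambda>i x. x i) [0..<n]"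
  have ps: "set ps = (\<lambda>i x. x i) ` {..<n}" "length ps = n"
    by (auto simp: ps_def atLeast0LessThan)
  have inj: "inj (\<lambda>i (x :: nat \<Rightarrow> real). x i)"
  proof (rule injI)
    fix i j assume "(\<lambda>x :: nat \<Rightarrow> real. x i) = (\<lambda>x. x j)"
    from fun_cong[OF this, of "\<lambda>k. if k = i then 1 else 0"] show "i = j"
      by (auto split: if_splits)
  qed
  have "distinct ps"
    by (simp add: ps_def distinct_map inj_on_subset[OF inj])
  let ?f = "\<lambda>q. approx_feature L (us q)"
  let ?B = "\<lambda>j q. if j < d q then B q j else 0"
  \<comment> \<open>Different indices may yield the same function, hence the sum over the
    fibre.\<close>
  let ?A = "\<lambda>j f. \<Sum>q\<in>{q \<in> Q. ?f q = f}. ?B j q"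
  have layers: "relu_layers (2 + (L - 1) * (2 * L + 4)) (set ps) (card Q * (90 * L ^ 3)) (?f ` Q)"
    unfolding ps(1) using assms by (intro relu_layers_UNION relu_layers_approx_feature) auto
  have "ps \<noteq> []"
  proof
    assume "ps = []"
    then show False using ps(2) assms(4) by simp
  qed
  note net = relu_layers_to_net[OF layers \<open>distinct ps\<close> this assms(5), of ?A, unfolded ps(2)]
  obtain \<Phi> where \<Phi>': "relu_net_dims n m \<Phi> \<and>
    relu_net_size \<Phi> \<le> card Q * (90 * L ^ 3) + card {(j, f). j < m \<and> f \<in> ?f ` Q \<and> ?A j f \<noteq> 0} \<and>
    (\<forall>x. relu_net_eval \<Phi> (Matrix.vec n (\<lambda>i. (ps ! i) x)) =
      Matrix.vec m (\<lambda>j. \<Sum>f\<in>?f ` Q. ?A j f * f x))"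
    by (rule exE[OF net])
  note \<Phi> = conjunct1[OF \<Phi>'] conjunct1[OF conjunct2[OF \<Phi>']] conjunct2[OF conjunct2[OF \<Phi>']]
  have "card {(j, f). j < m \<and> f \<in> ?f ` Q \<and> ?A j f \<noteq> 0} \<le> card (SIGMA q:Q. {..<d q})"
  proof (rule surj_card_le)
    show "{(j, f). j < m \<and> f \<in> ?f ` Q \<and> ?A j f \<noteq> 0} \<subseteq> (\<lambda>(q, j). (j, ?f q)) ` (SIGMA q:Q. {..<d q})"
    proof clarify
      fix j q assume A: "?A j (?f q) \<noteq> 0"
      have "\<exists>q'\<in>{q' \<in> Q. ?f q' = ?f q}. ?B j q' \<noteq> 0"
      proof (rule ccontr)
        assume "\<not> ?thesis"
        then have "?A j (?f q) = 0" by (intro sum.neutral) blast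
        with A show False by contradiction
      qed
      then obtain q' where q': "q' \<in> Q" "?f q' = ?f q" "?B j q' \<noteq> 0"
        by blast
      then have "j < d q'" by (meson)
      then show "(j, ?f q) \<in> (\<lambda>(q, j). (j, ?f q)) ` (SIGMA q:Q. {..<d q})"
        using q' by (intro image_eqI[of _ _ "(q', j)"]) simp_all
    qed
  qed (use assms in auto)
  also have "\<dots> = (\<Sum>q\<in>Q. d q)"
    using assms by simp
  finally have size: "relu_net_size \<Phi> \<le> card Q * (90 * L ^ 3) + (\<Sum>q\<in>Q. d q)"
    using \<Phi>(2) by simp
  have "relu_net_eval \<Phi> (Matrix.vec n x) =
      Matrix.vec m (\<lambda>j. \<Sum>q\<in>Q. if j < d q then B q j * ?f q x else 0)" for x
  proof -
    have "Matrix.vec n x = Matrix.vec n (\<lambda>i. (ps ! i) x)"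
      by (rule eq_vecI) (auto simp: ps_def)
    moreover have "(\<Sum>f\<in>?f ` Q. ?A j f * f x) = (\<Sum>q\<in>Q. if j < d q then B q j * ?f q x else 0)" for j
    proof -
      have "(\<Sum>f\<in>?f ` Q. ?A j f * f x) = (\<Sum>f\<in>?f ` Q. \<Sum>q\<in>{q \<in> Q. ?f q = f}. ?B j q * ?f q x)"
        by (intro sum.cong refl) (auto simp: sum_distrib_right)
      also have "\<dots> = (\<Sum>q\<in>Q. ?B j q * ?f q x)"
        using assms by (intro sum.image_gen[symmetric]) auto
      finally show ?thesis by (auto intro!: sum.cong)
    qed
    ultimately show ?thesis using spec[OF \<Phi>(3), of x] by (simp only:)
  qed
  with \<Phi>(1) size show ?thesis by blast
qed

section \<open>Directional derivatives of holomorphic functions\<close>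

lemma cscale_add_left: "cscale (a + b) v = cscale a v + cscale b v"
  by (simp add: cscale_def prod_eq_iff algebra_simps)

lemma cscale_cscale: "cscale a (cscale b v) = cscale (a * b) v"
  by (simp add: cscale_def prod_eq_iff algebra_simps)

lemma cscale_0_left [simp]: "cscale 0 v = 0"
  by (simp add: cscale_def prod_eq_iff)

lemma cscale_0_right [simp]: "cscale a 0 = 0"
  by (simp add: cscale_def prod_eq_iff)

lemma cscale_1 [simp]: "cscale 1 v = v"
  by (simp add: cscale_def prod_eq_iff)

lemma norm_cscale: "norm (cscale a v) = cmod a * norm (v :: 'a::real_inner complexified)"
proof -
  obtain x y where v: "v = (x, y)" by (cases v)
  have "(norm (Re a *\<^sub>R x - Im a *\<^sub>R y))\<^sup>2 + (norm (Re a *\<^sub>R y + Im a *\<^sub>R x))\<^sup>2 =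
      ((Re a)\<^sup>2 + (Im a)\<^sup>2) * ((norm x)\<^sup>2 + (norm y)\<^sup>2)"
    unfolding power2_norm_eq_inner
    by (simp add: inner_simps inner_commute power2_eq_square algebra_simps)
  then show ?thesis
    by (simp add: v cscale_def norm_prod_def cmod_def real_sqrt_mult)
qed

lemma bounded_linear_cscale: "bounded_linear (\<lambda>l. cscale l (v :: 'a::real_inner complexified))"
proof (rule bounded_linear_intro[of _ "norm v"])
  show "cscale (r *\<^sub>R x) v = r *\<^sub>R cscale x v" for r x
    by (simp add: cscale_def prod_eq_iff algebra_simps)
qed (simp_all add: norm_cscale cscale_add_left)

definition dir_deriv ::
  "('a::real_vector complexified \<Rightarrow> complex) \<Rightarrow> 'a complexified \<Rightarrow> 'a complexified \<Rightarrow> complex" where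
  "dir_deriv f v z = deriv (\<lambda>l. f (z + cscale l v)) 0"

text \<open>Gateaux differentiability with a derivative additive in the direction. For functions
  bounded on a ball this property passes to directional derivatives, so it can be iterated with
  one-variable theory alone.\<close>

definition line_holomorphic_on :: "('a::real_vector complexified \<Rightarrow> complex) \<Rightarrow> 'a complexified set \<Rightarrow> bool" where
  "line_holomorphic_on f S \<longleftrightarrow>
    (\<forall>z\<in>S. \<forall>v. (\<lambda>l. f (z + cscale l v)) field_differentiable at 0) \<and>
    (\<forall>z\<in>S. \<forall>u v. dir_deriv f (u + v) z = dir_deriv f u z + dir_deriv f v z)"

lemma line_holomorphic_on_subset:
  "line_holomorphic_on f S \<Longrightarrow> T \<subseteq> S \<Longrightarrow> line_holomorphic_on f T"
  unfolding line_holomorphic_on_def by blast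

lemma line_holomorphic_on_cinner_real:
  assumes "holomorphic_map_on G S"
  shows "line_holomorphic_on (\<lambda>z. cinner_real (G z) e) (S :: 'a::real_inner complexified set)"
proof -
  have "\<exists>D. (\<forall>v. ((\<lambda>l. cinner_real (G (z + cscale l v)) e) has_field_derivative D v) (at 0)) \<and>
      (\<forall>u v. D (u + v) = D u + D v)" if "z \<in> S" for z
  proof -
    obtain f' where f': "(G has_derivative f') (at z)" "\<forall>c v. f' (cscale c v) = cscale c (f' v)"
      using assms \<open>z \<in> S\<close> unfolding holomorphic_map_on_def by blast
    interpret f': bounded_linear f' using f'(1) by (rule has_derivative_bounded_linear)
    have "((\<lambda>l. cinner_real (G (z + cscale l v)) e) has_field_derivative cinner_real (f' v) e) (at 0)" for v
    proof -
      have "((\<lambda>l. z + cscale l v) has_derivative (\<lambda>l. cscale l v)) (at 0)"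
        using bounded_linear_imp_has_derivative[OF bounded_linear_cscale, of v "at 0"]
        by (auto intro: derivative_eq_intros)
      then have "((\<lambda>l. G (z + cscale l v)) has_derivative (\<lambda>l. f' (cscale l v))) (at 0)"
        using has_derivative_compose[of "\<lambda>l. z + cscale l v" _ 0 UNIV G f'] f'(1) by simp
      then have fs: "((\<lambda>l. fst (G (z + cscale l v))) has_derivative (\<lambda>l. fst (f' (cscale l v)))) (at 0)"
          "((\<lambda>l. snd (G (z + cscale l v))) has_derivative (\<lambda>l. snd (f' (cscale l v)))) (at 0)"
        by (auto intro: has_derivative_fst has_derivative_snd)
      have "((\<lambda>l. of_real (inner (fst (G (z + cscale l v))) e) + \<i> * of_real (inner (snd (G (z + cscale l v))) e))
          has_derivative (\<lambda>l. of_real (inner (fst (f' (cscale l v))) e) + \<i> * of_real (inner (snd (f' (cscale l v))) e))) (at 0)"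
        by (intro has_derivative_add has_derivative_mult_right has_derivative_of_real has_derivative_inner_left fs)
      moreover have "of_real (inner (fst w) e) + \<i> * of_real (inner (snd w) e) = cinner_real w e" for w :: "'b complexified"
        by (simp add: cinner_real_def complex_eq_iff)
      ultimately have "((\<lambda>l. cinner_real (G (z + cscale l v)) e) has_derivative (\<lambda>l. cinner_real (f' (cscale l v)) e)) (at 0)"
        by simp
      \<comment> \<open>Complex linearity of the Frechet derivative turns the real derivative in l
        into multiplication by a complex number.\<close>
      moreover have "cinner_real (f' (cscale l v)) e = cinner_real (f' v) e * l" for l
        unfolding f'(2)[rule_format] by (simp add: cinner_real_def cscale_def complex_eq_iff inner_simps algebra_simps)
      ultimately show ?thesis
        by (simp add: has_field_derivative_def)
    qed
    moreover have "cinner_real (f' (u + v)) e = cinner_real (f' u) e + cinner_real (f' v) e" for u v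
      by (simp add: f'.add cinner_real_def complex_eq_iff inner_simps)
    ultimately show ?thesis by (intro exI[of _ "\<lambda>v. cinner_real (f' v) e"]) simp
  qed
  note * = this
  show ?thesis
    unfolding line_holomorphic_on_def
  proof (intro conjI ballI allI)
    fix z assume "z \<in> S"
    from *[OF this] obtain D where
      D: "\<And>v. ((\<lambda>l. cinner_real (G (z + cscale l v)) e) has_field_derivative D v) (at 0)"
        "\<And>u v. D (u + v) = D u + D v" by blast
    show "(\<lambda>l. cinner_real (G (z + cscale l v)) e) field_differentiable at 0" for v
      using D(1) unfolding field_differentiable_def by blast
    show "dir_deriv (\<lambda>z. cinner_real (G z) e) (u + v) z =
        dir_deriv (\<lambda>z. cinner_real (G z) e) u z + dir_deriv (\<lambda>z. cinner_real (G z) e) v z" for u v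
      unfolding dir_deriv_def by (simp only: DERIV_imp_deriv[OF D(1)] D(2))
  qed
qed

lemma line_holomorphic_deriv:
  assumes "line_holomorphic_on f S" "z + cscale l v \<in> S"
  shows "((\<lambda>l. f (z + cscale l v)) has_field_derivative dir_deriv f v (z + cscale l v)) (at l)"
proof -
  have "((\<lambda>m. f (z + cscale l v + cscale m v)) has_field_derivative dir_deriv f v (z + cscale l v)) (at 0)"
  proof -
    have "(\<lambda>m. f (z + cscale l v + cscale m v)) field_differentiable at 0"
      using assms unfolding line_holomorphic_on_def by blast
    then show ?thesis
      unfolding dir_deriv_def by (simp add: DERIV_deriv_iff_field_differentiable)
  qed
  then have "((\<lambda>m. (\<lambda>l. f (z + cscale l v)) (m + l)) has_field_derivative dir_deriv f v (z + cscale l v)) (at 0)"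
    by (simp add: cscale_add_left add.commute add.left_commute)
  then show ?thesis
    using DERIV_shift[of "\<lambda>l. f (z + cscale l v)" "dir_deriv f v (z + cscale l v)" 0 l] by simp
qed

lemma line_holomorphic_deriv0:
  assumes "line_holomorphic_on f S" "z \<in> S"
  shows "((\<lambda>l. f (z + cscale l v)) has_field_derivative dir_deriv f v z) (at 0)"
  using line_holomorphic_deriv[of f S z 0 v] assms by simp

lemma dir_deriv_cscale:
  assumes "line_holomorphic_on f S" "z \<in> S"
  shows "dir_deriv f (cscale a v) z = a * dir_deriv f v z"
proof -
  have "((\<lambda>l. f (z + cscale l v)) has_field_derivative dir_deriv f v z) (at (0 * a))"
    using line_holomorphic_deriv0[OF assms] by simp
  moreover have "((\<lambda>l. l * a) has_field_derivative a) (at 0)"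
    by (auto intro!: derivative_eq_intros)
  ultimately have "((\<lambda>l. f (z + cscale (l * a) v)) has_field_derivative dir_deriv f v z * a) (at 0)"
    using DERIV_chain2[of "\<lambda>l. f (z + cscale l v)" _ "\<lambda>l. l * a" 0 a UNIV] by simp
  then show ?thesis
    unfolding dir_deriv_def[of f "cscale a v"] by (simp add: cscale_cscale DERIV_imp_deriv mult.commute)
qed

lemma dir_deriv_sum:
  assumes "line_holomorphic_on f S" "z \<in> S" "finite I"
  shows "dir_deriv f (\<Sum>i\<in>I. cscale (a i) (v i)) z = (\<Sum>i\<in>I. a i * dir_deriv f (v i) z)"
  using assms(3)
proof (induction I rule: finite_induct)
  case empty
  then show ?case using dir_deriv_cscale[OF assms(1,2), of 0 0] by simp
next
  case (insert i I)
  have "dir_deriv f (u + w) z = dir_deriv f u z + dir_deriv f w z" for u w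
    using assms unfolding line_holomorphic_on_def by blast
  then show ?case
    using insert dir_deriv_cscale[OF assms(1,2)] by simp
qed

lemma eventually_line_in_ball:
  fixes z :: "'a::real_inner complexified"
  assumes "z \<in> ball c R"
  shows "\<forall>\<^sub>F l in nhds 0. z + cscale l v \<in> ball c R"
proof -
  have "((\<lambda>l. z + cscale l v) \<longlongrightarrow> z + cscale 0 v) (nhds 0)"
    using bounded_linear.tendsto[OF bounded_linear_cscale, of "\<lambda>l. l" 0 "nhds 0" v]
    by (intro tendsto_add tendsto_const) (simp add: filterlim_ident)
  from topological_tendstoD[OF this open_ball, of c R] assms show ?thesis
    by (simp only: cscale_0_left add_0_right)
qed

lemma dir_deriv_cong:
  fixes z :: "'a::real_inner complexified"
  assumes "\<And>z. z \<in> ball c R \<Longrightarrow> f z = g z" "z \<in> ball c R"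
  shows "dir_deriv f v z = dir_deriv g v z"
  unfolding dir_deriv_def
  by (rule deriv_cong_ev, rule eventually_mono[OF eventually_line_in_ball[OF assms(2), of v]])
    (use assms(1) in auto)

lemma holomorphic_on_ballI:
  assumes "\<And>l. cmod l < r \<Longrightarrow> (g has_field_derivative g' l) (at l)"
  shows "g holomorphic_on ball 0 r"
  by (subst holomorphic_on_open) (simp, intro ballI exI, rule assms, simp)

text \<open>Cauchy's estimate for the restriction of \<open>f\<close> to the complex line through
  \<open>z\<close>; a disc of radius (R - R') / norm v stays in the larger ball.\<close>

lemma dir_deriv_bound:
  fixes z :: "'a::real_inner complexified"
  assumes f: "line_holomorphic_on f (ball c R)" and M: "\<And>z. z \<in> ball c R \<Longrightarrow> cmod (f z) \<le> M"
    and z: "z \<in> ball c R'" and R: "R' < R"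
  shows "cmod (dir_deriv f v z) \<le> M * norm v / (R - R')"
proof (cases "v = 0")
  case True
  have "z \<in> ball c R" using z R by auto
  then show ?thesis using dir_deriv_cscale[OF f, of z 0 0] True by simp
next
  case False
  define r where "r = (R - R') / norm v"
  have r: "r > 0" using R False by (simp add: r_def)
  have mem: "z + cscale l v \<in> ball c R" if "cmod l \<le> r" for l
  proof -
    have "norm (cscale l v) \<le> R - R'"
      using that False by (simp add: norm_cscale r_def field_simps)
    then show ?thesis
      using z norm_triangle_ineq[of "z - c" "cscale l v"]
      by (auto simp: dist_norm norm_minus_commute algebra_simps)
  qed
  let ?g = "\<lambda>l. f (z + cscale l v)"
  have d: "(?g has_field_derivative dir_deriv f v (z + cscale l v)) (at l)" if "cmod l \<le> r" for l
    by (rule line_holomorphic_deriv[OF f mem[OF that]])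
  have "norm ((deriv ^^ 1) ?g 0) \<le> fact 1 * M / r ^ 1"
  proof (rule Cauchy_inequality[OF _ _ r])
    show "?g holomorphic_on ball 0 r"
      by (rule holomorphic_on_ballI[OF d]) simp
    show "continuous_on (cball 0 r) ?g"
      by (rule DERIV_continuous_on, rule has_field_derivative_at_within[OF d]) auto
    show "cmod (?g x) \<le> M" if "cmod (0 - x) = r" for x
      using that by (intro M mem) auto
  qed
  then show ?thesis
    by (simp add: dir_deriv_def r_def)
qed

text \<open>First-order Taylor estimate on the disc of radius r/2. Around each of its points a
  circle of radius r/4 fits into the domain, and Cauchy's estimate 2 M / (r/4)^2 for the second
  derivative gives the 32.\<close>

lemma difference_quotient_bound:
  assumes h: "h holomorphic_on ball 0 r" and M: "\<And>l. l \<in> ball 0 r \<Longrightarrow> cmod (h l) \<le> M"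
    and m: "m \<noteq> 0" "cmod m \<le> r / 2" and r: "0 < r"
  shows "cmod ((h m - h 0) / m - deriv h 0) \<le> 32 * M / r\<^sup>2 * cmod m"
proof -
  let ?S = "cball (0::complex) (r/2)"
  have S: "?S \<subseteq> ball 0 r" using r by auto
  have "cmod (h m - (\<Sum>i\<le>1. (deriv ^^ i) h 0 * (m - 0) ^ i / fact i))
      \<le> (32 * M / r\<^sup>2) * cmod (m - 0) ^ (Suc 1) / fact 1"
  proof (rule complex_Taylor[of ?S 1 "\<lambda>i. (deriv ^^ i) h" "32 * M / r\<^sup>2" 0 m, simplified funpow_0])
    show "((deriv ^^ i) h has_field_derivative (deriv ^^ Suc i) h x) (at x within ?S)" if "x \<in> ?S" for i x
    proof -
      have "(deriv ^^ i) h holomorphic_on ball 0 r"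
        using h by (intro holomorphic_higher_deriv) auto
      then show ?thesis
        using holomorphic_derivI[of "(deriv ^^ i) h" "ball 0 r" x] that S
        by (auto intro: has_field_derivative_at_within)
    qed
    show "cmod ((deriv ^^ Suc 1) h x) \<le> 32 * M / r\<^sup>2" if x: "x \<in> ?S" for x
    proof -
      have sub: "cball x (r/4) \<subseteq> ball 0 r"
      proof
        fix y assume "y \<in> cball x (r/4)"
        then have "cmod y \<le> cmod x + r/4"
          using norm_triangle_ineq[of x "y - x"] by (simp add: dist_norm norm_minus_commute)
        then show "y \<in> ball 0 r" using x r by auto
      qed
      have "cmod ((deriv ^^ 2) h x) \<le> fact 2 * M / (r/4)^2"
      proof (rule Cauchy_inequality)
        show "h holomorphic_on ball x (r/4)"
          using h sub by (meson ball_subset_cball holomorphic_on_subset subset_trans)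
        show "continuous_on (cball x (r/4)) h"
          using h sub by (meson holomorphic_on_imp_continuous_on continuous_on_subset)
        show "cmod (h y) \<le> M" if "cmod (x - y) = r/4" for y
          using that sub by (intro M) (auto simp: dist_norm)
      qed (use r in auto)
      then show ?thesis
        by (simp add: numeral_2_eq_2 power2_eq_square field_simps)
    qed
  qed (use m r in auto)
  then have "cmod (h m - h 0 - deriv h 0 * m) \<le> 32 * M / r\<^sup>2 * (cmod m * cmod m)"
    by (simp add: algebra_simps)
  moreover have "(h m - h 0) / m - deriv h 0 = (h m - h 0 - deriv h 0 * m) / m"
    using m by (simp add: diff_divide_distrib)
  ultimately show ?thesis
    using m by (simp add: norm_divide divide_le_eq mult.assoc)
qed

text \<open>The difference quotients of f in direction v are holomorphic along u and converge
  uniformly; the limit theorem for derivatives gives both the differentiability of the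
  directional derivatives and their symmetry.\<close>

lemma dir_deriv_swap:
  fixes z :: "'a::real_inner complexified"
  assumes f: "line_holomorphic_on f (ball c R)" and M: "\<And>z. z \<in> ball c R \<Longrightarrow> cmod (f z) \<le> M"
    and z: "z \<in> ball c R"
  shows "(\<lambda>l. dir_deriv f v (z + cscale l u)) field_differentiable at 0"
    and "dir_deriv (dir_deriv f v) u z = dir_deriv (dir_deriv f u) v z"
proof -
  define e where "e = R - dist c z"
  have e: "0 < e" using z by (simp add: e_def)
  \<comment> \<open>Half of the free distance \<open>e\<close> is enough for moving in both
    directions; the summand 1 excludes a zero denominator.\<close>
  define r where "r = e / (2 * (norm u + norm v + 1))"
  have pos: "0 < norm u + norm v + 1" by (simp add: add_nonneg_pos)
  have r: "0 < r" using e pos by (simp add: r_def)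
  have mem: "z + cscale l u + cscale m v \<in> ball c R" if "cmod l \<le> r" "cmod m \<le> r" for l m
  proof -
    have "norm (cscale l u + cscale m v) \<le> cmod l * norm u + cmod m * norm v"
      by (rule order_trans[OF norm_triangle_ineq]) (simp add: norm_cscale)
    also have "\<dots> \<le> r * norm u + r * norm v"
      using that by (intro add_mono mult_right_mono) auto
    also have "\<dots> \<le> r * (norm u + norm v + 1)"
      using r by (simp add: algebra_simps)
    also have "\<dots> = e / 2" using pos by (simp add: r_def field_simps)
    also have "\<dots> < e" using e by simp
    finally have "norm (cscale l u + cscale m v) < e" .
    moreover have "dist c (z + cscale l u + cscale m v) \<le> dist c z + norm (cscale l u + cscale m v)"
      using norm_triangle_ineq[of "z - c" "cscale l u + cscale m v"]
      by (simp add: dist_norm norm_minus_commute algebra_simps)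
    ultimately show ?thesis by (simp add: e_def)
  qed
  let ?F = "\<lambda>m l. (f (z + cscale m v + cscale l u) - f (z + cscale l u)) / m"
  let ?F' = "\<lambda>m l. (dir_deriv f u (z + cscale m v + cscale l u) - dir_deriv f u (z + cscale l u)) / m"
  let ?g = "\<lambda>l. dir_deriv f v (z + cscale l u)"
  have mem': "z + cscale m v + cscale l u \<in> ball c R" if "cmod l \<le> r" "cmod m \<le> r" for l m
    using mem[OF that] by (simp only: add.commute add.left_commute)
  have mem0: "z + cscale l u \<in> ball c R" if "cmod l \<le> r" for l
    using mem[OF that, of 0] r by simp
  have dF: "(?F m has_field_derivative ?F' m l) (at l)" if "cmod l \<le> r" "cmod m \<le> r" for l m
    by (intro DERIV_cdivide DERIV_diff line_holomorphic_deriv[OF f] mem' mem0 that)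
  have ev: "\<forall>\<^sub>F m in at 0. cmod m \<le> r / 2 \<and> m \<noteq> 0"
    unfolding eventually_at using r by (intro exI[of _ "r/2"]) auto
  have 1: "\<forall>\<^sub>F m in at 0. continuous_on (cball 0 r) (?F m) \<and>
      (\<forall>w\<in>ball 0 r. (?F m has_field_derivative ?F' m w) (at w))"
    using ev
  proof eventually_elim
    case (elim m)
    then have m: "cmod m \<le> r" using r by auto
    have "continuous_on (cball 0 r) (?F m)"
      by (rule DERIV_continuous_on, rule has_field_derivative_at_within[OF dF[OF _ m]]) simp
    moreover have "(?F m has_field_derivative ?F' m w) (at w)" if "w \<in> ball 0 r" for w
      by (rule dF[OF _ m]) (use that in simp)
    ultimately show ?case by blast
  qed
  have bound: "cmod (?F m l - ?g l) \<le> 32 * M / r\<^sup>2 * cmod m" if "cmod l \<le> r" "cmod m \<le> r/2" "m \<noteq> 0" for l m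
  proof -
    let ?h = "\<lambda>m. f (z + cscale l u + cscale m v)"
    have "(?h has_field_derivative dir_deriv f v (z + cscale l u + cscale m v)) (at m)" if "cmod m < r" for m
      by (rule line_holomorphic_deriv[OF f mem[OF \<open>cmod l \<le> r\<close>]]) (use that in auto)
    then have "?h holomorphic_on ball 0 r"
      by (rule holomorphic_on_ballI)
    moreover have "cmod (?h m) \<le> M" if "m \<in> ball 0 r" for m
      using that \<open>cmod l \<le> r\<close> by (intro M mem) auto
    ultimately have "cmod ((?h m - ?h 0) / m - deriv ?h 0) \<le> 32 * M / r\<^sup>2 * cmod m"
      using that r by (intro difference_quotient_bound)
    then show ?thesis
      by (simp add: dir_deriv_def add.commute add.left_commute)
  qed
  have M0: "0 \<le> M" using M[OF z] norm_ge_zero order_trans by blast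
  have 2: "uniform_limit (cball 0 r) ?F ?g (at 0)"
  proof (rule uniform_limitI)
    fix \<epsilon> :: real assume "\<epsilon> > 0"
    define K where "K = 32 * M / r\<^sup>2"
    have K: "0 \<le> K" using M0 r by (simp add: K_def)
    have "\<forall>\<^sub>F m in at 0. m \<noteq> 0 \<and> cmod m < \<epsilon> / (K + 1)"
      unfolding eventually_at using \<open>\<epsilon> > 0\<close> K by (intro exI[of _ "\<epsilon> / (K + 1)"]) auto
    with ev show "\<forall>\<^sub>F m in at 0. \<forall>l\<in>cball 0 r. dist (?F m l) (?g l) < \<epsilon>"
    proof eventually_elim
      case (elim m)
      have "K * cmod m \<le> (K + 1) * cmod m" by (simp add: mult_right_mono)
      also have "\<dots> < \<epsilon>" using elim K by (simp add: field_simps)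
      finally have "K * cmod m < \<epsilon>" .
      show ?case
      proof
        fix l :: complex assume "l \<in> cball 0 r"
        then have "dist (?F m l) (?g l) \<le> K * cmod m"
          using bound[of l m] elim unfolding K_def dist_norm by simp
        with \<open>K * cmod m < \<epsilon>\<close> show "dist (?F m l) (?g l) < \<epsilon>" by linarith
      qed
    qed
  qed
  obtain g' where g': "\<And>w. w \<in> ball 0 r \<Longrightarrow> (?g has_field_derivative g' w) (at w) \<and> ((\<lambda>m. ?F' m w) \<longlongrightarrow> g' w) (at 0)"
    using has_complex_derivative_uniform_limit[OF 1 2 _ r] by auto
  \<comment> \<open>At the origin \<open>?F'\<close> is the difference quotient of
    \<open>dir_deriv f u\<close> along \<open>v\<close>, so \<open>g' 0\<close> is at once both
    mixed derivatives.\<close>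
  have g0: "(?g has_field_derivative g' 0) (at 0)" "((\<lambda>m. ?F' m 0) \<longlongrightarrow> g' 0) (at 0)"
    using g'[of 0] r by auto
  then have "((\<lambda>m. dir_deriv f u (z + cscale m v)) has_field_derivative g' 0) (at 0)"
    by (simp add: DERIV_def)
  then show "(\<lambda>l. dir_deriv f v (z + cscale l u)) field_differentiable at 0"
    and "dir_deriv (dir_deriv f v) u z = dir_deriv (dir_deriv f u) v z"
    using g0 unfolding dir_deriv_def[of "dir_deriv f v"] dir_deriv_def[of "dir_deriv f u"]
    by (auto simp: field_differentiable_def DERIV_imp_deriv)
qed

text \<open>Additivity in the new direction is the nontrivial part: exchanging the two derivatives
  moves it to the inner one, where it holds by assumption.\<close>

lemma line_holomorphic_on_dir_deriv:
  fixes c :: "'a::real_inner complexified"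
  assumes f: "line_holomorphic_on f (ball c R)" and M: "\<And>z. z \<in> ball c R \<Longrightarrow> cmod (f z) \<le> M"
  shows "line_holomorphic_on (dir_deriv f v) (ball c R)"
  unfolding line_holomorphic_on_def
proof (intro conjI ballI allI)
  fix z assume z: "z \<in> ball c R"
  show "(\<lambda>l. dir_deriv f v (z + cscale l u)) field_differentiable at 0" for u
    using dir_deriv_swap(1)[OF f M z] .
  fix u1 u2
  let ?d = "\<lambda>u. dir_deriv (dir_deriv f u) v z"
  have "?d (u1 + u2) = dir_deriv (\<lambda>z. dir_deriv f u1 z + dir_deriv f u2 z) v z"
    by (rule dir_deriv_cong[OF _ z]) (use f[unfolded line_holomorphic_on_def] in blast)
  also have "\<dots> = ?d u1 + ?d u2"
    unfolding dir_deriv_def[of _ v]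
    by (rule deriv_add[OF dir_deriv_swap(1)[OF f M z, where v = u1 and u = v]
          dir_deriv_swap(1)[OF f M z, where v = u2 and u = v]])
  finally show "dir_deriv (dir_deriv f v) (u1 + u2) z =
      dir_deriv (dir_deriv f v) u1 z + dir_deriv (dir_deriv f v) u2 z"
    using dir_deriv_swap(2)[OF f M z] by metis
qed

section \<open>Taylor expansion over words\<close>

primrec iter_deriv ::
  "('a::real_vector complexified \<Rightarrow> complex) \<Rightarrow> 'a complexified list \<Rightarrow> 'a complexified \<Rightarrow> complex" where
  "iter_deriv f [] = f"
| "iter_deriv f (v # vs) = dir_deriv (iter_deriv f vs) v"

text \<open>Holomorphy and bound go through the induction together, since the next derivative needs
  a bound on the current ball. Each letter gives up radius \<open>h\<close>.\<close>

lemma iter_deriv_bound: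
  fixes c :: "'a::real_inner complexified"
    and h :: real
  assumes f: "line_holomorphic_on f (ball c R)" and M: "\<And>z. z \<in> ball c R \<Longrightarrow> cmod (f z) \<le> M"
    and h: "0 < h"
  shows "line_holomorphic_on (iter_deriv f vs) (ball c (R - length vs * h)) \<and>
    (\<forall>z\<in>ball c (R - length vs * h). cmod (iter_deriv f vs z) \<le> M * prod_list (map norm vs) / h ^ length vs)"
proof (induction vs)
  case (Cons v vs)
  let ?R = "R - length vs * h" and ?R' = "R - length (v # vs) * h"
  let ?M = "M * prod_list (map norm vs) / h ^ length vs"
  have IH: "line_holomorphic_on (iter_deriv f vs) (ball c ?R)"
    "\<And>z. z \<in> ball c ?R \<Longrightarrow> cmod (iter_deriv f vs z) \<le> ?M"
    using Cons.IH by auto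
  have R: "?R' < ?R" "?R - ?R' = h" using h by (auto simp: algebra_simps)
  have "line_holomorphic_on (dir_deriv (iter_deriv f vs) v) (ball c ?R')"
    by (rule line_holomorphic_on_subset[OF line_holomorphic_on_dir_deriv[OF IH]])
      (use R in \<open>auto simp: subset_ball\<close>)
  moreover have "cmod (dir_deriv (iter_deriv f vs) v z) \<le> ?M * norm v / h" if "z \<in> ball c ?R'" for z
    using dir_deriv_bound[OF IH that R(1), of v] unfolding R(2) .
  ultimately show ?case
    by (simp add: mult_ac)
qed (use assms in auto)

definition words :: "'l set \<Rightarrow> nat \<Rightarrow> 'l list set" where
  "words I n = {ws. set ws \<subseteq> I \<and> length ws = n}"

lemma finite_words: "finite I \<Longrightarrow> finite (words I n)"
  unfolding words_def by (rule finite_lists_length_eq)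

lemma words_0 [simp]: "words I 0 = {[]}"
  by (auto simp: words_def)

lemma sum_words_Suc:
  assumes "finite I"
  shows "(\<Sum>ws\<in>words I (Suc n). f ws) = (\<Sum>l\<in>I. \<Sum>ws\<in>words I n. f (l # ws))"
proof -
  have "(\<Sum>l\<in>I. \<Sum>ws\<in>words I n. f (l # ws)) = (\<Sum>(l, ws)\<in>I \<times> words I n. f (l # ws))"
    by (rule sum.cartesian_product)
  also have "\<dots> = (\<Sum>ws\<in>words I (Suc n). f ws)"
    by (rule sum.reindex_bij_witness[of _ "\<lambda>ws. (hd ws, tl ws)" "\<lambda>(l, ws). l # ws"])
      (auto simp: words_def length_Suc_conv)
  finally show ?thesis by simp
qed

text \<open>Multilinearity of the n-th derivative. Expanding over words gives each ordering its own
  term, so no multinomial coefficients arise.\<close>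

lemma iter_deriv_replicate:
  fixes c :: "'a::real_inner complexified" and v :: "'l \<Rightarrow> 'a complexified"
    and h :: real
  assumes f: "line_holomorphic_on f (ball c R)" and M: "\<And>z. z \<in> ball c R \<Longrightarrow> cmod (f z) \<le> M"
    and h: "0 < h" and I: "finite I" and z: "z \<in> ball c (R - n * h)"
  shows "iter_deriv f (replicate n (\<Sum>l\<in>I. cscale (a l) (v l))) z =
    (\<Sum>ws\<in>words I n. prod_list (map a ws) * iter_deriv f (map v ws) z)"
  using z
proof (induction n arbitrary: z)
  case (Suc n)
  let ?u = "\<Sum>l\<in>I. cscale (a l) (v l)"
  have "R - real (Suc n) * h \<le> R - n * h" using h by (simp add: algebra_simps)
  then have z: "z \<in> ball c (R - n * h)" using Suc.prems by auto
  have hol: "line_holomorphic_on (iter_deriv f (map v ws)) (ball c (R - n * h))" if "ws \<in> words I n" for ws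
    using iter_deriv_bound[OF f M h, of "map v ws"] that by (simp add: words_def)
  have "iter_deriv f (replicate (Suc n) ?u) z =
      dir_deriv (\<lambda>z. \<Sum>ws\<in>words I n. prod_list (map a ws) * iter_deriv f (map v ws) z) ?u z"
    by simp (rule dir_deriv_cong[OF Suc.IH z])
  also have "\<dots> = (\<Sum>ws\<in>words I n. prod_list (map a ws) * dir_deriv (iter_deriv f (map v ws)) ?u z)"
    unfolding dir_deriv_def[of _ ?u]
    by (rule DERIV_imp_deriv, rule DERIV_sum, rule DERIV_cmult)
      (use line_holomorphic_deriv0[OF hol z, of _ ?u] in \<open>simp add: dir_deriv_def\<close>)
  also have "\<dots> = (\<Sum>ws\<in>words I n. prod_list (map a ws) * (\<Sum>l\<in>I. a l * dir_deriv (iter_deriv f (map v ws)) (v l) z))"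
    by (intro sum.cong refl arg_cong2[where f = times] dir_deriv_sum[OF hol z I])
  also have "\<dots> = (\<Sum>ws\<in>words I n. \<Sum>l\<in>I. prod_list (map a (l # ws)) * iter_deriv f (map v (l # ws)) z)"
    by (simp add: sum_distrib_left mult_ac)
  also have "\<dots> = (\<Sum>l\<in>I. \<Sum>ws\<in>words I n. prod_list (map a (l # ws)) * iter_deriv f (map v (l # ws)) z)"
    by (rule sum.swap)
  finally show ?case
    by (simp only: sum_words_Suc[OF I])
qed simp

text \<open>Linear combinations of components serve the duality argument in
  \<open>word_coeff_bound\<close>; each component may have its own bound.\<close>

lemma iter_deriv_linear:
  fixes c :: "'a::real_inner complexified" and f :: "'j \<Rightarrow> 'a complexified \<Rightarrow> complex"
    and h :: real
  assumes f: "\<And>j. j \<in> J \<Longrightarrow> line_holomorphic_on (f j) (ball c R)"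
    and M: "\<And>j z. j \<in> J \<Longrightarrow> z \<in> ball c R \<Longrightarrow> cmod (f j z) \<le> M j"
    and h: "0 < h" and z: "z \<in> ball c (R - length vs * h)"
  shows "iter_deriv (\<lambda>z. \<Sum>j\<in>J. a j * f j z) vs z = (\<Sum>j\<in>J. a j * iter_deriv (f j) vs z)"
  using z
proof (induction vs arbitrary: z)
  case (Cons v vs)
  have "R - real (length (v # vs)) * h \<le> R - length vs * h" using h by (simp add: algebra_simps)
  then have z: "z \<in> ball c (R - length vs * h)" using Cons.prems by auto
  have hol: "line_holomorphic_on (iter_deriv (f j) vs) (ball c (R - length vs * h))" if "j \<in> J" for j
    using iter_deriv_bound[OF f[OF that] M[OF that] h, of vs] by simp
  have "iter_deriv (\<lambda>z. \<Sum>j\<in>J. a j * f j z) (v # vs) z =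
      dir_deriv (\<lambda>z. \<Sum>j\<in>J. a j * iter_deriv (f j) vs z) v z"
    by simp (rule dir_deriv_cong[OF Cons.IH z])
  also have "\<dots> = (\<Sum>j\<in>J. a j * dir_deriv (iter_deriv (f j) vs) v z)"
    unfolding dir_deriv_def[of _ v]
    by (rule DERIV_imp_deriv, rule DERIV_sum, rule DERIV_cmult)
      (use line_holomorphic_deriv0[OF hol z, of _ v] in \<open>simp add: dir_deriv_def\<close>)
  finally show ?case by simp
qed simp

lemma line_holomorphic_on_linear:
  fixes c :: "'a::real_inner complexified" and f :: "'j \<Rightarrow> 'a complexified \<Rightarrow> complex"
  assumes f: "\<And>j. j \<in> J \<Longrightarrow> line_holomorphic_on (f j) S"
  shows "line_holomorphic_on (\<lambda>z. \<Sum>j\<in>J. a j * f j z) S"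
proof -
  have D: "((\<lambda>l. \<Sum>j\<in>J. a j * f j (z + cscale l v)) has_field_derivative (\<Sum>j\<in>J. a j * dir_deriv (f j) v z)) (at 0)"
    if "z \<in> S" for z v
    by (rule DERIV_sum, rule DERIV_cmult, rule line_holomorphic_deriv0[OF f that])
  have "dir_deriv (\<lambda>z. \<Sum>j\<in>J. a j * f j z) v z = (\<Sum>j\<in>J. a j * dir_deriv (f j) v z)" if "z \<in> S" for z v
    unfolding dir_deriv_def[of _ v] using D[OF that, of v] by (simp add: DERIV_imp_deriv dir_deriv_def)
  note dd = this
  show ?thesis
    unfolding line_holomorphic_on_def
  proof (intro conjI ballI allI)
    fix z assume z: "z \<in> S"
    show "(\<lambda>l. \<Sum>j\<in>J. a j * f j (z + cscale l v)) field_differentiable at 0" for v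
      using D[OF z] unfolding field_differentiable_def by blast
    have "dir_deriv (f j) (u + v) z = dir_deriv (f j) u z + dir_deriv (f j) v z" if "j \<in> J" for j u v
      using f[OF that] z unfolding line_holomorphic_on_def by blast
    then show "dir_deriv (\<lambda>z. \<Sum>j\<in>J. a j * f j z) (u + v) z =
        dir_deriv (\<lambda>z. \<Sum>j\<in>J. a j * f j z) u z + dir_deriv (\<lambda>z. \<Sum>j\<in>J. a j * f j z) v z" for u v
      unfolding dd[OF z] by (simp add: sum.distrib[symmetric] distrib_left)
  qed
qed

lemma power_div_fact_le_exp:
  assumes "0 \<le> (x::real)"
  shows "x ^ n / fact n \<le> exp x"
proof -
  have "(\<Sum>k\<in>{n}. inverse (fact k) *\<^sub>R x ^ k) \<le> (\<Sum>k. inverse (fact k) *\<^sub>R x ^ k)"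
    using assms summable_exp_generic[of x] by (intro sum_le_suminf) auto
  then show ?thesis
    by (simp add: exp_def field_simps)
qed

text \<open>Each derivative costs one Cauchy estimate on a ball shrunk by R/(d+1), and the resulting
  power (d+1)^d is compensated by d! up to a factor exp (d+1).\<close>

lemma iter_deriv_coeff_bound:
  fixes c :: "'a::real_inner complexified"
  assumes f: "line_holomorphic_on f (ball c R)" and M: "\<And>z. z \<in> ball c R \<Longrightarrow> cmod (f z) \<le> M"
    and R: "0 < R"
  shows "cmod (iter_deriv f vs c / fact (length vs)) \<le> M * exp 1 * prod_list (map (\<lambda>v. exp 1 * norm v / R) vs)"
proof -
  let ?d = "length vs"
  have M0: "0 \<le> M" using M[of c] R norm_ge_zero order_trans by (metis centre_in_ball)
  define h where "h = R / (?d + 1)"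
  have h: "0 < h" using R by (simp add: h_def)
  have "?d * h < R" using R by (simp add: h_def field_simps)
  then have "cmod (iter_deriv f vs c) \<le> M * prod_list (map norm vs) / h ^ ?d"
    using iter_deriv_bound[OF f M h, of vs] by simp
  also have "\<dots> = M * prod_list (map norm vs) / R ^ ?d * (?d + 1) ^ ?d"
    by (simp add: h_def power_divide)
  finally have "cmod (iter_deriv f vs c) / fact ?d \<le> M * prod_list (map norm vs) / R ^ ?d * (?d + 1) ^ ?d / fact ?d"
    by (rule divide_right_mono) simp
  also have "\<dots> = M * prod_list (map norm vs) / R ^ ?d * ((?d + 1) ^ ?d / fact ?d)"
    by simp
  also have "\<dots> \<le> M * prod_list (map norm vs) / R ^ ?d * exp (?d + 1)"
  proof (rule mult_left_mono)
    show "real ((?d + 1) ^ ?d) / fact ?d \<le> exp (real (?d + 1))"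
      using power_div_fact_le_exp[of "real (?d + 1)" ?d] by simp
    have "0 \<le> prod_list (map norm vs)" by (induction vs) auto
    then show "0 \<le> M * prod_list (map norm vs) / R ^ ?d" using M0 R by simp
  qed
  also have "exp (real (?d + 1)) = exp 1 * exp 1 ^ ?d"
    by (simp add: exp_add exp_of_nat_mult[symmetric])
  also have "M * prod_list (map norm vs) / R ^ ?d * (exp 1 * exp 1 ^ ?d) =
      M * exp 1 * prod_list (map (\<lambda>v. exp 1 * norm v / R) vs)"
  proof -
    have "prod_list (map (\<lambda>v. exp 1 * norm v / R) vs) = prod_list (map norm vs) * exp 1 ^ ?d / R ^ ?d"
      by (induction vs) simp_all
    then show ?thesis by simp
  qed
  finally show ?thesis by (simp add: norm_divide)
qed

text \<open>Taylor's formula on the segment from \<open>c\<close> to the evaluation point, followed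
  by expansion over words. The segment uses R/4 and the n + 1 derivatives together R/2 of the
  radius.\<close>

lemma word_taylor:
  fixes c :: "'a::real_inner complexified" and v :: "'l \<Rightarrow> 'a complexified"
  assumes f: "line_holomorphic_on f (ball c R)" and M: "\<And>z. z \<in> ball c R \<Longrightarrow> cmod (f z) \<le> M"
    and R: "0 < R" and I: "finite I" and a: "\<And>l. l \<in> I \<Longrightarrow> cmod (a l) \<le> 1"
    and v: "(\<Sum>l\<in>I. norm (v l)) \<le> R / (4 * exp 1)"
  shows "cmod (f (c + (\<Sum>l\<in>I. cscale (a l) (v l))) -
      (\<Sum>i\<le>n. \<Sum>ws\<in>words I i. prod_list (map a ws) * (iter_deriv f (map v ws) c / fact i)))
    \<le> M * (real (Suc n) / 2 ^ Suc n)"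
proof -
  let ?u = "\<Sum>l\<in>I. cscale (a l) (v l)"
  have M0: "0 \<le> M" using M[of c] R norm_ge_zero order_trans by (metis centre_in_ball)
  have "norm ?u \<le> (\<Sum>l\<in>I. cmod (a l) * norm (v l))"
    by (rule order_trans[OF norm_sum]) (simp add: norm_cscale)
  also have "\<dots> \<le> (\<Sum>l\<in>I. 1 * norm (v l))"
    using a by (intro sum_mono mult_right_mono) auto
  finally have u: "norm ?u \<le> R / (4 * exp 1)" using v by simp
  have "exp 1 \<ge> (1::real)" by simp
  then have "R / (4 * exp 1) \<le> R / 4" using R by (intro divide_left_mono) auto
  then have u4: "norm ?u \<le> R / 4" using u by simp
  define h where "h = R / (2 * (n + 1))"
  have h: "0 < h" using R by (simp add: h_def)
  have nh: "i * h \<le> R / 2" if "i \<le> Suc n" for i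
  proof -
    have "i * h \<le> Suc n * h" using that h by (intro mult_right_mono) auto
    also have "Suc n * h = R / 2" by (simp add: h_def field_simps)
    finally show ?thesis .
  qed
  have mem: "c + cscale x ?u \<in> ball c (R - i * h)" if "i \<le> Suc n" "x \<in> closed_segment 0 1" for i x
  proof -
    have "cmod x \<le> 1"
      using segment_bound[OF that(2)] by simp
    then have "norm (cscale x ?u) \<le> 1 * norm ?u"
      unfolding norm_cscale by (intro mult_right_mono) auto
    then show ?thesis using u4 nh[OF that(1)] R by (simp add: dist_norm)
  qed
  let ?f = "\<lambda>i x. iter_deriv f (replicate i ?u) (c + cscale x ?u)"
  let ?B = "M * norm ?u ^ Suc n / h ^ Suc n"
  have b: "line_holomorphic_on (iter_deriv f (replicate i ?u)) (ball c (R - i * h))"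
      "\<And>z. z \<in> ball c (R - i * h) \<Longrightarrow> cmod (iter_deriv f (replicate i ?u) z) \<le> M * norm ?u ^ i / h ^ i" for i
    using iter_deriv_bound[OF f M h, of "replicate i ?u"] by (auto simp: map_replicate_const prod_list_replicate)
  have "cmod (?f 0 1 - (\<Sum>i\<le>n. ?f i 0 * (1 - 0) ^ i / (fact i))) \<le> ?B * cmod (1 - 0) ^ Suc n / fact n"
  proof (rule complex_Taylor[of "closed_segment 0 1"])
    show "(?f i has_field_derivative ?f (Suc i) x) (at x within closed_segment 0 1)"
      if "x \<in> closed_segment 0 1" "i \<le> n" for i x
      using line_holomorphic_deriv[OF b(1) mem[of i x]] that
      by (auto intro: has_field_derivative_at_within)
    show "cmod (?f (Suc n) x) \<le> ?B" if "x \<in> closed_segment 0 1" for x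
      by (rule b(2)[OF mem]) (use that in auto)
  qed auto
  then have "cmod (f (c + ?u) - (\<Sum>i\<le>n. iter_deriv f (replicate i ?u) c / fact i)) \<le> ?B / fact n"
    by simp
  also have "(\<Sum>i\<le>n. iter_deriv f (replicate i ?u) c / fact i) =
      (\<Sum>i\<le>n. \<Sum>ws\<in>words I i. prod_list (map a ws) * (iter_deriv f (map v ws) c / fact i))"
  proof (rule sum.cong[OF refl])
    fix i assume "i \<in> {..n}"
    then have "c \<in> ball c (R - i * h)" using mem[of i 0] by simp
    from iter_deriv_replicate[OF f M h I this, of a v]
    show "iter_deriv f (replicate i ?u) c / fact i =
        (\<Sum>ws\<in>words I i. prod_list (map a ws) * (iter_deriv f (map v ws) c / fact i))"
      by (simp add: sum_divide_distrib)
  qed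
  also have "?B / fact n \<le> M * (real (Suc n) / 2 ^ Suc n)"
  proof -
    \<comment> \<open>The factor e in the hypothesis on \<open>v\<close> absorbs the bound
      (n+1)^(n+1) / (n+1)! <= e^(n+1) and leaves 2^-(n+1). The factor n + 1 appears because the
      remainder is divided by n! only.\<close>
    have "norm ?u / h \<le> real (Suc n) / (2 * exp 1)"
    proof -
      have "norm ?u / h \<le> (R / (4 * exp 1)) / h"
        using u h by (intro divide_right_mono) auto
      also have "\<dots> = real (Suc n) / (2 * exp 1)"
        using R by (simp add: h_def field_simps)
      finally show ?thesis .
    qed
    then have "(norm ?u / h) ^ Suc n \<le> (real (Suc n) / (2 * exp 1)) ^ Suc n"
      using h by (intro power_mono) auto
    also have "\<dots> = real (Suc n) ^ Suc n / (2 ^ Suc n * exp (real (Suc n)))"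
      by (simp add: power_divide power_mult_distrib exp_of_nat_mult[symmetric] del: power_Suc of_nat_Suc)
    finally have "(norm ?u / h) ^ Suc n / fact n \<le>
        real (Suc n) ^ Suc n / (2 ^ Suc n * exp (real (Suc n))) / fact n"
      by (rule divide_right_mono) simp
    also have "\<dots> = (real (Suc n) ^ Suc n / fact (Suc n)) * (real (Suc n) / (2 ^ Suc n * exp (real (Suc n))))"
      unfolding fact_Suc by (simp add: mult_ac del: power_Suc of_nat_Suc)
    also have "\<dots> \<le> exp (real (Suc n)) * (real (Suc n) / (2 ^ Suc n * exp (real (Suc n))))"
      by (intro mult_right_mono power_div_fact_le_exp) auto
    also have "\<dots> = real (Suc n) / 2 ^ Suc n"
      by simp
    finally have "(norm ?u / h) ^ Suc n / fact n \<le> real (Suc n) / 2 ^ Suc n" .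
    from mult_left_mono[OF this M0] show ?thesis
      by (simp only: power_divide times_divide_eq_right)
  qed
  finally show ?thesis by simp
qed

text \<open>By duality: the scalar bound is applied to the linear combination of the components whose
  coefficients are the conjugated Taylor coefficients themselves.\<close>

lemma word_coeff_bound:
  fixes c :: "'a::real_inner complexified" and f :: "'j \<Rightarrow> 'a complexified \<Rightarrow> complex"
  assumes J: "finite J" and f: "\<And>j. j \<in> J \<Longrightarrow> line_holomorphic_on (f j) (ball c R)"
    and om: "\<And>j. j \<in> J \<Longrightarrow> 0 < om j"
    and M: "\<And>z. z \<in> ball c R \<Longrightarrow> L2_set (\<lambda>j. om j * cmod (f j z)) J \<le> M"
    and R: "0 < R"
  shows "L2_set (\<lambda>j. om j * cmod (iter_deriv (f j) vs c / fact (length vs))) J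
    \<le> M * exp 1 * prod_list (map (\<lambda>v. exp 1 * norm v / R) vs)"
proof -
  let ?d = "length vs" and ?P = "exp 1 * prod_list (map (\<lambda>v. exp 1 * norm v / R) vs)"
  define A where "A j = iter_deriv (f j) vs c / fact ?d" for j
  define S where "S = L2_set (\<lambda>j. om j * cmod (A j)) J"
  \<comment> \<open>One factor \<open>om j\<close> goes with the coefficient and one with
    \<open>f j\<close>, so that Cauchy-Schwarz meets the weighted norm in both places.\<close>
  define a where "a j = of_real ((om j)\<^sup>2) * cnj (A j)" for j
  let ?F = "\<lambda>z. \<Sum>j\<in>J. a j * f j z"
  have fb: "cmod (f j z) \<le> M / om j" if "j \<in> J" "z \<in> ball c R" for j z
  proof -
    have "om j * cmod (f j z) \<le> M"
      using member_le_L2_set[OF J that(1), of "\<lambda>j. om j * cmod (f j z)"] M[OF that(2)] by simp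
    then show ?thesis using om[OF that(1)] by (simp add: field_simps)
  qed
  have Fb: "cmod (?F z) \<le> S * M" if "z \<in> ball c R" for z
  proof -
    have "cmod (?F z) \<le> (\<Sum>j\<in>J. cmod (a j * f j z))" by (rule norm_sum)
    also have "\<dots> = (\<Sum>j\<in>J. \<bar>om j * cmod (A j)\<bar> * \<bar>om j * cmod (f j z)\<bar>)"
      by (simp add: a_def norm_mult abs_mult power2_eq_square mult_ac)
    also have "\<dots> \<le> S * L2_set (\<lambda>j. om j * cmod (f j z)) J"
      unfolding S_def by (rule L2_set_mult_ineq)
    also have "\<dots> \<le> S * M"
      using M[OF that] by (intro mult_left_mono) (auto simp: S_def)
    finally show ?thesis .
  qed
  have "cmod (iter_deriv ?F vs c / fact ?d) \<le> S * M * ?P"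
    using iter_deriv_coeff_bound[of ?F c R "S * M" vs, OF line_holomorphic_on_linear[OF f] Fb R] by (simp add: mult_ac)
  moreover have "iter_deriv ?F vs c / fact ?d = of_real (S\<^sup>2)"
  proof -
    define h where "h = R / (?d + 1)"
    have h: "0 < h" "?d * h < R" using R by (simp_all add: h_def field_simps)
    have "iter_deriv ?F vs c = (\<Sum>j\<in>J. a j * iter_deriv (f j) vs c)"
      by (rule iter_deriv_linear[OF f fb h(1)]) (use h in auto)
    then have "iter_deriv ?F vs c / fact ?d = (\<Sum>j\<in>J. a j * A j)"
      by (simp add: A_def sum_divide_distrib)
    also have "\<dots> = (\<Sum>j\<in>J. of_real ((om j * cmod (A j))\<^sup>2))"
      by (intro sum.cong refl) (simp only: a_def power_mult_distrib of_real_mult complex_norm_square mult_ac)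
    also have "\<dots> = of_real (S\<^sup>2)"
      unfolding S_def L2_set_def by (simp add: sum_nonneg)
    finally show ?thesis .
  qed
  ultimately have "S * S \<le> S * (M * ?P)"
    by (simp add: power2_eq_square mult_ac norm_mult)
  moreover have "0 \<le> S" by (simp add: S_def)
  moreover have "0 \<le> M"
    using M[of c] R by (meson L2_set_nonneg centre_in_ball order_trans)
  moreover have "0 \<le> ?P"
    using R by (intro mult_nonneg_nonneg prod_list_nonneg) auto
  ultimately have "S \<le> M * ?P"
    by (cases "S = 0") auto
  then show ?thesis unfolding S_def A_def by (simp add: mult_ac)
qed

section \<open>Frames\<close>

lemma coord_analysis_op:
  assumes "is_frame \<psi>"
  shows "coord (analysis_op \<psi> v) j = inner v (\<psi> j)"
  using assms by (simp add: is_frame_def analysis_op_def coord_to_ell2)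

lemma norm_ell2_eq: "norm x = sqrt (\<Sum>j. (coord x j)\<^sup>2)"
  by (simp add: norm_ell2_def inner_ell2_def power2_eq_square)

lemma L2_set_coord_le:
  assumes "finite I"
  shows "L2_set (coord x) I \<le> norm x"
  unfolding L2_set_def norm_ell2_eq
  using assms by (intro real_sqrt_le_mono sum_le_suminf summable_coord_square) auto

text \<open>Synthesis is adjoint to analysis: the sum v paired with itself is a pairing of
  \<open>c\<close> with the analysis coefficients of v, and one factor norm v cancels.\<close>

lemma frame_synthesis_bound:
  fixes \<psi> :: "nat \<Rightarrow> 'a::real_inner"
  assumes "is_frame \<psi>"
  shows "\<exists>B>0. \<forall>I c. finite I \<longrightarrow> norm (\<Sum>j\<in>I. c j *\<^sub>R \<psi> j) \<le> B * L2_set c I"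
proof -
  have "bounded_linear (analysis_op \<psi>)" using assms by (simp add: is_frame_def)
  then obtain B where B: "B > 0" "\<And>v. norm (analysis_op \<psi> v) \<le> norm v * B"
    by (meson bounded_linear.pos_bounded)
  have "norm (\<Sum>j\<in>I. c j *\<^sub>R \<psi> j) \<le> B * L2_set c I" if "finite I" for I c
  proof -
    define v where "v = (\<Sum>j\<in>I. c j *\<^sub>R \<psi> j)"
    have "norm v * norm v = (\<Sum>j\<in>I. c j * inner v (\<psi> j))"
      by (simp add: power2_norm_eq_inner[unfolded power2_eq_square] inner_sum_right v_def[symmetric])
        (simp add: v_def inner_sum_right)
    also have "\<dots> \<le> (\<Sum>j\<in>I. \<bar>c j\<bar> * \<bar>coord (analysis_op \<psi> v) j\<bar>)"
      by (rule sum_mono) (simp add: coord_analysis_op[OF assms] flip: abs_mult)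
    also have "\<dots> \<le> L2_set c I * L2_set (coord (analysis_op \<psi> v)) I"
      by (rule L2_set_mult_ineq)
    also have "\<dots> \<le> L2_set c I * (norm v * B)"
      using L2_set_coord_le[OF that, of "analysis_op \<psi> v"] B(2)[of v] by (intro mult_left_mono) auto
    finally have "norm v * norm v \<le> norm v * (B * L2_set c I)" by (simp add: mult_ac)
    then show ?thesis
      unfolding v_def[symmetric] using B(1) by (cases "v = 0") auto
  qed
  with B(1) show ?thesis by blast
qed

lemma synthesis_summable:
  fixes \<psi> :: "nat \<Rightarrow> 'a::{real_inner, banach}"
  assumes B: "\<And>I c. finite I \<Longrightarrow> norm (\<Sum>j\<in>I. c j *\<^sub>R \<psi> j) \<le> B * L2_set c I" "0 < B"
    and c: "summable (\<lambda>j. (c j)\<^sup>2)"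
  shows "summable (\<lambda>j. c j *\<^sub>R \<psi> j)"
  unfolding summable_Cauchy
proof (intro allI impI)
  fix e :: real assume e: "e > 0"
  then have "(e / B)\<^sup>2 > 0" using B by simp
  with c obtain N where N: "\<And>m n. m \<ge> N \<Longrightarrow> norm (\<Sum>j=m..<n. (c j)\<^sup>2) < (e / B)\<^sup>2"
    unfolding summable_Cauchy by blast
  have "norm (\<Sum>j=m..<n. c j *\<^sub>R \<psi> j) < e" if "m \<ge> N" for m n
  proof -
    have "L2_set c {m..<n} < e / B"
      unfolding L2_set_def using N[OF that, of n] e B
      by (intro real_less_lsqrt) (auto simp: sum_nonneg)
    then have "B * L2_set c {m..<n} < e" using B by (simp add: field_simps)
    then show ?thesis using B(1)[of "{m..<n}" c] by simp
  qed
  then show "\<exists>N. \<forall>m\<ge>N. \<forall>n. norm (\<Sum>j=m..<n. c j *\<^sub>R \<psi> j) < e" by blast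
qed

lemma frame_synthesis_summable:
  fixes \<psi> :: "nat \<Rightarrow> 'a::{real_inner, banach}"
  assumes "is_frame \<psi>" "summable (\<lambda>j. (c j)\<^sup>2)"
  shows "summable (\<lambda>j. c j *\<^sub>R \<psi> j)"
proof -
  obtain B where B: "B > 0" "\<forall>I c. finite I \<longrightarrow> norm (\<Sum>j\<in>I. c j *\<^sub>R \<psi> j) \<le> B * L2_set c I"
    using frame_synthesis_bound[OF assms(1)] by (elim exE conjE)
  show ?thesis
    by (rule synthesis_summable[of \<psi> B, OF _ B(1) assms(2)]) (use B(2) in simp)
qed

text \<open>\<open>adjoint\<close> is specified by choice, so it is identified through an explicit
  candidate, whose series converges by the synthesis bound.\<close>

lemma adjoint_analysis_op:
  fixes \<psi> :: "nat \<Rightarrow> 'a::{real_inner, banach}"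
  assumes "is_frame \<psi>"
  shows "adjoint (analysis_op \<psi>) = (\<lambda>c. \<Sum>j. coord c j *\<^sub>R \<psi> j)"
proof (rule adjoint_unique, intro allI)
  fix v c
  have "summable (\<lambda>j. coord c j *\<^sub>R \<psi> j)"
    by (rule frame_synthesis_summable[OF assms summable_coord_square])
  from bounded_linear.suminf[OF bounded_linear_inner_right this, of v]
  show "inner (analysis_op \<psi> v) c = inner v (\<Sum>j. coord c j *\<^sub>R \<psi> j)"
    by (simp add: inner_ell2_def coord_analysis_op[OF assms] mult.commute)
qed

text \<open>The frame operator is coercive, so the map x - rho (S x - y) is a contraction for small
  rho > 0 and S is onto.\<close>

theorem frame_expansion:
  fixes \<psi> :: "nat \<Rightarrow> 'a::{real_inner, banach}"
  assumes fr: "is_frame \<psi>"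
  shows "summable (\<lambda>j. (inner v (dual_frame \<psi> j))\<^sup>2)"
    and "(\<lambda>j. inner v (dual_frame \<psi> j) *\<^sub>R \<psi> j) sums v"
proof -
  define F where "F = analysis_op \<psi>"
  define S where "S = adjoint F \<circ> F"
  have S_eq: "S u = (\<Sum>j. inner u (\<psi> j) *\<^sub>R \<psi> j)" for u
    by (simp add: S_def F_def adjoint_analysis_op[OF fr] coord_analysis_op[OF fr])
  have S_sums: "(\<lambda>j. inner u (\<psi> j) *\<^sub>R \<psi> j) sums S u" for u
    unfolding S_eq using fr frame_synthesis_summable[OF fr, of "\<lambda>j. inner u (\<psi> j)"]
    by (simp add: is_frame_def summable_sums)
  have SF: "inner u (S x) = inner (F u) (F x)" for u x
    using sums_unique[OF bounded_linear.sums[OF bounded_linear_inner_right S_sums, of u x]]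
    by (simp add: inner_ell2_def F_def coord_analysis_op[OF fr] mult.commute)
  interpret F: bounded_linear F using fr by (simp add: is_frame_def F_def)
  have S_diff: "S (x - y) = S x - S y" for x y
    by (rule vector_eq_ldot[THEN iffD1], rule allI) (simp add: SF F.diff inner_diff_right)
  obtain b where b: "b > 0" "\<And>v. norm (F v) \<le> norm v * b"
    using F.pos_bounded by blast
  obtain K where K: "\<And>c. c \<in> range F \<Longrightarrow> norm (inv_into UNIV F c) \<le> K * norm c"
    using fr by (auto simp: is_frame_def F_def)
  have inj: "inj F" using fr by (simp add: is_frame_def F_def)
  \<comment> \<open>The constant in \<open>is_frame\<close> may be zero or negative; the maximum
    makes it positive.\<close>
  define k where "k = max K 1"
  have k: "k > 0" by (simp add: k_def)
  have low: "norm v \<le> k * norm (F v)" for v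
  proof -
    have "norm v \<le> K * norm (F v)" using K[of "F v"] inj by simp
    also have "\<dots> \<le> k * norm (F v)" by (intro mult_right_mono) (auto simp: k_def)
    finally show ?thesis .
  qed
  define a where "a = 1 / k\<^sup>2"
  \<comment> \<open>Taking the maximum with \<open>a\<close> ensures a <= d, so that 1 - a^2/d^2 is
    nonnegative.\<close>
  define d where "d = max (b\<^sup>2) a"
  have a: "a > 0" using k by (simp add: a_def)
  have d: "d > 0" "a \<le> d" using a by (auto simp: d_def)
  have lower: "a * (norm x)\<^sup>2 \<le> inner x (S x)" for x
  proof -
    have "(norm x)\<^sup>2 \<le> (k * norm (F x))\<^sup>2" using low[of x] by (intro power_mono) auto
    then show ?thesis
      using k by (simp add: a_def SF power_mult_distrib power2_norm_eq_inner divide_le_eq mult.commute)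
  qed
  have upper: "norm (S x) \<le> d * norm x" for x
  proof -
    have "norm (S x) * norm (S x) = inner (F (S x)) (F x)"
      by (simp add: SF[symmetric] power2_norm_eq_inner[unfolded power2_eq_square])
    also have "\<dots> \<le> norm (F (S x)) * norm (F x)" by (rule norm_cauchy_schwarz)
    also have "\<dots> \<le> (norm (S x) * b) * (norm x * b)"
      using b by (intro mult_mono) auto
    finally have "norm (S x) * norm (S x) \<le> norm (S x) * (b\<^sup>2 * norm x)"
      by (simp add: power2_eq_square mult_ac)
    then have "norm (S x) \<le> b\<^sup>2 * norm x"
      by (cases "S x = 0") auto
    also have "\<dots> \<le> d * norm x" by (intro mult_right_mono) (auto simp: d_def)
    finally show ?thesis .
  qed
  have S_inj: "x = y" if "S x = S y" for x y
    using lower[of "x - y"] a that by (simp add: S_diff mult_le_0_iff)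
  have S_surj: "\<exists>x. S x = y" for y
  proof -
    \<comment> \<open>Minimizer of 1 - 2 a \<rho> + d^2 \<rho>^2, the bound for the squared
      contraction factor.\<close>
    define \<rho> where "\<rho> = a / d\<^sup>2"
    have \<rho>: "\<rho> > 0" using a d by (simp add: \<rho>_def)
    define q where "q = sqrt (1 - a\<^sup>2 / d\<^sup>2)"
    have ad: "a\<^sup>2 / d\<^sup>2 \<le> 1" "a\<^sup>2 / d\<^sup>2 > 0" using a d by (simp_all add: power_mono)
    have q: "0 \<le> q" "q < 1" using ad by (simp_all add: q_def)
    let ?T = "\<lambda>x. x - \<rho> *\<^sub>R (S x - y)"
    have "dist (?T x) (?T x') \<le> q * dist x x'" for x x'
    proof -
      define e where "e = x - x'"
      have E: "?T x - ?T x' = e - \<rho> *\<^sub>R S e"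
        by (simp add: e_def S_diff algebra_simps)
      have "(norm (e - \<rho> *\<^sub>R S e))\<^sup>2 = (norm e)\<^sup>2 - 2 * \<rho> * inner e (S e) + \<rho>\<^sup>2 * (norm (S e))\<^sup>2"
        unfolding power2_norm_eq_inner by (simp add: inner_simps inner_commute power2_eq_square algebra_simps)
      moreover have "2 * \<rho> * (a * (norm e)\<^sup>2) \<le> 2 * \<rho> * inner e (S e)"
        using \<rho> lower[of e] by (intro mult_left_mono) auto
      moreover have "\<rho>\<^sup>2 * (norm (S e))\<^sup>2 \<le> \<rho>\<^sup>2 * (d * norm e)\<^sup>2"
        using upper[of e] by (intro mult_left_mono power_mono) auto
      moreover have "\<rho>\<^sup>2 * (d * norm e)\<^sup>2 = a\<^sup>2 / d\<^sup>2 * (norm e)\<^sup>2" "2 * \<rho> * (a * (norm e)\<^sup>2) = 2 * (a\<^sup>2 / d\<^sup>2 * (norm e)\<^sup>2)"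
        using d by (simp_all add: \<rho>_def field_simps power2_eq_square)
      ultimately have "(norm (?T x - ?T x'))\<^sup>2 \<le> (1 - a\<^sup>2 / d\<^sup>2) * (norm e)\<^sup>2"
        unfolding E left_diff_distrib mult_1 by linarith
      also have "\<dots> = (q * norm e)\<^sup>2" using ad by (simp add: q_def power_mult_distrib)
      finally have "norm (?T x - ?T x') \<le> q * norm e"
        by (rule power2_le_imp_le) (use q in simp)
      then show ?thesis
        unfolding dist_norm e_def .
    qed
    with q obtain x where "?T x = x" using banach_fix_type[of q ?T] by blast
    then show ?thesis using \<rho> by auto
  qed
  have S_dual: "S (dual_frame \<psi> j) = \<psi> j" for j
  proof -
    have "\<psi> j \<in> range S" using S_surj by (metis rangeI)
    then show ?thesis
      unfolding dual_frame_def F_def[symmetric] S_def[symmetric] by (rule f_inv_into_f)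
  qed
  obtain u where u: "S u = v" using S_surj by blast
  \<comment> \<open>Self-adjointness of \<open>S\<close> moves it to the dual frame element, so the
    expansion of \<open>v\<close> is the defining series of \<open>S u\<close>.\<close>
  have "inner v (dual_frame \<psi> j) = inner u (\<psi> j)" for j
    using SF[of "dual_frame \<psi> j" u] SF[of u "dual_frame \<psi> j"] u
    by (simp add: S_dual inner_commute)
  then show "summable (\<lambda>j. (inner v (dual_frame \<psi> j))\<^sup>2)"
    and "(\<lambda>j. inner v (dual_frame \<psi> j) *\<^sub>R \<psi> j) sums v"
    using S_sums[of u] u fr by (auto simp: is_frame_def)
qed

section \<open>The image of the cube\<close>

lemma compact_unit_cube: "compact unit_cube"
proof -
  have "unit_cube = PiE UNIV (\<lambda>_. {-1..1})"
    by (auto simp: unit_cube_def PiE_def Pi_def)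
  moreover have "compactin (product_topology (\<lambda>_. euclidean) UNIV) (PiE UNIV (\<lambda>_ :: nat. {-1..1 :: real}))"
    by (auto simp: compactin_PiE)
  ultimately show ?thesis
    by (simp add: euclidean_product_topology)
qed

lemma uniform_limit_cube:
  fixes v :: "nat \<Rightarrow> 'a::banach"
  assumes "summable (\<lambda>j. norm (v j))"
  shows "uniform_limit unit_cube (\<lambda>n y. \<Sum>j<n. y j *\<^sub>R v j) (\<lambda>y. \<Sum>j. y j *\<^sub>R v j) sequentially"
proof (rule Weierstrass_m_test[OF _ assms])
  fix j and y :: "nat \<Rightarrow> real" assume "y \<in> unit_cube"
  then have "\<bar>y j\<bar> \<le> 1" by (auto simp: unit_cube_def abs_le_iff minus_le_iff)
  then have "\<bar>y j\<bar> * norm (v j) \<le> 1 * norm (v j)" by (rule mult_right_mono) simp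
  then show "norm (y j *\<^sub>R v j) \<le> norm (v j)" by simp
qed

lemma compact_cube_series:
  fixes v :: "nat \<Rightarrow> 'a::banach"
  assumes "summable (\<lambda>j. norm (v j))"
  shows "compact ((\<lambda>y. \<Sum>j. y j *\<^sub>R v j) ` unit_cube)"
proof (rule compact_continuous_image[OF _ compact_unit_cube])
  show "continuous_on unit_cube (\<lambda>y. \<Sum>j. y j *\<^sub>R v j)"
    by (rule uniform_limit_theorem[OF _ uniform_limit_cube[OF assms]])
      (auto intro!: always_eventually continuous_intros continuous_on_product_coordinates[THEN continuous_on_subset])
qed

section \<open>Weights and exponents\<close>

text \<open>Monotonicity gives (m+1) w_m^(1/g) <= the sum of all w_j^(1/g), which is finite as 1/g >
  1.\<close>

lemma weights_decay:
  assumes w: "admissible_weights w" and g: "0 < g" "g < 1"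
  shows "\<exists>C>0. \<forall>m. w m \<le> C * real (m + 1) powr (- g)"
proof -
  define \<epsilon> where "\<epsilon> = 1 / g - 1"
  have "\<epsilon> > 0" using g by (simp add: \<epsilon>_def)
  then have sm: "summable (\<lambda>j. w j powr (1 / g))"
    using w unfolding admissible_weights_def \<epsilon>_def by (metis add.commute diff_add_cancel)
  have pos: "0 < w j" for j using w by (simp add: admissible_weights_def)
  have dec: "w m \<le> w j" if "j \<le> m" for j m
    using w that by (auto simp: admissible_weights_def decseq_def)
  define S where "S = (\<Sum>j. w j powr (1 / g))"
  have bound: "w m \<le> S powr g * real (m + 1) powr (- g)" for m
  proof -
    have "real (m + 1) * w m powr (1 / g) = (\<Sum>j<m + 1. w m powr (1 / g))" by simp
    also have "\<dots> \<le> (\<Sum>j<m + 1. w j powr (1 / g))"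
      using pos dec g by (intro sum_mono powr_mono2) (auto simp: less_imp_le)
    also have "\<dots> \<le> S"
      unfolding S_def using sm by (intro sum_le_suminf) auto
    finally have "w m powr (1 / g) \<le> S / real (m + 1)"
      by (simp add: field_simps)
    then have "(w m powr (1 / g)) powr g \<le> (S / real (m + 1)) powr g"
      using g by (intro powr_mono2) auto
    moreover have "0 \<le> S" unfolding S_def using sm by (intro suminf_nonneg) auto
    ultimately show ?thesis
      using g pos[of m] by (simp add: powr_powr powr_divide powr_minus_divide)
  qed
  have "0 < S powr g"
  proof -
    have "w 0 \<le> S powr g" using bound[of 0] by simp
    with pos[of 0] show ?thesis by linarith
  qed
  with bound show ?thesis by blast
qed

lemma weights_summable_powr:
  assumes "admissible_weights w" "1 < q"
  shows "summable (\<lambda>j. w j powr q)"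
  using assms unfolding admissible_weights_def by (metis add_diff_cancel_left' diff_add_cancel diff_gt_0_iff_gt add.commute)

lemma sum_words_prod:
  fixes f :: "'l \<Rightarrow> real"
  assumes "finite I"
  shows "(\<Sum>ws\<in>words I n. prod_list (map f ws)) = (\<Sum>l\<in>I. f l) ^ n"
proof (induction n)
  case (Suc n)
  then show ?case
    by (simp add: sum_words_Suc[OF assms] sum_distrib_left[symmetric] sum_distrib_right[symmetric])
qed simp

lemma prod_list_powr:
  fixes f :: "'l \<Rightarrow> real"
  assumes "\<And>l. 0 \<le> f l"
  shows "prod_list (map f ws) powr p = prod_list (map (\<lambda>l. f l powr p) ws)"
  using assms by (induction ws) (simp_all add: powr_mult prod_list_nonneg)

text \<open>With l the rounded-up binary logarithm of N, l is bounded by a multiple of N^d; d is e/3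
  because of the cube.\<close>

lemma polylog_bound:
  fixes a b :: nat
  assumes "0 < e"
  shows "\<exists>C>0. \<forall>N\<ge>1. \<exists>l. N \<le> 2 ^ l \<and> real (a + b * l) ^ 3 \<le> C * real N powr e"
proof -
  define d where "d = e / 3"
  have d: "d > 0" using assms by (simp add: d_def)
  define C where "C = real a + real b * (2 + 1 / (d * ln 2))"
  have C: "C \<ge> 0" using d by (simp add: C_def)
  have "\<exists>l. N \<le> 2 ^ l \<and> real (a + b * l) ^ 3 \<le> (C + 1) ^ 3 * real N powr e" if N: "N \<ge> 1" for N :: nat
  proof -
    define l where "l = nat \<lceil>log 2 (real N)\<rceil>"
    have log0: "0 \<le> log 2 (real N)" using N by simp
    have l: "log 2 (real N) \<le> real l" "real l \<le> log 2 (real N) + 1"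
      using log0 unfolding l_def by linarith+
    have "real N = 2 powr (log 2 (real N))" using N by simp
    also have "\<dots> \<le> 2 powr (real l)" using l by (intro powr_mono) auto
    also have "\<dots> = real (2 ^ l)" by (simp add: powr_realpow)
    finally have 1: "N \<le> 2 ^ l" by (simp only: of_nat_le_iff)
    have N1: "1 \<le> real N powr d" using N d by (simp add: ge_one_powr_ge_zero)
    have "ln (real N powr d) \<le> real N powr d - 1"
      using N by (intro ln_le_minus_one) auto
    then have "d * ln (real N) \<le> real N powr d"
      using N by (simp add: ln_powr)
    then have "ln (real N) \<le> real N powr d / d"
      using d by (simp add: field_simps)
    then have "log 2 (real N) \<le> (1 / (d * ln 2)) * real N powr d"
      unfolding log_def using d by (simp add: divide_le_eq field_simps)
    then have "real l \<le> (1 / (d * ln 2)) * real N powr d + 1 * real N powr d"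
      using l N1 by linarith
    then have "real l \<le> (2 + 1 / (d * ln 2)) * real N powr d"
      using N1 by (simp add: algebra_simps)
    then have "real b * real l \<le> real b * ((2 + 1 / (d * ln 2)) * real N powr d)"
      by (rule mult_left_mono) simp
    moreover have "real a * 1 \<le> real a * real N powr d"
      using N1 by (rule mult_left_mono) simp
    ultimately have "real (a + b * l) \<le> C * real N powr d"
      by (simp add: C_def algebra_simps)
    also have "\<dots> \<le> (C + 1) * real N powr d"
      by (simp add: mult_right_mono)
    finally have "real (a + b * l) ^ 3 \<le> ((C + 1) * real N powr d) ^ 3"
      by (rule power_mono) simp
    also have "\<dots> = (C + 1) ^ 3 * real N powr e"
      using N by (simp add: power_mult_distrib powr_power d_def)
    finally show ?thesis using 1 by blast
  qed
  then show ?thesis using C by (intro exI[of _ "(C + 1) ^ 3"]) auto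
qed

text \<open>\<tau> is g times the optimal rate: this makes 1 + \<tau> < s strict and covers the loss
  g in the decay of the weights. The second factor g in the final rate comes from running the
  construction with N^g; together they lose at most 2 x \<mu> <= \<delta>.\<close>

lemma exponent_choice:
  fixes s t \<delta> :: real
  assumes "1 < s" "0 < t" "0 < \<delta>"
  shows "\<exists>g \<tau>. 0 < g \<and> g < 1 \<and> 0 < \<tau> \<and> \<tau> \<le> g * t \<and> 1 + \<tau> < s \<and> min (s - 1) t - \<delta> \<le> g * \<tau>"
proof -
  define \<mu> where "\<mu> = min (s - 1) t"
  have \<mu>: "0 < \<mu>" "\<mu> \<le> s - 1" "\<mu> \<le> t" using assms by (auto simp: \<mu>_def)
  define x where "x = min (1/2) (\<delta> / (2 * \<mu>))"
  have x: "0 < x" "x \<le> 1/2" "x \<le> \<delta> / (2 * \<mu>)" using assms \<mu> by (auto simp: x_def)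
  define g where "g = 1 - x"
  have g: "0 < g" "g < 1" using x by (auto simp: g_def)
  have "x * \<mu> \<le> \<delta> / 2" using x \<mu> by (simp add: field_simps)
  moreover have "g * (g * \<mu>) = \<mu> - 2 * (x * \<mu>) + x * x * \<mu>" by (simp add: g_def algebra_simps)
  moreover have "0 \<le> x * x * \<mu>" using \<mu> by simp
  ultimately have "\<mu> - \<delta> \<le> g * (g * \<mu>)" by linarith
  moreover have "g * \<mu> < s - 1"
  proof -
    have "g * \<mu> < 1 * \<mu>" using g \<mu> by (intro mult_strict_right_mono) auto
    then show ?thesis using \<mu>(2) by linarith
  qed
  ultimately show ?thesis
    using g \<mu> by (intro exI[of _ g] exI[of _ "g * \<mu>"]) (auto simp: \<mu>_def[symmetric])
qed

section \<open>Localization by a partition of unity\<close>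

definition hat :: "real \<Rightarrow> real" where
  "hat x = max 0 (1 - \<bar>x\<bar>)"

definition clip01 :: "real \<Rightarrow> real" where
  "clip01 x = max 0 (1 - max 0 (1 - x))"

lemma hat_sum:
  assumes "\<bar>x\<bar> \<le> real H"
  shows "(\<Sum>k=-int H..int H. hat (x - of_int k)) = 1"
proof -
  define f where "f = \<lfloor>x\<rfloor>"
  have f: "of_int f \<le> x" "x < of_int f + 1" by (simp_all add: f_def)
  have fH: "- int H \<le> f" "f \<le> int H" using assms f unfolding abs_le_iff by linarith+
  have zero: "hat (x - of_int k) = 0" if "k \<noteq> f" "k \<noteq> f + 1" for k
  proof -
    have "k \<le> f - 1 \<or> f + 2 \<le> k" using that by linarith
    then have "real_of_int k \<le> of_int f - 1 \<or> of_int f + 2 \<le> real_of_int k"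
      by (metis of_int_add of_int_diff of_int_1 of_int_le_iff of_int_numeral)
    then show ?thesis using f by (auto simp: hat_def)
  qed
  have val: "hat (x - of_int f) = 1 - (x - of_int f)" "hat (x - of_int (f + 1)) = x - of_int f"
    using f by (auto simp: hat_def)
  have "(\<Sum>k=-int H..int H. hat (x - of_int k)) = (\<Sum>k\<in>{f, f + 1} \<inter> {- int H..int H}. hat (x - of_int k))"
    using zero by (intro sum.mono_neutral_right) auto
  \<comment> \<open>At x = H the node f + 1 falls outside the range, but its hat vanishes
    there.\<close>
  also have "\<dots> = 1"
  proof (cases "f = int H")
    case True
    then have "x = of_int f" using f assms by auto
    moreover have "{f, f + 1} \<inter> {- int H..int H} = {f}" using True by auto
    ultimately show ?thesis by (simp add: hat_def)
  next
    case False
    then have "{f, f + 1} \<inter> {- int H..int H} = {f, f + 1}" using fH by auto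
    then show ?thesis using val by simp
  qed
  finally show ?thesis .
qed

definition cells :: "nat \<Rightarrow> nat \<Rightarrow> (nat \<Rightarrow> int) set" where
  "cells J H = PiE {..<J} (\<lambda>_. {- int H..int H})"

definition bump :: "nat \<Rightarrow> nat \<Rightarrow> (nat \<Rightarrow> int) \<Rightarrow> (nat \<Rightarrow> real) \<Rightarrow> real" where
  "bump J H k y = (\<Prod>i<J. hat (real H * y i - of_int (k i)))"

text \<open>Only the first \<open>J\<close> coordinates are subdivided; the others have centre 0 and
  mesh 1, so their local coordinate is the coordinate itself.\<close>

definition center :: "nat \<Rightarrow> nat \<Rightarrow> (nat \<Rightarrow> int) \<Rightarrow> nat \<Rightarrow> real" where
  "center J H k i = (if i < J then of_int (k i) / real H else 0)"

definition mesh :: "nat \<Rightarrow> nat \<Rightarrow> nat \<Rightarrow> real" where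
  "mesh J H i = (if i < J then 1 / real H else 1)"

text \<open>The letters (i, True) and (i, False) carry the positive and the negative part of the
  local coordinate of index i, so that all features are products of numbers in [0, 1].\<close>

definition local_coord :: "nat \<Rightarrow> nat \<Rightarrow> (nat \<Rightarrow> int) \<Rightarrow> (nat \<Rightarrow> real) \<Rightarrow> nat \<times> bool \<Rightarrow> real" where
  "local_coord J H k y l = clip01 ((if snd l then 1 else -1) * ((y (fst l) - center J H k (fst l)) / mesh J H (fst l)))"

lemma finite_cells: "finite (cells J H)"
  unfolding cells_def by (intro finite_PiE) auto

lemma cells_nonempty: "cells J H \<noteq> {}"
  by (auto simp: cells_def PiE_eq_empty_iff)

lemma hat_nonneg: "0 \<le> hat x"
  by (simp add: hat_def)

lemma bump_nonneg: "0 \<le> bump J H k y"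
  unfolding bump_def by (intro prod_nonneg) (auto simp: hat_nonneg)

lemma unit_cube_abs: "y \<in> unit_cube \<Longrightarrow> \<bar>y i\<bar> \<le> 1"
  by (auto simp: unit_cube_def abs_le_iff minus_le_iff)

lemma bump_sum:
  assumes "y \<in> unit_cube"
  shows "(\<Sum>k\<in>cells J H. bump J H k y) = 1"
proof -
  have "(\<Sum>k\<in>cells J H. bump J H k y) = (\<Prod>i<J. \<Sum>k=-int H..int H. hat (real H * y i - of_int k))"
    unfolding cells_def bump_def by (subst prod_sum_PiE) auto
  also have "\<dots> = (\<Prod>i<J. 1)"
  proof (intro prod.cong refl hat_sum)
    fix i
    have "real H * \<bar>y i\<bar> \<le> real H * 1"
      using unit_cube_abs[OF assms] by (intro mult_left_mono) auto
    then show "\<bar>real H * y i\<bar> \<le> real H" by (simp add: abs_mult)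
  qed
  finally show ?thesis by simp
qed

lemma clip01_range: "clip01 x \<in> {0..1}"
  by (auto simp: clip01_def)

lemma clip01_diff: "\<bar>x\<bar> \<le> 1 \<Longrightarrow> clip01 x - clip01 (- x) = x"
  by (auto simp: clip01_def max_def)

lemma local_coord_range: "0 \<le> local_coord J H k y l" "local_coord J H k y l \<le> 1"
  unfolding local_coord_def using clip01_range by auto

lemma center_in_cube:
  assumes "k \<in> cells J H" "0 < H"
  shows "center J H k \<in> unit_cube"
proof -
  have "center J H k i \<in> {-1..1}" for i
  proof (cases "i < J")
    case True
    then have "k i \<in> {- int H..int H}"
      using PiE_mem[OF assms(1)[unfolded cells_def], of i] by simp
    then have "- real H \<le> real_of_int (k i)" "real_of_int (k i) \<le> real H" by auto
    then have "- 1 \<le> real_of_int (k i) / real H" "real_of_int (k i) / real H \<le> 1"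
      using assms(2) by (simp_all add: le_divide_eq divide_le_eq)
    then show ?thesis using True by (simp add: center_def)
  qed (simp add: center_def)
  then show ?thesis by (simp add: unit_cube_def)
qed

text \<open>On the support of the bump every local coordinate lies in [-1, 1], where the clipped
  positive and negative parts recombine exactly.\<close>

lemma local_expansion:
  fixes v :: "nat \<Rightarrow> 'a::real_vector"
  assumes y: "y \<in> unit_cube" and b: "bump J H k y \<noteq> 0" and H: "0 < H" and J: "J \<le> n"
  shows "(\<Sum>i<n. y i *\<^sub>R v i) = (\<Sum>i<J. center J H k i *\<^sub>R v i) +
    (\<Sum>l\<in>{..<n} \<times> UNIV. local_coord J H k y l *\<^sub>R
      ((if snd l then mesh J H (fst l) else - mesh J H (fst l)) *\<^sub>R v (fst l)))"
proof -
  let ?z = "\<lambda>i. (y i - center J H k i) / mesh J H i"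
  have z: "\<bar>?z i\<bar> \<le> 1" for i
  proof (cases "i < J")
    case True
    then have "hat (real H * y i - of_int (k i)) \<noteq> 0"
      using b by (auto simp: bump_def)
    then have "\<bar>real H * y i - of_int (k i)\<bar> \<le> 1" by (simp add: hat_def max_def split: if_splits)
    moreover have "?z i = real H * y i - of_int (k i)"
      using True H by (simp add: center_def mesh_def field_simps)
    ultimately show ?thesis by simp
  next
    case False
    then show ?thesis using unit_cube_abs[OF y] by (simp add: center_def mesh_def)
  qed
  have mesh: "mesh J H i \<noteq> 0" for i using H by (simp add: mesh_def)
  have "(\<Sum>l\<in>{..<n} \<times> UNIV. local_coord J H k y l *\<^sub>R
      ((if snd l then mesh J H (fst l) else - mesh J H (fst l)) *\<^sub>R v (fst l)))
    = (\<Sum>i<n. \<Sum>b\<in>UNIV. local_coord J H k y (i, b) *\<^sub>R ((if b then mesh J H i else - mesh J H i) *\<^sub>R v i))"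
    by (simp add: sum.cartesian_product case_prod_beta)
  also have "\<dots> = (\<Sum>i<n. (y i - center J H k i) *\<^sub>R v i)"
  proof (intro sum.cong refl)
    fix i
    have "(\<Sum>b\<in>UNIV. local_coord J H k y (i, b) *\<^sub>R ((if b then mesh J H i else - mesh J H i) *\<^sub>R v i)) =
        ((clip01 (?z i) - clip01 (- ?z i)) * mesh J H i) *\<^sub>R v i"
      by (simp add: UNIV_bool local_coord_def scaleR_left_diff_distrib left_diff_distrib del: minus_diff_eq)
    also have "\<dots> = (y i - center J H k i) *\<^sub>R v i"
      unfolding clip01_diff[OF z] using mesh by simp
    finally show "(\<Sum>b\<in>UNIV. local_coord J H k y (i, b) *\<^sub>R ((if b then mesh J H i else - mesh J H i) *\<^sub>R v i)) =
        (y i - center J H k i) *\<^sub>R v i" .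
  qed
  also have "\<dots> = (\<Sum>i<n. y i *\<^sub>R v i) - (\<Sum>i<n. center J H k i *\<^sub>R v i)"
    by (simp add: scaleR_left_diff_distrib sum_subtractf)
  also have "(\<Sum>i<n. center J H k i *\<^sub>R v i) = (\<Sum>i<J. center J H k i *\<^sub>R v i)"
    using J by (intro sum.mono_neutral_right) (auto simp: center_def)
  finally show ?thesis by (simp add: algebra_simps)
qed

text \<open>\<open>J\<close> leaves a tail below e/2, and dividing the remaining finitely many terms
  by a large \<open>H\<close> makes them small as well. The tail keeps mesh 1, so there are only
  finitely many cells.\<close>

lemma mesh_choice:
  fixes c :: "nat \<Rightarrow> real"
  assumes c: "\<And>i. 0 \<le> c i" and sm: "summable (\<lambda>i. c i powr p)" and p: "0 < p" and e: "0 < e"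
  shows "\<exists>J H. 0 < J \<and> 0 < H \<and> (\<forall>n. (\<Sum>i<n. (mesh J H i * c i) powr p) \<le> e)"
proof -
  obtain J where J: "\<And>n. norm (\<Sum>i=Suc J..<n. c i powr p) < e / 2"
    using sm[unfolded summable_Cauchy, rule_format, of "e / 2"] e by (meson Suc_n_not_le_n half_gt_zero nat_le_linear)
  define S where "S = (\<Sum>i<Suc J. c i powr p)"
  have S: "0 \<le> S" unfolding S_def by (intro sum_nonneg) auto
  \<comment> \<open>S + 1 in place of S keeps the lower bound for \<open>H\<close> positive when the
    head vanishes.\<close>
  obtain H :: nat where H: "(2 * (S + 1) / e) powr (1 / p) < real H"
    using reals_Archimedean2 by blast
  have "0 < (2 * (S + 1) / e) powr (1 / p)" using S e by simp
  then have H0: "0 < H" using H by linarith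
  have "((2 * (S + 1) / e) powr (1 / p)) powr p \<le> real H powr p"
    using H p by (intro powr_mono2) auto
  then have Hp: "2 * (S + 1) / e \<le> real H powr p"
    using S e p by (simp add: powr_powr)
  have low: "(\<Sum>i<Suc J. (mesh (Suc J) H i * c i) powr p) \<le> e / 2"
  proof -
    have "(\<Sum>i<Suc J. (mesh (Suc J) H i * c i) powr p) = (\<Sum>i<Suc J. c i powr p / real H powr p)"
      using c by (intro sum.cong) (auto simp: mesh_def powr_divide)
    also have "\<dots> = S / real H powr p" by (simp only: S_def sum_divide_distrib)
    also have "\<dots> \<le> S / (2 * (S + 1) / e)"
      using Hp S e H0 by (intro divide_left_mono mult_pos_pos) auto
    also have "\<dots> \<le> e / 2" using S e by (simp add: field_simps)
    finally show ?thesis .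
  qed
  have "(\<Sum>i<n. (mesh (Suc J) H i * c i) powr p) \<le> e" for n
  proof -
    have "(\<Sum>i<n. (mesh (Suc J) H i * c i) powr p) \<le> (\<Sum>i\<in>{..<Suc J} \<union> {Suc J..<n}. (mesh (Suc J) H i * c i) powr p)"
      by (intro sum_mono2) auto
    also have "\<dots> = (\<Sum>i<Suc J. (mesh (Suc J) H i * c i) powr p) + (\<Sum>i=Suc J..<n. (mesh (Suc J) H i * c i) powr p)"
      by (intro sum.union_disjoint) auto
    also have "(\<Sum>i=Suc J..<n. (mesh (Suc J) H i * c i) powr p) = (\<Sum>i=Suc J..<n. c i powr p)"
      by (intro sum.cong) (auto simp: mesh_def)
    also have "\<dots> \<le> e / 2" using J[of n] by simp
    finally show ?thesis using low by simp
  qed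
  with H0 show ?thesis by (intro exI[of _ "Suc J"] exI[of _ H]) auto
qed

section \<open>Sums over words of bounded length\<close>

definition words_upto :: "'l set \<Rightarrow> nat \<Rightarrow> 'l list set" where
  "words_upto I D = {ws. set ws \<subseteq> I \<and> length ws \<le> D}"

lemma finite_words_upto: "finite I \<Longrightarrow> finite (words_upto I D)"
  unfolding words_upto_def by (rule finite_lists_length_le)

lemma sum_words_upto:
  assumes "finite I"
  shows "(\<Sum>ws\<in>words_upto I D. f ws) = (\<Sum>i\<le>D. \<Sum>ws\<in>words I i. f ws)"
proof -
  have "words_upto I D = (\<Union>i\<in>{..D}. words I i)"
    by (auto simp: words_upto_def words_def)
  then show ?thesis
    using finite_words[OF assms] by (simp only:) (rule sum.UNION_disjoint, auto simp: words_def)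
qed

text \<open>The words of length i sum to the i-th power of the letter sum, a geometric series. The
  bound is uniform in \<open>D\<close> and in the number of letters, which is why both may be taken
  as large as needed.\<close>

lemma word_weight_sum:
  fixes \<theta> :: "'l \<Rightarrow> real"
  assumes I: "finite I" and \<theta>: "\<And>l. 0 \<le> \<theta> l" and s: "(\<Sum>l\<in>I. \<theta> l powr p) \<le> 1/4"
  shows "(\<Sum>ws\<in>words_upto I D. prod_list (map \<theta> ws) powr p) \<le> 2"
proof -
  have "(\<Sum>ws\<in>words_upto I D. prod_list (map \<theta> ws) powr p) = (\<Sum>i\<le>D. (\<Sum>l\<in>I. \<theta> l powr p) ^ i)"
    by (simp add: sum_words_upto[OF I] prod_list_powr[OF \<theta>] sum_words_prod[OF I])
  also have "\<dots> \<le> (\<Sum>i\<le>D. (1/2) ^ i)"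
    using s by (intro sum_mono power_mono) (auto intro: sum_nonneg)
  also have "\<dots> \<le> (\<Sum>i. (1/2) ^ i)"
    by (intro sum_le_suminf) auto
  also have "\<dots> = 2" by (subst suminf_geometric) auto
  finally show ?thesis .
qed

section \<open>Expansion in a cell\<close>

lemma cscale_of_real: "cscale (of_real a) (of_real_part x) = of_real_part (a *\<^sub>R x)"
  by (simp add: cscale_def of_real_part_def)

lemma of_real_part_add: "of_real_part (x + y) = of_real_part x + of_real_part y"
  by (simp add: of_real_part_def)

lemma of_real_part_sum: "of_real_part (\<Sum>i\<in>I. f i) = (\<Sum>i\<in>I. of_real_part (f i))"
  by (simp add: of_real_part_def prod_eq_iff fst_sum snd_sum)

lemma norm_of_real_part [simp]: "norm (of_real_part x) = norm (x :: 'a::real_normed_vector)"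
  by (simp add: of_real_part_def norm_prod_def)

lemma L2_set_sum_le: "L2_set (\<lambda>j. \<Sum>i\<in>I. f i j) J \<le> (\<Sum>i\<in>I. L2_set (f i) J)"
proof (induction I rule: infinite_finite_induct)
  case (insert i I)
  have "L2_set (\<lambda>j. f i j + (\<Sum>i\<in>I. f i j)) J \<le> L2_set (f i) J + L2_set (\<lambda>j. \<Sum>i\<in>I. f i j) J"
    by (rule L2_set_triangle_ineq)
  then show ?case using insert by simp
qed (auto simp: L2_set_def)

lemma smooth_norm_L2_set:
  assumes "y \<in> smooth_space w \<eta> t" "smooth_norm w \<eta> t y \<le> M" "\<And>j. 0 < w j"
  shows "L2_set (\<lambda>j. w j powr (- t) * cmod (cinner_real y (dual_frame \<eta> j))) {..<m} \<le> M"
proof -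
  have "(w j powr (- t))\<^sup>2 = w j powr (- 2 * t)" for j
    using assms(3)[of j] by (simp add: power2_eq_square powr_add[symmetric])
  then have "L2_set (\<lambda>j. w j powr (- t) * cmod (cinner_real y (dual_frame \<eta> j))) {..<m} =
      sqrt (\<Sum>j<m. (cmod (cinner_real y (dual_frame \<eta> j)))\<^sup>2 * w j powr (- 2 * t))"
    by (simp add: L2_set_def power_mult_distrib mult.commute)
  also have "\<dots> \<le> smooth_norm w \<eta> t y"
    unfolding smooth_norm_def using assms(1)
    by (intro real_sqrt_le_mono sum_le_suminf) (auto simp: smooth_space_def)
  finally show ?thesis using assms(2) by simp
qed

text \<open>The weights decrease, so 1 <= w_d^t w_j^(-t) for every discarded index j >= d.\<close>

lemma weighted_tail:
  fixes a :: "nat \<Rightarrow> real"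
  assumes w: "\<And>j. 0 < w j" "decseq w" and t: "0 < t"
    and M: "L2_set (\<lambda>j. w j powr (- t) * b j) {..<m} \<le> M" and ab: "\<And>j. \<bar>a j\<bar> \<le> b j"
  shows "L2_set a {d..<m} \<le> w d powr t * M"
proof -
  have "L2_set a {d..<m} \<le> L2_set (\<lambda>j. w d powr t * (w j powr (- t) * b j)) {d..<m}"
  proof -
    have "\<bar>a j\<bar> \<le> w d powr t * (w j powr (- t) * b j)" if "j \<in> {d..<m}" for j
    proof -
      have "w j powr t \<le> w d powr t"
        using w that t by (intro powr_mono2) (auto simp: decseq_def less_imp_le)
      then have "1 \<le> w d powr t * w j powr (- t)"
        using w(1)[of j] by (simp add: powr_minus field_simps)
      then have "1 * b j \<le> (w d powr t * w j powr (- t)) * b j"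
        using ab[of j] by (intro mult_right_mono) auto
      then show ?thesis using ab[of j] by (simp add: mult_ac)
    qed
    then have "L2_set (\<lambda>j. \<bar>a j\<bar>) {d..<m} \<le> L2_set (\<lambda>j. w d powr t * (w j powr (- t) * b j)) {d..<m}"
      by (intro L2_set_mono) auto
    then show ?thesis by (simp add: L2_set_def)
  qed
  also have "\<dots> = w d powr t * L2_set (\<lambda>j. w j powr (- t) * b j) {d..<m}"
    by (simp add: L2_set_right_distrib)
  also have "\<dots> \<le> w d powr t * L2_set (\<lambda>j. w j powr (- t) * b j) {..<m}"
    unfolding L2_set_def by (intro mult_left_mono real_sqrt_le_mono sum_mono2) auto
  also have "\<dots> \<le> w d powr t * M"
    using M by (intro mult_left_mono) auto
  finally show ?thesis .
qed

text \<open>The coefficients \<open>A\<close> are chosen before the degree \<open>D\<close>. The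
  bound with free \<open>d\<close> serves for the whole coefficient vector and for its tail; the
  remainder bound is the same for all components j, which suffices because \<open>D\<close> is fixed
  only after \<open>m\<close>.\<close>

lemma cell_expansion:
  fixes GC :: "'x::real_inner complexified \<Rightarrow> 'y::real_inner complexified" and u :: "'l \<Rightarrow> 'x"
  assumes hol: "holomorphic_map_on GC OC" and sub: "ball (of_real_part c) R \<subseteq> OC" and R: "0 < R"
    and GC: "\<And>z. z \<in> OC \<Longrightarrow> GC z \<in> smooth_space w \<eta> t \<and> smooth_norm w \<eta> t (GC z) \<le> M"
    and w: "\<And>j. 0 < w j" "decseq w" and t: "0 < t"
    and I: "finite I" and \<theta>: "(\<Sum>l\<in>I. exp 1 * norm (u l) / R) \<le> 1/4"
  shows "\<exists>A. (\<forall>ws d. L2_set (A ws) {d..<m} \<le>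
        w d powr t * (M * exp 1 * prod_list (map (\<lambda>l. exp 1 * norm (u l) / R) ws))) \<and>
    (\<forall>a D j. (\<forall>l\<in>I. 0 \<le> a l \<and> a l \<le> 1) \<longrightarrow> j < m \<longrightarrow>
      \<bar>Re (cinner_real (GC (of_real_part (c + (\<Sum>l\<in>I. a l *\<^sub>R u l)))) (dual_frame \<eta> j)) -
        (\<Sum>ws\<in>words_upto I D. prod_list (map a ws) * A ws j)\<bar>
      \<le> M * w 0 powr t * (real (Suc D) / 2 ^ Suc D))"
proof -
  define f where "f j z = cinner_real (GC z) (dual_frame \<eta> j)" for j z
  let ?c = "of_real_part c" and ?v = "\<lambda>l. of_real_part (u l)"
  define co where "co ws j = iter_deriv (f j) (map ?v ws) ?c / fact (length ws)" for ws j
  have fl: "line_holomorphic_on (f j) (ball ?c R)" for j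
    unfolding f_def by (rule line_holomorphic_on_subset[OF line_holomorphic_on_cinner_real[OF hol] sub])
  have fM: "L2_set (\<lambda>j. w j powr (- t) * cmod (f j z)) {..<m} \<le> M" if "z \<in> ball ?c R" for z m
  proof -
    have "z \<in> OC" using sub that by blast
    from GC[OF this] show ?thesis
      unfolding f_def by (intro smooth_norm_L2_set w(1)) auto
  qed
  have fb: "cmod (f j z) \<le> M * w 0 powr t" if "z \<in> ball ?c R" for j z
  proof -
    have "w j powr (- t) * cmod (f j z) \<le> M"
      using member_le_L2_set[of "{..<Suc j}" j "\<lambda>j. w j powr (- t) * cmod (f j z)"] fM[OF that, of "Suc j"] by simp
    then have le: "cmod (f j z) \<le> M * w j powr t"
      using w(1)[of j] by (simp add: powr_minus field_simps)
    have "0 \<le> M" using fM[OF that, of 0] by simp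
    moreover have "w j powr t \<le> w 0 powr t"
      using w t by (intro powr_mono2) (auto simp: decseq_def less_imp_le)
    ultimately show ?thesis using le by (meson mult_left_mono order_trans)
  qed
  have n: "map (\<lambda>v. exp 1 * norm v / R) (map ?v ws) = map (\<lambda>l. exp 1 * norm (u l) / R) ws" for ws
    by simp
  have co: "L2_set (\<lambda>j. w j powr (- t) * cmod (co ws j)) {..<m}
      \<le> M * exp 1 * prod_list (map (\<lambda>l. exp 1 * norm (u l) / R) ws)" for ws
    using word_coeff_bound[of "{..<m}" f ?c R "\<lambda>j. w j powr (- t)" M "map ?v ws", OF _ fl _ fM R] w(1)
    unfolding n co_def by (simp add: less_imp_neq[symmetric])
  have "L2_set (\<lambda>j. Re (co ws j)) {d..<m}
      \<le> w d powr t * (M * exp 1 * prod_list (map (\<lambda>l. exp 1 * norm (u l) / R) ws))" for ws d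
    by (rule weighted_tail[OF w t co]) (rule abs_Re_le_cmod)
  moreover have "\<bar>Re (f j (of_real_part (c + (\<Sum>l\<in>I. a l *\<^sub>R u l)))) -
        (\<Sum>ws\<in>words_upto I D. prod_list (map a ws) * Re (co ws j))\<bar>
      \<le> M * w 0 powr t * (real (Suc D) / 2 ^ Suc D)" if a: "\<forall>l\<in>I. 0 \<le> a l \<and> a l \<le> 1" for a D j
  proof -
    have s: "(\<Sum>l\<in>I. norm (?v l)) \<le> R / (4 * exp 1)"
    proof -
      have "exp 1 / R * (\<Sum>l\<in>I. norm (u l)) \<le> 1/4"
        using \<theta> by (simp add: sum_distrib_left)
      then show ?thesis using R by (simp add: field_simps)
    qed
    have pl: "prod_list (map (\<lambda>l. complex_of_real (a l)) ws) = of_real (prod_list (map a ws))" for ws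
      by (induction ws) auto
    have "cmod (f j (?c + (\<Sum>l\<in>I. cscale (of_real (a l)) (?v l))) -
        (\<Sum>i\<le>D. \<Sum>ws\<in>words I i. prod_list (map (\<lambda>l. complex_of_real (a l)) ws) *
          (iter_deriv (f j) (map ?v ws) ?c / fact i))) \<le> M * w 0 powr t * (real (Suc D) / 2 ^ Suc D)"
      by (rule word_taylor[OF fl fb R I _ s]) (use a in auto)
    also have "(\<Sum>i\<le>D. \<Sum>ws\<in>words I i. prod_list (map (\<lambda>l. complex_of_real (a l)) ws) *
          (iter_deriv (f j) (map ?v ws) ?c / fact i)) =
        (\<Sum>ws\<in>words_upto I D. of_real (prod_list (map a ws)) * co ws j)"
      unfolding sum_words_upto[OF I] co_def
      by (intro sum.cong refl) (auto simp: words_def pl)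
    also have "?c + (\<Sum>l\<in>I. cscale (of_real (a l)) (?v l)) = of_real_part (c + (\<Sum>l\<in>I. a l *\<^sub>R u l))"
      by (simp add: cscale_of_real of_real_part_add of_real_part_sum)
    finally have "\<bar>Re (f j (of_real_part (c + (\<Sum>l\<in>I. a l *\<^sub>R u l))) -
        (\<Sum>ws\<in>words_upto I D. of_real (prod_list (map a ws)) * co ws j))\<bar>
      \<le> M * w 0 powr t * (real (Suc D) / 2 ^ Suc D)"
      by (rule order_trans[OF abs_Re_le_cmod])
    then show ?thesis by simp
  qed
  ultimately show ?thesis
    unfolding f_def by (intro exI[of _ "\<lambda>ws j. Re (co ws j)"]) auto
qed

section \<open>Features as products of factors\<close>

text \<open>\<open>sc\<close> rescales encoder coefficients to cube coordinates inside the first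
  affine map. The two opposite ramps give 1 - |z|.\<close>

definition hat_factor :: "(nat \<Rightarrow> real) \<Rightarrow> nat \<Rightarrow> (nat \<Rightarrow> int) \<Rightarrow> nat \<Rightarrow> factor" where
  "hat_factor sc H k i = (i, real H * sc i, - of_int (k i), - (real H * sc i), of_int (k i))"

text \<open>Here the second ramp is zero and the argument of the first is 1 minus the signed local
  coordinate, so the factor is \<open>clip01\<close>.\<close>

definition coord_factor :: "(nat \<Rightarrow> real) \<Rightarrow> nat \<Rightarrow> nat \<Rightarrow> (nat \<Rightarrow> int) \<Rightarrow> nat \<times> bool \<Rightarrow> factor" where
  "coord_factor sc J H k l = (let \<epsilon> = if snd l then 1 else - 1; h = mesh J H (fst l) in
     (fst l, - \<epsilon> * sc (fst l) / h, 1 + \<epsilon> * center J H k (fst l) / h, 0, 0))"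

text \<open>The all-zero factor evaluates to 1, so padding to length \<open>L\<close> does not
  change the product.\<close>

definition feature_factors ::
  "(nat \<Rightarrow> real) \<Rightarrow> nat \<Rightarrow> nat \<Rightarrow> nat \<Rightarrow> (nat \<Rightarrow> int) \<Rightarrow> (nat \<times> bool) list \<Rightarrow> factor list" where
  "feature_factors sc J H L k ws = map (hat_factor sc H k) [0..<J] @ map (coord_factor sc J H k) ws
     @ replicate (L - (J + length ws)) (0, 0, 0, 0, 0)"

lemma length_feature_factors: "J + length ws \<le> L \<Longrightarrow> length (feature_factors sc J H L k ws) = L"
  by (simp add: feature_factors_def)

lemma feature_factors_index:
  assumes "u \<in> set (feature_factors sc J H L k ws)" "J \<le> n" "0 < n" "set ws \<subseteq> {..<n} \<times> UNIV"
  shows "fst u < n"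
  using assms by (auto simp: feature_factors_def hat_factor_def coord_factor_def Let_def)

lemma factor_eval_hat: "factor_eval (hat_factor sc H k i) x = hat (real H * (sc i * x i) - of_int (k i))"
  by (simp add: hat_factor_def hat_def max_def abs_if mult.assoc)

lemma factor_eval_coord:
  "factor_eval (coord_factor sc J H k l) x = local_coord J H k (\<lambda>i. sc i * x i) l"
  by (simp add: coord_factor_def local_coord_def clip01_def Let_def diff_divide_distrib algebra_simps)

lemma prod_feature_factors:
  "prod_list (map (\<lambda>u. factor_eval u x) (feature_factors sc J H L k ws)) =
    bump J H k (\<lambda>i. sc i * x i) * prod_list (map (local_coord J H k (\<lambda>i. sc i * x i)) ws)"
proof -
  have "prod_list (map (\<lambda>i. hat (real H * (sc i * x i) - of_int (k i))) [0..<J]) =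
      bump J H k (\<lambda>i. sc i * x i)"
    unfolding bump_def by (induction J) (simp_all add: mult.commute)
  then show ?thesis
    by (simp add: feature_factors_def comp_def factor_eval_hat factor_eval_coord prod_list_replicate map_replicate_const)
qed

text \<open>The accuracy of \<Psi> is required only where 0 < \<open>d ws\<close>: words without
  kept coefficients do not enter the network and may be too long for the padded products. The error
  splits into a discarded tail and \<epsilon> times the whole coefficient vector.\<close>

lemma feature_error:
  fixes A :: "'k \<Rightarrow> 'w \<Rightarrow> nat \<Rightarrow> real"
  assumes \<Phi>: "\<And>k ws. k \<in> K \<Longrightarrow> ws \<in> W \<Longrightarrow> \<bar>\<Phi> k ws\<bar> \<le> 1"
    and \<Psi>: "\<And>k ws. k \<in> K \<Longrightarrow> ws \<in> W \<Longrightarrow> 0 < d ws \<Longrightarrow> \<bar>\<Phi> k ws - \<Psi> k ws\<bar> \<le> \<epsilon>"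
    and T: "\<And>k ws. k \<in> K \<Longrightarrow> ws \<in> W \<Longrightarrow> L2_set (A k ws) {d ws..<m} \<le> T ws"
    and S: "\<And>k ws. k \<in> K \<Longrightarrow> ws \<in> W \<Longrightarrow> L2_set (A k ws) {..<m} \<le> S ws"
    and \<epsilon>: "0 \<le> \<epsilon>"
  shows "L2_set (\<lambda>j. (\<Sum>k\<in>K. \<Sum>ws\<in>W. A k ws j * \<Phi> k ws) -
      (\<Sum>k\<in>K. \<Sum>ws\<in>W. if j < d ws then A k ws j * \<Psi> k ws else 0)) {..<m}
    \<le> (\<Sum>k\<in>K. \<Sum>ws\<in>W. T ws + \<epsilon> * S ws)"
proof -
  define e where "e k ws j = A k ws j * \<Phi> k ws - (if j < d ws then A k ws j * \<Psi> k ws else 0)" for k ws j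
  have e: "L2_set (e k ws) {..<m} \<le> T ws + \<epsilon> * S ws" if "k \<in> K" "ws \<in> W" for k ws
  proof -
    let ?a = "\<lambda>j. if j < d ws then 0 else \<bar>A k ws j\<bar>"
    have le: "\<bar>e k ws j\<bar> \<le> ?a j + \<epsilon> * \<bar>A k ws j\<bar>" for j
    proof (cases "j < d ws")
      case True
      then have "\<bar>\<Phi> k ws - \<Psi> k ws\<bar> \<le> \<epsilon>" using \<Psi>[OF that] by simp
      then have "\<bar>A k ws j\<bar> * \<bar>\<Phi> k ws - \<Psi> k ws\<bar> \<le> \<bar>A k ws j\<bar> * \<epsilon>"
        by (rule mult_left_mono) simp
      moreover have "e k ws j = A k ws j * (\<Phi> k ws - \<Psi> k ws)"
        using True by (simp add: e_def right_diff_distrib)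
      ultimately show ?thesis using True by (simp add: abs_mult mult.commute)
    next
      case False
      have "\<bar>A k ws j\<bar> * \<bar>\<Phi> k ws\<bar> \<le> \<bar>A k ws j\<bar> * 1"
        using \<Phi>[OF that] by (intro mult_left_mono) auto
      then show ?thesis using False \<epsilon> by (simp add: e_def abs_mult add_increasing2)
    qed
    have "L2_set (e k ws) {..<m} = L2_set (\<lambda>j. \<bar>e k ws j\<bar>) {..<m}"
      by (simp add: L2_set_def)
    also have "\<dots> \<le> L2_set (\<lambda>j. ?a j + \<epsilon> * \<bar>A k ws j\<bar>) {..<m}"
      by (intro L2_set_mono le) auto
    also have "\<dots> \<le> L2_set ?a {..<m} + L2_set (\<lambda>j. \<epsilon> * \<bar>A k ws j\<bar>) {..<m}"
      by (rule L2_set_triangle_ineq)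
    also have "L2_set ?a {..<m} = L2_set (A k ws) {d ws..<m}"
      unfolding L2_set_def by (intro arg_cong[where f = sqrt] sum.mono_neutral_cong_right) auto
    also have "L2_set (\<lambda>j. \<epsilon> * \<bar>A k ws j\<bar>) {..<m} = \<epsilon> * L2_set (A k ws) {..<m}"
      using L2_set_right_distrib[OF \<epsilon>, of "\<lambda>j. \<bar>A k ws j\<bar>" "{..<m}"] by (simp add: L2_set_def)
    also have "L2_set (A k ws) {d ws..<m} + \<epsilon> * L2_set (A k ws) {..<m} \<le> T ws + \<epsilon> * S ws"
      using T[OF that] S[OF that] \<epsilon> by (intro add_mono mult_left_mono) auto
    finally show ?thesis .
  qed
  have "(\<lambda>j. (\<Sum>k\<in>K. \<Sum>ws\<in>W. A k ws j * \<Phi> k ws) -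
      (\<Sum>k\<in>K. \<Sum>ws\<in>W. if j < d ws then A k ws j * \<Psi> k ws else 0)) =
      (\<lambda>j. \<Sum>k\<in>K. \<Sum>ws\<in>W. e k ws j)"
    by (simp add: e_def sum_subtractf)
  then have "L2_set (\<lambda>j. (\<Sum>k\<in>K. \<Sum>ws\<in>W. A k ws j * \<Phi> k ws) -
      (\<Sum>k\<in>K. \<Sum>ws\<in>W. if j < d ws then A k ws j * \<Psi> k ws else 0)) {..<m}
    = L2_set (\<lambda>j. \<Sum>k\<in>K. \<Sum>ws\<in>W. e k ws j) {..<m}" by simp
  also have "\<dots> \<le> (\<Sum>k\<in>K. \<Sum>ws\<in>W. L2_set (e k ws) {..<m})"
    by (rule order_trans[OF L2_set_sum_le]) (intro sum_mono L2_set_sum_le)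
  also have "\<dots> \<le> (\<Sum>k\<in>K. \<Sum>ws\<in>W. T ws + \<epsilon> * S ws)"
    by (intro sum_mono e)
  finally show ?thesis .
qed

text \<open>Indices start at 0, so w_d is the largest discarded weight and decays in d + 1, which is
  at least N beta^p when d is its floor.\<close>

lemma truncation_term:
  fixes N \<beta> :: real
  assumes x: "0 < x" "x \<le> C * real (d + 1) powr (- g)" and C: "0 < C"
    and d: "N * \<beta> powr p \<le> real (d + 1)" and N: "0 < N" and \<beta>: "0 \<le> \<beta>"
    and \<tau>: "0 < \<tau>" "\<tau> \<le> g * t" and t: "0 < t" and p: "p = 1 / (1 + \<tau>)"
  shows "x powr t * \<beta> \<le> C powr t * (N powr (- \<tau>) * \<beta> powr p)"
proof (cases "\<beta> = 0")
  case False
  then have \<beta>': "0 < \<beta>" using \<beta> by simp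
  have "x powr t \<le> (C * real (d + 1) powr (- g)) powr t"
    using x t by (intro powr_mono2) auto
  also have "\<dots> = C powr t * real (d + 1) powr (- (g * t))"
    using C by (simp add: powr_mult powr_powr)
  also have "\<dots> \<le> C powr t * real (d + 1) powr (- \<tau>)"
    using \<tau> by (intro mult_left_mono powr_mono) auto
  also have "\<dots> \<le> C powr t * (N * \<beta> powr p) powr (- \<tau>)"
    using d N \<beta>' \<tau> by (intro mult_left_mono powr_mono2') auto
  also have "\<dots> = C powr t * (N powr (- \<tau>) * \<beta> powr (- (p * \<tau>)))"
    using N \<beta>' by (simp add: powr_mult powr_powr)
  finally have "x powr t * \<beta> \<le> C powr t * (N powr (- \<tau>) * \<beta> powr (- (p * \<tau>))) * \<beta>"
    using \<beta> by (rule mult_right_mono)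
  also have "\<dots> = C powr t * (N powr (- \<tau>) * (\<beta> powr (- (p * \<tau>)) * \<beta> powr 1))"
    using \<beta>' by simp
  also have "\<beta> powr (- (p * \<tau>)) * \<beta> powr 1 = \<beta> powr p"
  proof -
    have "- (p * \<tau>) + 1 = p" using \<tau> by (simp add: p field_simps)
    then show ?thesis by (simp only: powr_add[symmetric])
  qed
  finally show ?thesis .
qed auto

text \<open>The frame bound is applied to partial sums and passes to the limit. From index
  \<open>m\<close> on the network outputs 0 and the smoothness of \<open>y\<close> takes
  over.\<close>

lemma decoder_error:
  fixes \<eta> :: "nat \<Rightarrow> 'y::{real_inner, banach}"
  assumes fr: "is_frame \<eta>" and B: "\<And>I c. finite I \<Longrightarrow> norm (\<Sum>j\<in>I. c j *\<^sub>R \<eta> j) \<le> B * L2_set c I" "0 < B"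
    and y: "of_real_part y \<in> smooth_space w \<eta> t" "smooth_norm w \<eta> t (of_real_part y) \<le> M"
    and w: "\<And>j. 0 < w j" "decseq w" and t: "0 < t"
  shows "norm (y - decoder \<eta> (to_ell2 (\<lambda>i. if i < m then q i else 0)))
    \<le> B * (L2_set (\<lambda>j. inner y (dual_frame \<eta> j) - q j) {..<m} + w m powr t * M)"
proof -
  let ?q = "\<lambda>i. if i < m then q i else 0" and ?g = "\<lambda>j. inner y (dual_frame \<eta> j)"
  let ?X = "B * (L2_set (\<lambda>j. ?g j - q j) {..<m} + w m powr t * M)"
  have "summable (\<lambda>j. (?q j)\<^sup>2)"
    by (rule summable_finite[of "{..<m}"]) auto
  then have c: "coord (to_ell2 ?q) = ?q" by (rule coord_to_ell2)
  have "(\<lambda>j. ?q j *\<^sub>R \<eta> j) sums (\<Sum>j<m. ?q j *\<^sub>R \<eta> j)"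
    by (rule sums_finite) auto
  then have "(\<lambda>j. ?q j *\<^sub>R \<eta> j) sums decoder \<eta> (to_ell2 ?q)"
    unfolding decoder_def c by (rule summable_sums[OF sums_summable])
  from sums_diff[OF frame_expansion(2)[OF fr, of y] this]
  have s: "(\<lambda>j. (?g j - ?q j) *\<^sub>R \<eta> j) sums (y - decoder \<eta> (to_ell2 ?q))"
    by (simp add: scaleR_left_diff_distrib)
  have "norm (\<Sum>j<n. (?g j - ?q j) *\<^sub>R \<eta> j) \<le> ?X" if n: "m \<le> n" for n
  proof -
    let ?e = "\<lambda>j. ?g j - ?q j"
    have "(\<Sum>j<n. (?e j)\<^sup>2) = (\<Sum>j<m. (?e j)\<^sup>2) + (\<Sum>j=m..<n. (?e j)\<^sup>2)"
      using sum.atLeastLessThan_concat[of 0 m n "\<lambda>j. (?e j)\<^sup>2", OF _ n]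
      unfolding lessThan_atLeast0 by (simp only: le0 True_implies_equals)
    then have "L2_set ?e {..<n} \<le> L2_set ?e {..<m} + L2_set ?e {m..<n}"
      unfolding L2_set_def by (simp add: sqrt_add_le_add_sqrt sum_nonneg)
    also have "L2_set ?e {..<m} = L2_set (\<lambda>j. ?g j - q j) {..<m}"
      by (intro L2_set_cong) auto
    also have "L2_set ?e {m..<n} = L2_set ?g {m..<n}"
      by (intro L2_set_cong) auto
    also have "\<dots> \<le> w m powr t * M"
    proof (rule weighted_tail[OF w t smooth_norm_L2_set[OF y w(1)]])
      show "\<bar>?g j\<bar> \<le> cmod (cinner_real (of_real_part y) (dual_frame \<eta> j))" for j
        by (simp add: cinner_real_def of_real_part_def cmod_def)
    qed
    finally have "B * L2_set ?e {..<n} \<le> ?X"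
      using B(2) by (intro mult_left_mono) auto
    then show ?thesis
      using B(1)[of "{..<n}" ?e] by simp
  qed
  then show ?thesis
    using s[unfolded sums_def, THEN tendsto_norm] by (intro LIMSEQ_le_const2) auto
qed

text \<open>\<open>h\<close> is uniformly continuous on the compact image, and truncated points stay
  in it because a truncated parameter is again in the cube. Convergence without a rate suffices, as
  the size bound does not involve the number of inputs.\<close>

lemma cube_truncation:
  fixes v :: "nat \<Rightarrow> 'a::banach" and h :: "'a \<Rightarrow> real"
  assumes sm: "summable (\<lambda>j. norm (v j))"
    and h: "continuous_on ((\<lambda>y. \<Sum>j. y j *\<^sub>R v j) ` unit_cube) h" and e: "0 < e"
  shows "\<forall>\<^sub>F n in sequentially. \<forall>y\<in>unit_cube. \<bar>h (\<Sum>j. y j *\<^sub>R v j) - h (\<Sum>j<n. y j *\<^sub>R v j)\<bar> \<le> e"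
proof -
  let ?\<sigma> = "\<lambda>y. \<Sum>j. y j *\<^sub>R v j"
  define K where "K = ?\<sigma> ` unit_cube"
  have "uniformly_continuous_on K h"
    unfolding K_def using compact_uniformly_continuous[OF h compact_cube_series[OF sm]] .
  from this[unfolded uniformly_continuous_on_def, THEN spec, THEN mp, OF e]
  obtain d where d: "d > 0" "\<forall>x\<in>K. \<forall>x'\<in>K. dist x' x < d \<longrightarrow> dist (h x') (h x) < e"
    by (elim exE conjE)
  have "\<forall>\<^sub>F n in sequentially. \<forall>y\<in>unit_cube. dist (\<Sum>j<n. y j *\<^sub>R v j) (?\<sigma> y) < d"
    using uniform_limitD[OF uniform_limit_cube[OF sm] d(1)] .
  then show ?thesis
  proof eventually_elim
    case (elim n)
    have "\<bar>h (?\<sigma> y) - h (\<Sum>j<n. y j *\<^sub>R v j)\<bar> \<le> e" if y: "y \<in> unit_cube" for y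
    proof -
      let ?y = "\<lambda>j. if j < n then y j else 0"
      have "?y \<in> unit_cube" using y by (auto simp: unit_cube_def)
      moreover have "?\<sigma> ?y = (\<Sum>j<n. y j *\<^sub>R v j)"
        by (subst suminf_finite[of "{..<n}"]) auto
      ultimately have 1: "(\<Sum>j<n. y j *\<^sub>R v j) \<in> K"
        unfolding K_def by (intro image_eqI[of _ _ ?y] sym[of "?\<sigma> ?y"])
      have 2: "?\<sigma> y \<in> K" unfolding K_def using y by (rule imageI)
      have "dist (h (\<Sum>j<n. y j *\<^sub>R v j)) (h (?\<sigma> y)) < e"
        using d(2)[rule_format, OF 2 1] elim y by simp
      then show ?thesis by (simp add: dist_real_def abs_minus_commute)
    qed
    then show ?case by blast
  qed
qed

text \<open>The bumps form a partition of unity, so the error is a convex combination of the errors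
  in the cells whose bump does not vanish.\<close>

lemma glue_cells:
  assumes y: "y \<in> unit_cube"
    and cell: "\<And>k. k \<in> cells J H \<Longrightarrow> bump J H k y \<noteq> 0 \<Longrightarrow> \<bar>h - a k\<bar> \<le> e"
  shows "\<bar>h - (\<Sum>k\<in>cells J H. bump J H k y * a k)\<bar> \<le> e"
proof -
  have "h - (\<Sum>k\<in>cells J H. bump J H k y * a k) = (\<Sum>k\<in>cells J H. bump J H k y * (h - a k))"
    using bump_sum[OF y, of J H] by (simp add: right_diff_distrib sum_subtractf sum_distrib_right[symmetric])
  then have "\<bar>h - (\<Sum>k\<in>cells J H. bump J H k y * a k)\<bar> \<le> (\<Sum>k\<in>cells J H. \<bar>bump J H k y * (h - a k)\<bar>)"
    by (simp add: sum_abs)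
  also have "\<dots> \<le> (\<Sum>k\<in>cells J H. bump J H k y * e)"
  proof (rule sum_mono)
    fix k assume "k \<in> cells J H"
    then show "\<bar>bump J H k y * (h - a k)\<bar> \<le> bump J H k y * e"
      using cell[of k] bump_nonneg[of J H k y]
      by (cases "bump J H k y = 0") (auto simp: abs_mult intro: mult_left_mono)
  qed
  also have "\<dots> = e"
    using bump_sum[OF y, of J H] by (simp add: sum_distrib_right[symmetric])
  finally show ?thesis .
qed

lemma weights_powr_tendsto_0:
  assumes "admissible_weights w" "0 < t"
  shows "(\<lambda>m. w m powr t) \<longlonglongrightarrow> 0"
proof -
  have pos: "0 < w j" for j using assms by (simp add: admissible_weights_def)
  have "(\<lambda>m. w m powr 2) \<longlonglongrightarrow> 0"
    by (rule summable_LIMSEQ_zero[OF weights_summable_powr[OF assms(1)]]) simp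
  then have "(\<lambda>m. (w m powr 2) powr (t / 2)) \<longlonglongrightarrow> 0"
    by (rule tendsto_zero_powrI[OF _ tendsto_const]) (use assms in auto)
  then show ?thesis by (simp add: powr_powr)
qed

lemma geometric_remainder_small:
  assumes "0 < (e::real)"
  shows "\<exists>D. X * (real (Suc D) / 2 ^ Suc D) \<le> e"
proof -
  have "(\<lambda>n. real n / 2 ^ n) \<longlonglongrightarrow> 0"
    using lim_n_over_pown[of "2::real"] by simp
  then have "(\<lambda>D. X * (real (Suc D) / 2 ^ Suc D)) \<longlonglongrightarrow> X * 0"
    by (intro tendsto_mult tendsto_const) (rule LIMSEQ_Suc)
  then have "\<forall>\<^sub>F D in sequentially. X * (real (Suc D) / 2 ^ Suc D) < e"
    using assms by (intro order_tendstoD) auto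
  then show ?thesis
    by (meson eventually_sequentially less_imp_le order_refl)
qed

lemma sum_L2_small:
  assumes "\<And>j. j < m \<Longrightarrow> \<bar>f j\<bar> \<le> E / real m" "0 < m"
  shows "L2_set f {..<m} \<le> E"
proof -
  have "L2_set f {..<m} \<le> (\<Sum>j<m. \<bar>f j\<bar>)" by (rule L2_set_le_sum_abs)
  also have "\<dots> \<le> (\<Sum>j<m. E / real m)" using assms by (intro sum_mono) auto
  also have "\<dots> = E" using assms by simp
  finally show ?thesis .
qed

text \<open>The truncation indices n, m and the Taylor degree D may be taken as
  large as needed, since only the kept word features enter the network.\<close>

lemma network_approximation:
  fixes u :: "nat \<Rightarrow> 'x::{real_inner, banach}" and \<eta> :: "nat \<Rightarrow> 'y::{real_inner, banach}"
    and GC :: "'x complexified \<Rightarrow> 'y complexified"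
  assumes hol: "holomorphic_map_on GC OC"
    and GC: "\<And>z. z \<in> OC \<Longrightarrow> GC z \<in> smooth_space w \<eta> t \<and> smooth_norm w \<eta> t (GC z) \<le> M"
    and w: "\<And>j. 0 < w j" "decseq w" "(\<lambda>m. w m powr t) \<longlonglongrightarrow> 0" and t: "0 < t"
    and wC: "\<And>m. w m \<le> C * real (m + 1) powr (- g)" "0 < C"
    and \<tau>: "0 < \<tau>" "\<tau> \<le> g * t" and p: "p = 1 / (1 + \<tau>)"
    and sm: "summable (\<lambda>j. norm (u j))"
    and R: "0 < R" "\<And>y. y \<in> unit_cube \<Longrightarrow> ball (of_real_part (\<Sum>j. y j *\<^sub>R u j)) R \<subseteq> OC"
    and J: "0 < J" "0 < H" "\<And>n. (\<Sum>i<n. (mesh J H i * (exp 1 * norm (u i) / R)) powr p) \<le> 1/8"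
    and N: "1 \<le> N" and E: "0 < E" and X: "0 \<le> X"
    and l: "N \<le> 4 ^ l" and L: "J + l \<le> L" "real L / 4 ^ L \<le> N powr (- \<tau>)"
  shows "\<exists>n m \<Phi> q. relu_net_dims n m \<Phi> \<and>
    real (relu_net_size \<Phi>) \<le> real (card (cells J H)) * 2 * N * (90 * real L ^ 3 + 1) \<and>
    (\<forall>x. relu_net_eval \<Phi> (Matrix.vec n x) = Matrix.vec m (q x)) \<and>
    X * w m powr t \<le> E \<and>
    (\<forall>x. (\<lambda>i. sc i * x i) \<in> unit_cube \<longrightarrow>
      L2_set (\<lambda>j. Re (cinner_real (GC (of_real_part (\<Sum>i. (sc i * x i) *\<^sub>R u i))) (dual_frame \<eta> j)) - q x j) {..<m}
      \<le> 2 * E + real (card (cells J H)) * 2 * (M * exp 1 * (C powr t + w 0 powr t)) * N powr (- \<tau>))"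
proof -
  define \<sigma> where "\<sigma> y = (\<Sum>j. y j *\<^sub>R u j)" for y
  define gj where "gj j x = Re (cinner_real (GC (of_real_part x)) (dual_frame \<eta> j))" for j x
  define M0 where "M0 = M * w 0 powr t"
  have p01: "0 < p" "p < 1" using \<tau> by (simp_all add: p)
  have in_OC: "of_real_part (\<sigma> y) \<in> OC" if "y \<in> unit_cube" for y
    using R(2)[OF that] R(1) unfolding \<sigma>_def by (meson centre_in_ball subsetD)
  have M: "0 \<le> M"
  proof -
    have "of_real_part (\<sigma> (\<lambda>_. 0)) \<in> OC" by (rule in_OC) (simp add: unit_cube_def)
    from smooth_norm_L2_set[OF conjunct1[OF GC[OF this]] conjunct2[OF GC[OF this]] w(1), of 0]
    show ?thesis by simp
  qed
  \<comment> \<open>The output dimension is fixed first, making the tail seen by the decoder at most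
    \<open>E\<close>; the degree and the input dimension may then depend on
    \<open>m\<close>.\<close>
  obtain m where m: "0 < m" "X * w m powr t \<le> E"
  proof -
    have "(\<lambda>m. X * w m powr t) \<longlonglongrightarrow> X * 0" by (intro tendsto_mult tendsto_const w)
    then have "\<forall>\<^sub>F m in sequentially. X * w m powr t < E"
      using E by (intro order_tendstoD) auto
    then have "\<forall>\<^sub>F m in sequentially. 0 < m \<and> X * w m powr t < E"
      using eventually_gt_at_top[of 0] by eventually_elim auto
    then show ?thesis using that by (auto simp: eventually_sequentially less_imp_le)
  qed
  have Em: "0 < E / real m" using E m by simp
  obtain D where D: "M0 * (real (Suc D) / 2 ^ Suc D) \<le> E / real m"
    using geometric_remainder_small[OF Em] by blast
  have cont: "continuous_on (\<sigma> ` unit_cube) (gj j)" for j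
  proof -
    have "continuous_on OC GC"
      using hol unfolding holomorphic_map_on_def
      by (intro continuous_at_imp_continuous_on ballI) (meson has_derivative_continuous)
    moreover have "continuous_on (\<sigma> ` unit_cube) of_real_part"
      unfolding of_real_part_def by (intro continuous_intros)
    moreover have "of_real_part ` \<sigma> ` unit_cube \<subseteq> OC" using in_OC by auto
    ultimately have "continuous_on (\<sigma> ` unit_cube) (\<lambda>x. GC (of_real_part x))"
      using continuous_on_compose2 by blast
    then show ?thesis
      unfolding gj_def cinner_real_def by (simp add: continuous_on_inner continuous_on_fst)
  qed
  have "\<forall>\<^sub>F n in sequentially. \<forall>j\<in>{..<m}. \<forall>y\<in>unit_cube. \<bar>gj j (\<sigma> y) - gj j (\<Sum>i<n. y i *\<^sub>R u i)\<bar> \<le> E / real m"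
    unfolding \<sigma>_def by (intro eventually_ball_finite ballI cube_truncation[OF sm] Em cont[unfolded \<sigma>_def]) auto
  then obtain n0 where n0: "\<And>n j y. n0 \<le> n \<Longrightarrow> j < m \<Longrightarrow> y \<in> unit_cube \<Longrightarrow>
      \<bar>gj j (\<sigma> y) - gj j (\<Sum>i<n. y i *\<^sub>R u i)\<bar> \<le> E / real m"
    unfolding eventually_sequentially by blast
  define n where "n = max J n0"
  have n: "J \<le> n" "0 < n" "n0 \<le> n" using J by (auto simp: n_def)
  define I where "I = {..<n} \<times> (UNIV :: bool set)"
  \<comment> \<open>Each index contributes two letters, one per sign, with the mesh included in the
    direction; therefore 1/8 in the hypothesis becomes 1/4 below.\<close>
  define v where "v l = (if snd l then mesh J H (fst l) else - mesh J H (fst l)) *\<^sub>R u (fst l)" for l :: "nat \<times> bool"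
  define \<theta> where "\<theta> l = exp 1 * norm (v l) / R" for l
  have I: "finite I" by (simp add: I_def)
  have \<theta>0: "0 \<le> \<theta> l" for l using R by (simp add: \<theta>_def)
  have \<theta>p: "(\<Sum>l\<in>I. \<theta> l powr p) \<le> 1/4"
  proof -
    have mesh0: "0 \<le> mesh J H i" for i by (simp add: mesh_def)
    have "(\<Sum>l\<in>I. \<theta> l powr p) = (\<Sum>i<n. \<Sum>b\<in>UNIV. \<theta> (i, b) powr p)"
      unfolding I_def by (simp add: sum.cartesian_product)
    also have "\<dots> = (\<Sum>i<n. 2 * (mesh J H i * (exp 1 * norm (u i) / R)) powr p)"
      using mesh0 by (intro sum.cong refl) (simp add: UNIV_bool \<theta>_def v_def mult_ac)
    also have "\<dots> \<le> 2 * (1/8)"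
      unfolding sum_distrib_left[symmetric] using J(3)[of n] by (intro mult_left_mono) auto
    finally show ?thesis by simp
  qed
  have \<theta>l: "\<theta> l powr p \<le> 1/4" if "l \<in> I" for l
    using member_le_sum[OF that, of "\<lambda>l. \<theta> l powr p"] I \<theta>p by simp
  \<comment> \<open>Since p < 1 and each weight is at most 1, the sum of the weights inherits the
    bound 1/4, which is the smallness required by \<open>cell_expansion\<close>.\<close>
  have \<theta>1: "\<theta> l \<le> \<theta> l powr p" if "l \<in> I" for l
  proof -
    have "\<theta> l \<le> 1"
    proof (rule ccontr)
      assume "\<not> \<theta> l \<le> 1"
      then have "1 powr p \<le> \<theta> l powr p" using p01 by (intro powr_mono2) auto
      then show False using \<theta>l[OF that] by simp
    qed
    then have "\<theta> l powr 1 \<le> \<theta> l powr p"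
      using powr_mono'[of p 1 "\<theta> l"] \<theta>0[of l] p01 by simp
    then show ?thesis using \<theta>0[of l] by simp
  qed
  have \<theta>s: "(\<Sum>l\<in>I. exp 1 * norm (v l) / R) \<le> 1/4"
  proof -
    have "(\<Sum>l\<in>I. \<theta> l) \<le> (\<Sum>l\<in>I. \<theta> l powr p)" by (rule sum_mono[OF \<theta>1])
    with \<theta>p show ?thesis unfolding \<theta>_def by linarith
  qed
  define \<beta> where "\<beta> ws = prod_list (map \<theta> ws)" for ws
  define W where "W = words_upto I D"
  have W: "finite W" unfolding W_def by (rule finite_words_upto[OF I])
  have \<beta>0: "0 \<le> \<beta> ws" for ws
    unfolding \<beta>_def using \<theta>0 by (intro prod_list_nonneg) auto
  \<comment> \<open>Exponential decay in the length: a word that keeps at least one coefficient has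
    4^length <= N, hence logarithmic length.\<close>
  have \<beta>4: "\<beta> ws powr p \<le> (1/4) ^ length ws" if "set ws \<subseteq> I" for ws
    using that
  proof (induction ws)
    case (Cons l ws)
    have "\<theta> l powr p * \<beta> ws powr p \<le> 1/4 * (1/4) ^ length ws"
      using Cons \<theta>l by (intro mult_mono) auto
    then show ?case using \<theta>0 \<beta>0 by (simp add: \<beta>_def powr_mult)
  qed (simp add: \<beta>_def)
  have \<beta>1: "\<beta> ws \<le> \<beta> ws powr p" if "set ws \<subseteq> I" for ws
    using that
  proof (induction ws)
    case (Cons l ws)
    have "\<theta> l * \<beta> ws \<le> \<theta> l powr p * \<beta> ws powr p"
      using Cons \<theta>1 \<theta>0 \<beta>0 by (intro mult_mono) auto
    then show ?case using \<theta>0 \<beta>0 by (simp add: \<beta>_def powr_mult)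
  qed (simp add: \<beta>_def)
  have \<beta>sum: "(\<Sum>ws\<in>W. \<beta> ws powr p) \<le> 2"
    unfolding \<beta>_def W_def by (rule word_weight_sum[OF I \<theta>0 \<theta>p])
  define ce where "ce k = (\<Sum>i<J. center J H k i *\<^sub>R u i)" for k
  have ball: "ball (of_real_part (ce k)) R \<subseteq> OC" if "k \<in> cells J H" for k
  proof -
    have "(\<Sum>i. center J H k i *\<^sub>R u i) = ce k"
      unfolding ce_def by (rule suminf_finite) (auto simp: center_def)
    then show ?thesis using R(2)[OF center_in_cube[OF that J(2)]] by simp
  qed
  have "\<forall>k\<in>cells J H. \<exists>A. (\<forall>ws d. L2_set (A ws) {d..<m} \<le> w d powr t * (M * exp 1 * \<beta> ws)) \<and>
    (\<forall>a D j. (\<forall>l\<in>I. 0 \<le> a l \<and> a l \<le> 1) \<longrightarrow> j < m \<longrightarrow>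
      \<bar>gj j (ce k + (\<Sum>l\<in>I. a l *\<^sub>R v l)) - (\<Sum>ws\<in>words_upto I D. prod_list (map a ws) * A ws j)\<bar>
      \<le> M0 * (real (Suc D) / 2 ^ Suc D))"
    unfolding gj_def \<beta>_def \<theta>_def M0_def
    by (intro ballI cell_expansion[OF hol ball R(1) GC w(1,2) t I \<theta>s])
  from bchoice[OF this] obtain A where A: "\<And>k ws d. k \<in> cells J H \<Longrightarrow>
      L2_set (A k ws) {d..<m} \<le> w d powr t * (M * exp 1 * \<beta> ws)"
    and A': "\<And>k a D j. k \<in> cells J H \<Longrightarrow> \<forall>l\<in>I. 0 \<le> a l \<and> a l \<le> 1 \<Longrightarrow> j < m \<Longrightarrow>
      \<bar>gj j (ce k + (\<Sum>l\<in>I. a l *\<^sub>R v l)) - (\<Sum>ws\<in>words_upto I D. prod_list (map a ws) * A k ws j)\<bar>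
      \<le> M0 * (real (Suc D) / 2 ^ Suc D)"
    by blast
  define d where "d ws = nat \<lfloor>N * \<beta> ws powr p\<rfloor>" for ws
  have d1: "real (d ws) \<le> N * \<beta> ws powr p" "N * \<beta> ws powr p \<le> real (d ws + 1)" for ws
  proof -
    have "0 \<le> N * \<beta> ws powr p" using N by simp
    then show "real (d ws) \<le> N * \<beta> ws powr p" "N * \<beta> ws powr p \<le> real (d ws + 1)"
      unfolding d_def by linarith+
  qed
  \<comment> \<open>Only these words become features. Each has \<open>d ws\<close> at least 1, so
    their number is bounded by the sum of \<open>d\<close>.\<close>
  define \<Lambda> where "\<Lambda> = {ws \<in> W. 0 < d ws}"
  have \<Lambda>: "finite \<Lambda>" "\<Lambda> \<subseteq> W" using W by (auto simp: \<Lambda>_def)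
  have WI: "set ws \<subseteq> I" if "ws \<in> W" for ws using that by (simp add: W_def words_upto_def)
  have len: "J + length ws \<le> L" if "ws \<in> \<Lambda>" for ws
  proof -
    have "1 \<le> real (d ws)" using that by (simp add: \<Lambda>_def)
    also have "\<dots> \<le> N * \<beta> ws powr p" by (rule d1)
    also have "\<dots> \<le> N * (1/4) ^ length ws"
      using N \<beta>4[OF WI] that \<Lambda> by (intro mult_left_mono) auto
    finally have "4 ^ length ws \<le> N" by (simp add: power_divide field_simps)
    then have "(4::real) ^ length ws \<le> 4 ^ l" by (rule order_trans[OF _ l])
    then have "length ws \<le> l" by (rule power_le_imp_le_exp[rotated]) simp
    then show ?thesis using L by simp
  qed
  have sum_d: "(\<Sum>ws\<in>\<Lambda>. real (d ws)) \<le> 2 * N"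
  proof -
    have "(\<Sum>ws\<in>\<Lambda>. real (d ws)) \<le> (\<Sum>ws\<in>W. real (d ws))"
      using W \<Lambda> by (intro sum_mono2) auto
    also have "\<dots> \<le> (\<Sum>ws\<in>W. N * \<beta> ws powr p)" by (intro sum_mono d1)
    also have "\<dots> \<le> N * 2"
      unfolding sum_distrib_left[symmetric] using \<beta>sum N by (intro mult_left_mono) auto
    finally show ?thesis by simp
  qed
  have card_\<Lambda>: "real (card \<Lambda>) \<le> 2 * N"
  proof -
    have "real (card \<Lambda>) = (\<Sum>ws\<in>\<Lambda>. 1)" by simp
    also have "\<dots> \<le> (\<Sum>ws\<in>\<Lambda>. real (d ws))"
      by (intro sum_mono) (auto simp: \<Lambda>_def)
    finally show ?thesis using sum_d by simp
  qed
  \<comment> \<open>The empty word has weight 1 and keeps at least one coefficient, so the network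
    has a feature.\<close>
  have "[] \<in> \<Lambda>"
    using N by (simp add: \<Lambda>_def W_def words_upto_def d_def \<beta>_def)
  define Q where "Q = cells J H \<times> \<Lambda>"
  define us where "us q = feature_factors sc J H L (fst q) (snd q)" for q
  have Q: "finite Q" "Q \<noteq> {}"
    using finite_cells cells_nonempty \<Lambda>(1) \<open>[] \<in> \<Lambda>\<close> by (auto simp: Q_def)
  have "0 < L" using L(1) J(1) by simp
  have lenq: "length (us q) = L" if "q \<in> Q" for q
    unfolding us_def using len that by (intro length_feature_factors) (auto simp: Q_def)
  have idx: "fst z < n" if "q \<in> Q" "z \<in> set (us q)" for q z
  proof (rule feature_factors_index[OF that(2)[unfolded us_def] n(1,2)])
    have "snd q \<in> W" using that(1) \<Lambda>(2) by (auto simp: Q_def)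
    from WI[OF this] show "set (snd q) \<subseteq> {..<n} \<times> UNIV" unfolding I_def .
  qed
  have net: "\<exists>\<Phi>. relu_net_dims n m \<Phi> \<and>
      relu_net_size \<Phi> \<le> card Q * (90 * L ^ 3) + (\<Sum>q\<in>Q. d (snd q)) \<and>
      (\<forall>x. relu_net_eval \<Phi> (Matrix.vec n x) = Matrix.vec m (\<lambda>j. \<Sum>q\<in>Q. if j < d (snd q)
        then A (fst q) (snd q) j * approx_feature L (us q) x else 0))"
    by (rule feature_network[OF Q \<open>0 < L\<close> n(2) m(1)]) (erule lenq, erule (1) idx)
  obtain \<Phi> where \<Phi>: "relu_net_dims n m \<Phi>"
      "relu_net_size \<Phi> \<le> card Q * (90 * L ^ 3) + (\<Sum>q\<in>Q. d (snd q))"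
      "\<forall>x. relu_net_eval \<Phi> (Matrix.vec n x) = Matrix.vec m (\<lambda>j. \<Sum>q\<in>Q. if j < d (snd q)
        then A (fst q) (snd q) j * approx_feature L (us q) x else 0)"
    using net by (elim exE conjE)
  \<comment> \<open>Words outside \<open>\<Lambda>\<close> contribute zero, so the output can be
    summed over all of \<open>W\<close> and compared with the Taylor sum term by term.\<close>
  define qq where "qq x j = (\<Sum>k\<in>cells J H. \<Sum>ws\<in>W. if j < d ws
      then A k ws j * approx_feature L (us (k, ws)) x else 0)" for x j
  have qq: "(\<Sum>q\<in>Q. if j < d (snd q) then A (fst q) (snd q) j * approx_feature L (us q) x else 0) = qq x j" for x j
  proof -
    have "(\<Sum>q\<in>Q. if j < d (snd q) then A (fst q) (snd q) j * approx_feature L (us q) x else 0) =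
        (\<Sum>k\<in>cells J H. \<Sum>ws\<in>\<Lambda>. if j < d ws then A k ws j * approx_feature L (us (k, ws)) x else 0)"
      unfolding Q_def sum.cartesian_product by (rule sum.cong[OF refl]) auto
    also have "\<dots> = qq x j"
      unfolding qq_def using W by (intro sum.cong refl sum.mono_neutral_left) (auto simp: \<Lambda>_def)
    finally show ?thesis .
  qed
  have size: "real (relu_net_size \<Phi>) \<le> real (card (cells J H)) * 2 * N * (90 * real L ^ 3 + 1)"
  proof -
    have "(\<Sum>q\<in>Q. d (snd q)) = card (cells J H) * (\<Sum>ws\<in>\<Lambda>. d ws)"
      unfolding Q_def using sum.cartesian_product[of "\<lambda>_ ws. d ws" \<Lambda> "cells J H"]
      by (simp add: case_prod_beta)
    then have "relu_net_size \<Phi> \<le> card (cells J H) * card \<Lambda> * (90 * L ^ 3) + card (cells J H) * (\<Sum>ws\<in>\<Lambda>. d ws)"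
      using \<Phi>(2) by (simp add: Q_def card_cartesian_product)
    then have "real (relu_net_size \<Phi>) \<le>
        real (card (cells J H) * card \<Lambda> * (90 * L ^ 3) + card (cells J H) * (\<Sum>ws\<in>\<Lambda>. d ws))"
      by (rule of_nat_mono)
    also have "\<dots> = real (card (cells J H)) * (real (card \<Lambda>) * (90 * real L ^ 3) + (\<Sum>ws\<in>\<Lambda>. real (d ws)))"
      by (simp add: algebra_simps)
    also have "\<dots> \<le> real (card (cells J H)) * (2 * N * (90 * real L ^ 3) + 2 * N)"
      using card_\<Lambda> sum_d by (intro mult_left_mono add_mono mult_right_mono) auto
    finally show ?thesis by (simp add: algebra_simps)
  qed
  have err: "L2_set (\<lambda>j. gj j (\<sigma> (\<lambda>i. sc i * x i)) - qq x j) {..<m}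
      \<le> 2 * E + real (card (cells J H)) * 2 * (M * exp 1 * (C powr t + w 0 powr t)) * N powr (- \<tau>)"
    if y: "(\<lambda>i. sc i * x i) \<in> unit_cube" for x
  proof -
    define y where "y = (\<lambda>i. sc i * x i)"
    have yU: "y \<in> unit_cube" using y by (simp add: y_def)
    let ?lc = "\<lambda>k. local_coord J H k y"
    let ?F = "\<lambda>k ws. bump J H k y * prod_list (map (?lc k) ws)"
    \<comment> \<open>Three errors: input truncation, Taylor remainder after gluing, and truncated
      approximate features. The first two are at most \<open>E\<close> by the choice of
      \<open>n\<close> and \<open>D\<close>.\<close>
    let ?h1 = "\<lambda>j. gj j (\<sigma> y) - gj j (\<Sum>i<n. y i *\<^sub>R u i)"
    let ?T = "\<lambda>j. \<Sum>k\<in>cells J H. \<Sum>ws\<in>W. A k ws j * ?F k ws"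
    let ?h2 = "\<lambda>j. gj j (\<Sum>i<n. y i *\<^sub>R u i) - ?T j"
    let ?h3 = "\<lambda>j. ?T j - qq x j"
    have h1: "L2_set ?h1 {..<m} \<le> E"
      by (rule sum_L2_small[OF n0[OF n(3) _ yU] m(1)])
    have h2: "L2_set ?h2 {..<m} \<le> E"
    proof (rule sum_L2_small[OF _ m(1)])
      fix j assume j: "j < m"
      have "\<bar>gj j (\<Sum>i<n. y i *\<^sub>R u i) -
          (\<Sum>k\<in>cells J H. bump J H k y * (\<Sum>ws\<in>W. prod_list (map (?lc k) ws) * A k ws j))\<bar> \<le> E / real m"
      proof (rule glue_cells[OF yU])
        fix k assume k: "k \<in> cells J H" and b: "bump J H k y \<noteq> 0"
        have "(\<Sum>i<n. y i *\<^sub>R u i) = ce k + (\<Sum>l\<in>I. ?lc k l *\<^sub>R v l)"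
          unfolding ce_def v_def I_def by (rule local_expansion[OF yU b J(2) n(1)])
        then show "\<bar>gj j (\<Sum>i<n. y i *\<^sub>R u i) - (\<Sum>ws\<in>W. prod_list (map (?lc k) ws) * A k ws j)\<bar> \<le> E / real m"
          using A'[OF k, of "?lc k" j D] j D local_coord_range unfolding W_def by simp
      qed
      then show "\<bar>?h2 j\<bar> \<le> E / real m"
        by (simp add: sum_distrib_left mult_ac)
    qed
    have F1: "\<bar>?F k ws\<bar> \<le> 1" if "k \<in> cells J H" for k ws
    proof -
      have "bump J H k y \<le> (\<Sum>k\<in>cells J H. bump J H k y)"
        by (rule member_le_sum[OF that]) (auto simp: bump_nonneg finite_cells)
      then have "bump J H k y \<le> 1" using bump_sum[OF yU] by simp
      moreover have "prod_list (map (?lc k) ws) \<in> {0..1}"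
        by (rule prod_list_range) (use local_coord_range in auto)
      ultimately show ?thesis
        using bump_nonneg[of J H k y] by (auto simp: abs_mult intro: mult_le_one)
    qed
    have "L2_set ?h3 {..<m} \<le> (\<Sum>k\<in>cells J H. \<Sum>ws\<in>W. w (d ws) powr t * (M * exp 1 * \<beta> ws) +
        N powr (- \<tau>) * (w 0 powr t * (M * exp 1 * \<beta> ws)))"
      unfolding qq_def
    proof (rule feature_error[OF F1])
      fix k ws assume k: "k \<in> cells J H" and ws: "ws \<in> W"
      show "L2_set (A k ws) {d ws..<m} \<le> w (d ws) powr t * (M * exp 1 * \<beta> ws)" by (rule A[OF k])
      show "L2_set (A k ws) {..<m} \<le> w 0 powr t * (M * exp 1 * \<beta> ws)"
        using A[OF k, of ws 0] by (simp add: atLeast0LessThan)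
      assume "0 < d ws"
      then have q: "(k, ws) \<in> Q" using k ws by (simp add: Q_def \<Lambda>_def)
      have "\<bar>approx_feature L (us (k, ws)) x - ?F k ws\<bar> \<le> real L / 4 ^ L"
        using approx_feature_error[OF lenq[OF q], of x] unfolding us_def y_def by (simp add: prod_feature_factors)
      then show "\<bar>?F k ws - approx_feature L (us (k, ws)) x\<bar> \<le> N powr (- \<tau>)"
        using L(2) by (simp add: abs_minus_commute)
    qed auto
    also have "\<dots> \<le> (\<Sum>k\<in>cells J H. \<Sum>ws\<in>W. (M * exp 1 * (C powr t + w 0 powr t) * N powr (- \<tau>)) * \<beta> ws powr p)"
    proof (intro sum_mono)
      fix k ws assume "ws \<in> W"
      have a: "w (d ws) powr t * \<beta> ws \<le> C powr t * (N powr (- \<tau>) * \<beta> ws powr p)"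
        by (rule truncation_term[OF w(1) wC d1(2) _ \<beta>0 \<tau> t p]) (use N in auto)
      \<comment> \<open>Replacing \<beta> by the larger \<beta>^p lets the multiplication error
        share the sum that bounds the truncation error.\<close>
      have b: "N powr (- \<tau>) * w 0 powr t * \<beta> ws \<le> N powr (- \<tau>) * w 0 powr t * \<beta> ws powr p"
        using \<beta>1[OF WI[OF \<open>ws \<in> W\<close>]] by (intro mult_left_mono) auto
      have "(M * exp 1) * (w (d ws) powr t * \<beta> ws + N powr (- \<tau>) * w 0 powr t * \<beta> ws)
          \<le> (M * exp 1) * (C powr t * (N powr (- \<tau>) * \<beta> ws powr p) + N powr (- \<tau>) * w 0 powr t * \<beta> ws powr p)"
        by (rule mult_left_mono[OF add_mono[OF a b]]) (use M in simp)
      then show "w (d ws) powr t * (M * exp 1 * \<beta> ws) + N powr (- \<tau>) * (w 0 powr t * (M * exp 1 * \<beta> ws))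
          \<le> (M * exp 1 * (C powr t + w 0 powr t) * N powr (- \<tau>)) * \<beta> ws powr p"
        by (simp add: algebra_simps)
    qed
    also have "\<dots> = real (card (cells J H)) * ((M * exp 1 * (C powr t + w 0 powr t) * N powr (- \<tau>)) * (\<Sum>ws\<in>W. \<beta> ws powr p))"
      by (simp add: sum_distrib_left)
    also have "\<dots> \<le> real (card (cells J H)) * ((M * exp 1 * (C powr t + w 0 powr t) * N powr (- \<tau>)) * 2)"
      using \<beta>sum M by (intro mult_left_mono) auto
    finally have h3: "L2_set ?h3 {..<m} \<le> real (card (cells J H)) * 2 * (M * exp 1 * (C powr t + w 0 powr t)) * N powr (- \<tau>)"
      by (simp add: mult_ac)
    have eq: "gj j (\<sigma> y) - qq x j = ?h1 j + (?h2 j + ?h3 j)" for j by simp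
    have "L2_set (\<lambda>j. gj j (\<sigma> y) - qq x j) {..<m} \<le>
        E + (E + real (card (cells J H)) * 2 * (M * exp 1 * (C powr t + w 0 powr t)) * N powr (- \<tau>))"
      unfolding eq
      by (rule order_trans[OF L2_set_triangle_ineq add_mono[OF h1 order_trans[OF L2_set_triangle_ineq add_mono[OF h2 h3]]]])
    then show ?thesis unfolding y_def by linarith
  qed
  show ?thesis
  proof (intro exI conjI allI impI)
    show "relu_net_dims n m \<Phi>" by (rule \<Phi>(1))
    show "real (relu_net_size \<Phi>) \<le> real (card (cells J H)) * 2 * N * (90 * real L ^ 3 + 1)"
      by (rule size)
    show "relu_net_eval \<Phi> (Matrix.vec n x) = Matrix.vec m (qq x)" for x
      using \<Phi>(3) unfolding qq by (rule spec)
    show "X * w m powr t \<le> E" by (rule m(2))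
    show "L2_set (\<lambda>j. Re (cinner_real (GC (of_real_part (\<Sum>i. (sc i * x i) *\<^sub>R u i))) (dual_frame \<eta> j)) - qq x j) {..<m}
        \<le> 2 * E + real (card (cells J H)) * 2 * (M * exp 1 * (C powr t + w 0 powr t)) * N powr (- \<tau>)"
      if "(\<lambda>i. sc i * x i) \<in> unit_cube" for x
      using err[OF that] unfolding gj_def \<sigma>_def .
  qed
qed

section \<open>Choice of the parameters and the final rate\<close>

lemma sigma_map_eq:
  fixes \<psi> :: "nat \<Rightarrow> 'a::{real_inner, banach}"
  assumes sm: "summable (\<lambda>j. norm ((r * w j powr s) *\<^sub>R \<psi> j))" and r: "0 < r" and y: "y \<in> unit_cube"
  shows "sigma_map w \<psi> r s y = (\<Sum>j. y j *\<^sub>R ((r * w j powr s) *\<^sub>R \<psi> j))"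
proof -
  have "summable (\<lambda>j. y j *\<^sub>R ((r * w j powr s) *\<^sub>R \<psi> j))"
  proof (rule summable_norm_cancel, rule summable_comparison_test'[OF sm])
    fix j
    have "\<bar>y j\<bar> * norm ((r * w j powr s) *\<^sub>R \<psi> j) \<le> 1 * norm ((r * w j powr s) *\<^sub>R \<psi> j)"
      using unit_cube_abs[OF y] by (rule mult_right_mono) simp
    then show "norm (norm (y j *\<^sub>R ((r * w j powr s) *\<^sub>R \<psi> j))) \<le> norm ((r * w j powr s) *\<^sub>R \<psi> j)"
      by (simp only: norm_scaleR real_norm_def abs_norm_cancel abs_mult mult_1 abs_abs mult.assoc)
  qed
  from summable_scaleR_right[OF this, of "1 / r"]
  have "summable (\<lambda>j. (w j powr s * y j) *\<^sub>R \<psi> j)"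
    using r by (simp add: mult.commute)
  from suminf_scaleR_right[OF this, of r] show ?thesis
    by (simp add: sigma_map_def mult_ac)
qed

text \<open>Spending one power 2^L on the factor L leaves 2^(-L), and since L grows with slope q in
  l, this is at most N^(-q).\<close>

lemma power_of_two_bound:
  assumes q: "1 \<le> q" "x \<le> real q" and N: "1 \<le> N" "N \<le> 2 ^ l" and L: "L = a + q * l"
  shows "real L / 4 ^ L \<le> N powr (- x)"
proof -
  have "real L < 2 ^ L" by (rule of_nat_less_two_power)
  then have "real L / 4 ^ L \<le> 2 ^ L / 4 ^ L" by (intro divide_right_mono) auto
  also have "\<dots> = 1 / 2 ^ L"
    using power_mult_distrib[of "2::real" 2 L] by simp
  also have "\<dots> \<le> 1 / 2 ^ (q * l)"
    using L by (intro divide_left_mono power_increasing) auto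
  also have "\<dots> = 1 / (2 ^ l) ^ q" by (simp add: power_mult[symmetric] mult.commute)
  also have "\<dots> \<le> 1 / N ^ q"
    using N by (intro divide_left_mono power_mono) auto
  also have "\<dots> = N powr (- real q)"
    using N by (simp add: powr_minus_divide powr_realpow)
  also have "\<dots> \<le> N powr (- x)"
    using q N by (intro powr_mono) auto
  finally show ?thesis .
qed

theorem theorem3p7:
  fixes \<psi> :: "nat \<Rightarrow> 'x::{real_inner, banach, second_countable_topology}"
    and \<eta> :: "nat \<Rightarrow> 'y::{real_inner, banach, second_countable_topology}"
    and w :: "nat \<Rightarrow> real"
    and r s t \<delta> M :: real
    and A :: "'x set"
    and G :: "'x \<Rightarrow> 'y"
    and OC :: "'x complexified set"
    and GC :: "'x complexified \<Rightarrow> 'y complexified"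
  assumes "is_frame \<psi>" and "is_frame \<eta>" and "admissible_weights w"
    and "r > 0" and "s > 1" and "t > 0" and "\<delta> > 0"
    and "cube_image w \<psi> r s \<subseteq> A"
    and "open OC" and "of_real_part ` cube_image w \<psi> r s \<subseteq> OC"
    and "holomorphic_map_on GC OC"
    and "\<forall>a\<in>A. of_real_part a \<in> OC \<longrightarrow> GC (of_real_part a) = of_real_part (G a)"
    and "\<forall>z\<in>OC. GC z \<in> smooth_space w \<eta> t \<and> smooth_norm w \<eta> t (GC z) \<le> M"
  shows "\<exists>C K :: real. C > 0 \<and>
    (\<forall>N::nat. N \<ge> 1 \<longrightarrow>
      (\<exists>n m \<Phi>. relu_net_dims n m \<Phi> \<and> real (relu_net_size \<Phi>) \<le> K * real N \<and>
        (\<forall>a \<in> coeff_cube w \<psi> r s.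
          norm (G a - decoder \<eta> (relu_net_ell2 n m \<Phi> (encoder \<psi> a)))
            \<le> C * real N powr (- min (s - 1) t + \<delta>))))"
proof -
  have w: "0 < w j" "decseq w" for j
    using assms(3) by (auto simp: admissible_weights_def)
  obtain g \<tau> where g: "0 < g" "g < 1" and \<tau>: "0 < \<tau>" "\<tau> \<le> g * t" "1 + \<tau> < s"
      and rate: "min (s - 1) t - \<delta> \<le> g * \<tau>"
    using exponent_choice[OF \<open>s > 1\<close> \<open>t > 0\<close> \<open>\<delta> > 0\<close>] by blast
  define p where "p = 1 / (1 + \<tau>)"
  have p: "0 < p" "1 < s * p" using \<tau> by (simp_all add: p_def field_simps)
  obtain B1 where B1: "0 < B1" "\<forall>I c. finite I \<longrightarrow> norm (\<Sum>j\<in>I. c j *\<^sub>R \<psi> j) \<le> B1 * L2_set c I"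
    using frame_synthesis_bound[OF assms(1)] by (elim exE conjE)
  obtain B2 where B2: "0 < B2" "\<forall>I c. finite I \<longrightarrow> norm (\<Sum>j\<in>I. c j *\<^sub>R \<eta> j) \<le> B2 * L2_set c I"
    using frame_synthesis_bound[OF assms(2)] by (elim exE conjE)
  have \<psi>: "norm (\<psi> j) \<le> B1" for j
    using B1(2)[rule_format, of "{j}" "\<lambda>_. 1"] by (simp add: L2_set_def)
  \<comment> \<open>Absorbing r w_j^s into the directions turns the input set into a cube series
    with absolutely summable terms.\<close>
  define u where "u j = (r * w j powr s) *\<^sub>R \<psi> j" for j
  have u: "norm (u j) \<le> r * B1 * w j powr s" for j
  proof -
    have "norm (u j) = r * w j powr s * norm (\<psi> j)" using assms(4) by (simp add: u_def)
    also have "\<dots> \<le> r * w j powr s * B1"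
      using \<psi> assms(4) by (intro mult_left_mono) auto
    finally show ?thesis by (simp add: mult_ac)
  qed
  have sm: "summable (\<lambda>j. norm (u j))"
    by (rule summable_comparison_test'[OF summable_mult[OF weights_summable_powr[OF assms(3,5)], of "r * B1"]])
      (use u in simp)
  have \<sigma>: "sigma_map w \<psi> r s y = (\<Sum>j. y j *\<^sub>R u j)" if "y \<in> unit_cube" for y
    unfolding u_def by (rule sigma_map_eq[OF sm[unfolded u_def] assms(4) that])
  have cube: "cube_image w \<psi> r s = (\<lambda>y. \<Sum>j. y j *\<^sub>R u j) ` unit_cube"
    unfolding cube_image_def using \<sigma> by (intro image_cong) auto
  have "compact (of_real_part ` cube_image w \<psi> r s)"
    unfolding cube
    by (rule compact_continuous_image[OF _ compact_cube_series[OF sm]])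
      (simp add: of_real_part_def continuous_intros)
  then obtain R where R: "0 < R" "(\<Union>x\<in>of_real_part ` cube_image w \<psi> r s. ball x R) \<subseteq> OC"
    using compact_subset_open_imp_ball_epsilon_subset[OF _ assms(9,10)] by metis
  have R': "ball (of_real_part (\<Sum>j. y j *\<^sub>R u j)) R \<subseteq> OC" if "y \<in> unit_cube" for y
    using R(2) that unfolding cube by blast
  \<comment> \<open>The terms are bounded by multiples of w_j^(s p), and s p > 1 because 1 + \<tau>
    < s.\<close>
  have smp: "summable (\<lambda>j. (exp 1 * norm (u j) / R) powr p)"
  proof (rule summable_comparison_test'[OF summable_mult[OF weights_summable_powr[OF assms(3) p(2)]]])
    fix j
    have "(exp 1 * norm (u j) / R) powr p \<le> ((exp 1 * r * B1 / R) * w j powr s) powr p"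
      using u[of j] R(1) p(1) by (intro powr_mono2) (auto simp: divide_right_mono mult_ac)
    also have "\<dots> = (exp 1 * r * B1 / R) powr p * w j powr (s * p)"
      using R(1) B1(1) assms(4) by (subst powr_mult) (simp_all add: powr_powr)
    finally show "norm ((exp 1 * norm (u j) / R) powr p) \<le> (exp 1 * r * B1 / R) powr p * w j powr (s * p)"
      by simp
  qed
  obtain J H where J: "0 < J" "0 < H"
      "\<And>n. (\<Sum>i<n. (mesh J H i * (exp 1 * norm (u i) / R)) powr p) \<le> 1/8"
    using mesh_choice[OF _ smp p(1), of "1/8"] R(1) by auto
  obtain Cw where Cw: "0 < Cw" "\<And>m. w m \<le> Cw * real (m + 1) powr (- g)"
    using weights_decay[OF assms(3) g] by blast
  \<comment> \<open>An exponent q of at least g \<tau> keeps the error of the products, at most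
    N^(-q), within the target.\<close>
  define q where "q = nat \<lceil>g * \<tau>\<rceil> + 1"
  have q: "1 \<le> q" "g * \<tau> \<le> real q" unfolding q_def by linarith+
  obtain Cl where Cl: "0 < Cl" "\<And>N. 1 \<le> N \<Longrightarrow> \<exists>l. N \<le> 2 ^ l \<and> real (J + 1 + q * l) ^ 3 \<le> Cl * real N powr (1 - g)"
    using polylog_bound[of "1 - g" "J + 1" q] g by auto
  define nK where "nK = real (card (cells J H))"
  have in_OC: "of_real_part a \<in> OC" if "a \<in> cube_image w \<psi> r s" for a
    using assms(10) that by blast
  \<comment> \<open>The origin of the cube witnesses that \<open>OC\<close> is nonempty, which makes
    \<open>M\<close> nonnegative.\<close>
  have "(\<lambda>_. 0) \<in> unit_cube" by (simp add: unit_cube_def)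
  then have "(\<Sum>j. 0 *\<^sub>R u j) \<in> cube_image w \<psi> r s"
    unfolding cube by (rule rev_image_eqI) simp
  then have "of_real_part (\<Sum>j. 0 *\<^sub>R u j) \<in> OC" by (rule in_OC)
  then have M: "0 \<le> M"
    using smooth_norm_L2_set[of "GC (of_real_part (\<Sum>j. 0 *\<^sub>R u j))" w \<eta> t M 0] assms(13) w(1) by simp
  define Z where "Z = nK * 2 * (M * exp 1 * (Cw powr t + w 0 powr t))"
  have Z: "0 \<le> Z" using M by (simp add: Z_def nK_def)
  \<comment> \<open>2 + Z bounds the component error in units of the target rate, and the summand 1
    is the decoder tail.\<close>
  define C where "C = B2 * (2 + Z) + 1"
  \<comment> \<open>91 merges 90 L^3 + 1 into one multiple of L^3.\<close>
  define K where "K = nK * 2 * 91 * Cl"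
  have "0 < C" using B2(1) Z by (simp add: C_def add_nonneg_pos)
  define sc where "sc i = w i powr (- s) / r" for i
  have main: "\<exists>n m \<Phi>. relu_net_dims n m \<Phi> \<and> real (relu_net_size \<Phi>) \<le> K * real N \<and>
        (\<forall>a \<in> coeff_cube w \<psi> r s.
          norm (G a - decoder \<eta> (relu_net_ell2 n m \<Phi> (encoder \<psi> a)))
            \<le> C * real N powr (- min (s - 1) t + \<delta>))" if N: "1 \<le> N" for N :: nat
  proof -
    obtain l where l: "N \<le> 2 ^ l" "real (J + 1 + q * l) ^ 3 \<le> Cl * real N powr (1 - g)"
      using Cl(2)[OF N] by blast
    define L where "L = J + 1 + q * l"
    define N' where "N' = real N powr g"
    define E where "E = real N powr (- (g * \<tau>))"
    have rN: "1 \<le> real N" "real N \<le> 2 ^ l" using N l(1) by (simp_all flip: of_nat_power)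
    have N'1: "1 \<le> N'" using rN g by (simp add: N'_def ge_one_powr_ge_zero)
    have "N' \<le> real N powr 1" unfolding N'_def using rN g by (intro powr_mono) auto
    also have "\<dots> \<le> 2 ^ l" using rN by simp
    also have "\<dots> \<le> (4::real) ^ l" by (intro power_mono) auto
    finally have N'l: "N' \<le> 4 ^ l" .
    have EN: "N' powr (- \<tau>) = E" by (simp add: N'_def E_def powr_powr)
    have E0: "0 < E" using N by (simp add: E_def)
    have "l \<le> q * l" using q(1) by (cases q) auto
    then have L1: "J + l \<le> L" unfolding L_def by linarith
    have L2: "real L / 4 ^ L \<le> N' powr (- \<tau>)"
      unfolding EN E_def by (rule power_of_two_bound[OF q rN L_def])
    have X: "0 \<le> B2 * M" using B2(1) M by simp
    have GC: "GC z \<in> smooth_space w \<eta> t \<and> smooth_norm w \<eta> t (GC z) \<le> M" if "z \<in> OC" for z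
      using assms(13) that by blast
    have net: "\<exists>n m \<Phi> q. relu_net_dims n m \<Phi> \<and>
      real (relu_net_size \<Phi>) \<le> nK * 2 * N' * (90 * real L ^ 3 + 1) \<and>
      (\<forall>x. relu_net_eval \<Phi> (Matrix.vec n x) = Matrix.vec m (q x)) \<and>
      B2 * M * w m powr t \<le> E \<and>
      (\<forall>x. (\<lambda>i. sc i * x i) \<in> unit_cube \<longrightarrow>
        L2_set (\<lambda>j. Re (cinner_real (GC (of_real_part (\<Sum>i. (sc i * x i) *\<^sub>R u i))) (dual_frame \<eta> j)) - q x j) {..<m}
        \<le> 2 * E + nK * 2 * (M * exp 1 * (Cw powr t + w 0 powr t)) * N' powr (- \<tau>))"
      unfolding nK_def
      by (rule network_approximation[OF assms(11) GC w(1,2) weights_powr_tendsto_0[OF assms(3,6)] assms(6)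
            Cw(2,1) \<tau>(1,2) p_def sm R(1) R' J N'1 E0 X N'l L1 L2])
    obtain n m \<Phi> Q where dims: "relu_net_dims n m \<Phi>"
      and size: "real (relu_net_size \<Phi>) \<le> nK * 2 * N' * (90 * real L ^ 3 + 1)"
      and eval: "\<forall>x. relu_net_eval \<Phi> (Matrix.vec n x) = Matrix.vec m (Q x)"
      and tail: "B2 * M * w m powr t \<le> E"
      and err: "\<forall>x. (\<lambda>i. sc i * x i) \<in> unit_cube \<longrightarrow>
        L2_set (\<lambda>j. Re (cinner_real (GC (of_real_part (\<Sum>i. (sc i * x i) *\<^sub>R u i))) (dual_frame \<eta> j)) - Q x j) {..<m}
        \<le> 2 * E + nK * 2 * (M * exp 1 * (Cw powr t + w 0 powr t)) * N' powr (- \<tau>)"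
      using net by (elim exE conjE)
    have "real (relu_net_size \<Phi>) \<le> K * real N"
    proof -
      have "1 \<le> L" by (simp add: L_def)
      then have "1 \<le> real L ^ 3" by simp
      then have "nK * 2 * N' * (90 * real L ^ 3 + 1) \<le> nK * 2 * N' * (91 * real L ^ 3)"
        using N'1 by (intro mult_left_mono) (auto simp: nK_def)
      also have "\<dots> = nK * 2 * 91 * N' * real L ^ 3" by simp
      also have "\<dots> \<le> nK * 2 * 91 * N' * (Cl * real N powr (1 - g))"
        using l(2) N'1 unfolding L_def by (intro mult_left_mono) (auto simp: nK_def)
      also have "\<dots> = K * (real N powr g * real N powr (1 - g))"
        by (simp add: K_def N'_def mult_ac)
      also have "real N powr g * real N powr (1 - g) = real N"
        using N by (simp add: powr_add[symmetric])
      finally show ?thesis using size by simp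
    qed
    moreover have "norm (G a - decoder \<eta> (relu_net_ell2 n m \<Phi> (encoder \<psi> a)))
            \<le> C * real N powr (- min (s - 1) t + \<delta>)" if a: "a \<in> coeff_cube w \<psi> r s" for a
    proof -
      define x where "x = coord (encoder \<psi> a)"
      have x: "x j = inner a (dual_frame \<psi> j)" for j
        unfolding x_def encoder_def by (simp add: coord_to_ell2[OF frame_expansion(1)[OF assms(1)]])
      have y: "(\<lambda>i. sc i * x i) \<in> unit_cube"
      proof -
        have "\<bar>sc i * x i\<bar> \<le> 1" for i
        proof -
          have "\<bar>x i\<bar> * w i powr (- s) \<le> r" using a by (simp add: coeff_cube_def x)
          then show ?thesis using assms(4) by (simp add: sc_def abs_mult mult.commute divide_le_eq)
        qed
        then show ?thesis by (simp add: unit_cube_def abs_le_iff minus_le_iff)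
      qed
      have "(sc i * x i) *\<^sub>R u i = inner a (dual_frame \<psi> i) *\<^sub>R \<psi> i" for i
        using assms(4) w(1)[of i] by (simp add: sc_def u_def x powr_minus field_simps)
      \<comment> \<open>The frame expansion reconstructs \<open>a\<close> from its encoder output,
        so \<open>a\<close> lies in the cube image with the rescaled network input as its
        parameter.\<close>
      then have a_eq: "(\<Sum>i. (sc i * x i) *\<^sub>R u i) = a"
        using sums_unique[OF frame_expansion(2)[OF assms(1), of a]] by simp
      have "a \<in> cube_image w \<psi> r s"
        unfolding cube by (rule rev_image_eqI[OF y]) (simp only: a_eq)
      then have aO: "of_real_part a \<in> OC" and Ga: "GC (of_real_part a) = of_real_part (G a)"
        using in_OC assms(8,12) by auto
      have re: "Re (cinner_real (of_real_part (G a)) e) = inner (G a) e" for e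
        by (simp add: cinner_real_def of_real_part_def)
      have e: "L2_set (\<lambda>j. inner (G a) (dual_frame \<eta> j) - Q x j) {..<m} \<le> 2 * E + Z * E"
        using err[rule_format, OF y] unfolding a_eq Ga re EN Z_def .
      have rn: "relu_net_ell2 n m \<Phi> (encoder \<psi> a) = to_ell2 (\<lambda>i. if i < m then Q x i else 0)"
        unfolding relu_net_ell2_def x_def[symmetric] eval[rule_format]
        by (rule arg_cong[where f = to_ell2]) auto
      have "norm (G a - decoder \<eta> (relu_net_ell2 n m \<Phi> (encoder \<psi> a))) \<le>
          B2 * (L2_set (\<lambda>j. inner (G a) (dual_frame \<eta> j) - Q x j) {..<m} + w m powr t * M)"
        unfolding rn
        by (rule decoder_error[OF assms(2) _ B2(1) _ _ w(1,2) assms(6)])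
          (use B2(2) GC[OF aO] Ga in auto)
      also have "\<dots> \<le> B2 * (2 * E + Z * E) + E"
        using mult_left_mono[OF e, of B2] B2(1) tail by (simp add: distrib_left mult_ac)
      also have "\<dots> = C * E" by (simp add: C_def algebra_simps)
      also have "\<dots> \<le> C * real N powr (- min (s - 1) t + \<delta>)"
        unfolding E_def using rate rN \<open>0 < C\<close> by (intro mult_left_mono powr_mono) auto
      finally show ?thesis .
    qed
    ultimately show ?thesis using dims by blast
  qed
  then show ?thesis using \<open>0 < C\<close> by blast
qed

end
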